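(* Let $\Lambda$ be a string algebra whose underlying quiver is acyclic. Let $\mathfrak b$ be a band for $\Lambda$, $l\in\mathbb N^+$ and $\lambda\in\mathcal K^\times$. Then the band module $B(\mathfrak b,l,\lambda)$ is a brick if and only if $l=1$ and both pairs of crowns $(\mathcal W_{\mathsf{Ba}}(\mathfrak b),\mathcal W_{\mathsf{Ba}}(\mathfrak b))$ and $(\mathcal W_{\mathsf{Ba}}(\mathfrak b),\mathcal W_{\mathsf{Ba}}(\mathfrak b^{-1}))$ are weakly perfectly clustering.
   Context: $\mathcal K$ is an algebraically closed field. Paths are composed right to left ($\alpha\beta$ means first $\beta$, then $\alpha$). String algebra. $\Lambda=\mathcal KQ/\langle\rho\rangle$, where $Q=(Q_0,Q_1,s,t)$ is a finite quiver and $\rho$ a set of paths of length $\ge 2$ such that: (I) every vertex is the source of at most two arrows and the target of at most two arrows; (II) for every $\alpha\in Q_1$ there is at most one arrow $\beta$ with $s(\alpha)=t(\beta)$ and $\alpha\beta\notin\rho$, and at most one arrow $\beta'$ with $s(\beta')=t(\alpha)$ and $\beta'\alpha\notin\rho$; (III) there is a bound on the lengths of paths having no subpath in $\rho$. $Q$ is acyclic if it has no directed cycle. Signs. Fix maps $\varsigma,\varepsilon:Q_1\to\{-1,1\}$ such that: distinct arrows $\alpha,\beta$ with the same source have $\varsigma(\alpha)=-\varsigma(\beta)$; distinct arrows with the same target have $\varepsilon(\alpha)=-\varepsilon(\beta)$; if $s(\alpha)=t(\beta)$ and $\alpha\beta\notin\rho$ then $\varsigma(\alpha)=-\varepsilon(\beta)$.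 For formal inverses put $s(\alpha^{-1})=t(\alpha)$, $t(\alpha^{-1})=s(\alpha)$, $\varsigma(\alpha^{-1})=\varepsilon(\alpha)$, $\varepsilon(\alpha^{-1})=\varsigma(\alpha)$. Elements of $Q_1$ (direct) and $Q_1^{-1}$ (inverse) are called syllables. Strings and bands. A positive-length string is a sequence of syllables $\alpha_k\cdots\alpha_1$ with $t(\alpha_i)=s(\alpha_{i+1})$, $\alpha_i\ne\alpha_{i+1}^{-1}$, and such that no consecutive subsequence $\alpha_{i+j}\cdots\alpha_i$ nor its inverse $\alpha_i^{-1}\cdots\alpha_{i+j}^{-1}$ lies in $\rho$. Its inverse is $\alpha_1^{-1}\cdots\alpha_k^{-1}$. A band is a positive-length string $\mathfrak b$ with $s(\mathfrak b)=t(\mathfrak b)$, all powers $\mathfrak b^m$ ($m\ge1$) strings, $\mathfrak b$ not of the form $\mathfrak u^m$ with $m\ge2$, first (rightmost) syllable inverse and last (leftmost) syllable direct. If $\mathfrak b$ is a band so is $\mathfrak b^{-1}$. Band module. For a band $\mathfrak b=\alpha_k\cdots\alpha_1$ let $u_0=s(\alpha_1)$, $u_j=t(\alpha_j)$ (so $u_k=u_0$). $B(\mathfrak b,l,\lambda)$ is the usual band module: place a copy $V_j$ of $\mathcal K^l$ at $u_j$ for each $j\in\mathbb Z/k$; if $\alpha_j$ is direct it maps $V_{j-1}\to V_j$, if $\alpha_j=\beta^{-1}$ then $\beta$ maps $V_j\to V_{j-1}$; one of these maps is the $l\times l$ Jordan block with eigenvalue $\lambda$, the others are identities, all other components of arrows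 are zero. A brick is a module whose endomorphism algebra is isomorphic to $\mathcal K$. Ordered alphabet. Let $A=Q_0\times\{-1,1\}$. For a syllable $\alpha$ put $\overline s(\alpha)=(s(\alpha),-\varsigma(\alpha))$ and $\overline t(\alpha)=(t(\alpha),\varepsilon(\alpha))$. Let $<$ be the transitive closure of the relation: $p<q$ if there is $\alpha\in Q_1$ with ($\overline s(\alpha)=q$ and $\overline t(\alpha)=p$) or ($\overline s(\alpha^{-1})=p$ and $\overline t(\alpha^{-1})=q$). As $Q$ is acyclic, $<$ is a strict partial order on $A$. Traces. For $p,q\in A$ there is at most one positive-length string $\mathfrak z=\alpha_k\cdots\alpha_1$ with all syllables direct or all syllables inverse such that $\overline s(\alpha_1)=p$ and $\overline t(\alpha_k)=q$. If it exists, $T_{(p,q)}$ is the sequence $\langle p,\overline s(\alpha_2),\dots,\overline s(\alpha_k),q\rangle$; otherwise $T_{(p,q)}$ is empty. Intersections of traces are intersections of their sets of terms. The word of a band. Write a band uniquely as $\mathfrak b=\mathfrak x_{k}\cdots\mathfrak x_1$, where each $\mathfrak x_i$ is a positive-length string whose syllables are all direct or all inverse, and $\mathfrak x_i,\mathfrak x_{i+1}$ have opposite types. Then $\mathcal W_{\mathsf{Ba}}(\mathfrak b):=n_1n_2\cdots n_k$, where $n_i=\overline s(\text{first (rightmost) syllable of }\mathfrak x_i)\in A$. Words over $A$ are read left to right; $\mathcal W_{\mathsf{Ba}}(\mathfrak b)$ is a crown, i.e. it and all its cyclic permutations are zigzags (consecutive letters alternately strictly increase and decrease). Weakly perfectly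 clustering pair. A pair $(\mathsf w_1,\mathsf w_2)$ of crowns is weakly perfectly clustering if neither of the following happens. (1) There are cyclic permutations $\mathsf w'=n'\mathsf z m'\mathsf z'$ of $\mathsf w_1^{2|\mathsf w_2|}$ and $\mathsf w''=n''\mathsf z m''\mathsf z''$ of $\mathsf w_2^{2|\mathsf w_1|}$ ($n',m',n'',m''$ letters; $\mathsf z,\mathsf z',\mathsf z''$ words) with $n'<n''$, $m'<m''$, $|\mathsf z|\ge1$. (2) There are cyclic permutations $\mathsf w'=n'm'\mathsf z'$ of $\mathsf w_1^{2|\mathsf w_2|}$ and $\mathsf w''=n''m''\mathsf z''$ of $\mathsf w_2^{2|\mathsf w_1|}$ with $n'<n''$, $m'<m''$, ($n'<m'$ if and only if $n''<m''$), and $T_{(n',m')}\cap T_{(n'',m'')}\ne\emptyset$. *)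

theory Defs
  imports
    "HOL-Algebra.Module"
    "HOL-Algebra.QuotRing"
    "HOL-Computational_Algebra.Polynomial"
    "HOL-Library.Function_Algebras"
    "HOL-Library.Sublist"
    "Graph_Theory.Arc_Walk"
    "Jordan_Normal_Form.Jordan_Normal_Form"
begin

section \<open>String algebras\<close>

text \<open>
  A finite quiver is a \<^locale>\<open>fin_digraph\<close> (parallel arrows allowed), with source \<^term>\<open>tail Q\<close>
  and target \<^term>\<open>head Q\<close>.
  Paths, strings and all other sequences are lists in order of traversal: the path
  \<open>\<alpha>\<^sub>k \<cdots> \<alpha>\<^sub>1\<close>, composed from right to left, is the list \<open>[\<alpha>\<^sub>1, \<dots>, \<alpha>\<^sub>k]\<close>.
  In particular the path \<open>\<alpha> \<beta>\<close> is \<open>[\<beta>, \<alpha>]\<close>.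
\<close>

definition quiver_path :: "('v, 'a) pre_digraph \<Rightarrow> 'a list \<Rightarrow> bool" where
  "quiver_path Q p \<longleftrightarrow> (\<exists>u v. pre_digraph.awalk Q u p v)"

definition acyclic_quiver :: "('v, 'a) pre_digraph \<Rightarrow> bool" where
  "acyclic_quiver Q \<longleftrightarrow> (\<nexists>p. pre_digraph.cycle Q p)"

text \<open>
  The pair \<open>(Q, \<rho>)\<close> presents the string algebra \<open>K Q / \<langle>\<rho>\<rangle>\<close>.
\<close>

definition string_algebra :: "('v, 'a) pre_digraph \<Rightarrow> 'a list set \<Rightarrow> bool" where
  "string_algebra Q \<rho> \<longleftrightarrow>
     fin_digraph Q \<and>
     (\<forall>r\<in>\<rho>. quiver_path Q r \<and> length r \<ge> 2) \<and>
     (\<forall>v\<in>verts Q. card (out_arcs Q v) \<le> 2 \<and> card (in_arcs Q v) \<le> 2) \<and>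
     (\<forall>\<alpha>\<in>arcs Q.
        card {\<beta> \<in> arcs Q. tail Q \<alpha> = head Q \<beta> \<and> [\<beta>, \<alpha>] \<notin> \<rho>} \<le> 1 \<and>
        card {\<beta> \<in> arcs Q. tail Q \<beta> = head Q \<alpha> \<and> [\<alpha>, \<beta>] \<notin> \<rho>} \<le> 1) \<and>
     (\<exists>N. \<forall>p. quiver_path Q p \<and> (\<forall>r\<in>\<rho>. \<not> sublist r p) \<longrightarrow> length p \<le> N)"

definition sign_maps ::
  "('v, 'a) pre_digraph \<Rightarrow> 'a list set \<Rightarrow> ('a \<Rightarrow> int) \<Rightarrow> ('a \<Rightarrow> int) \<Rightarrow> bool" where
  "sign_maps Q \<rho> \<sigma> \<epsilon> \<longleftrightarrow>
     (\<forall>\<alpha>\<in>arcs Q. \<sigma> \<alpha> \<in> {-1, 1} \<and> \<epsilon> \<alpha> \<in> {-1, 1}) \<and>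
     (\<forall>\<alpha>\<in>arcs Q. \<forall>\<beta>\<in>arcs Q.
        (\<alpha> \<noteq> \<beta> \<and> tail Q \<alpha> = tail Q \<beta> \<longrightarrow> \<sigma> \<alpha> = - \<sigma> \<beta>) \<and>
        (\<alpha> \<noteq> \<beta> \<and> head Q \<alpha> = head Q \<beta> \<longrightarrow> \<epsilon> \<alpha> = - \<epsilon> \<beta>) \<and>
        (tail Q \<alpha> = head Q \<beta> \<and> [\<beta>, \<alpha>] \<notin> \<rho> \<longrightarrow> \<sigma> \<alpha> = - \<epsilon> \<beta>))"


section \<open>Strings and bands\<close>

datatype 'a syllable = Dir (arrow: 'a) | Inv (arrow: 'a)

definition direct :: "'a syllable \<Rightarrow> bool" where
  "direct x \<longleftrightarrow> (\<exists>\<alpha>. x = Dir \<alpha>)"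

fun syl_inv :: "'a syllable \<Rightarrow> 'a syllable" where
  "syl_inv (Dir \<alpha>) = Inv \<alpha>"
| "syl_inv (Inv \<alpha>) = Dir \<alpha>"

fun syl_src :: "('v, 'a) pre_digraph \<Rightarrow> 'a syllable \<Rightarrow> 'v" where
  "syl_src Q (Dir \<alpha>) = tail Q \<alpha>"
| "syl_src Q (Inv \<alpha>) = head Q \<alpha>"

fun syl_tgt :: "('v, 'a) pre_digraph \<Rightarrow> 'a syllable \<Rightarrow> 'v" where
  "syl_tgt Q (Dir \<alpha>) = head Q \<alpha>"
| "syl_tgt Q (Inv \<alpha>) = tail Q \<alpha>"

definition word_inv :: "'a syllable list \<Rightarrow> 'a syllable list" where
  "word_inv w = rev (map syl_inv w)"

definition is_string :: "('v, 'a) pre_digraph \<Rightarrow> 'a list set \<Rightarrow> 'a syllable list \<Rightarrow> bool" where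
  "is_string Q \<rho> w \<longleftrightarrow>
     w \<noteq> [] \<and>
     arrow ` set w \<subseteq> arcs Q \<and>
     (\<forall>i. Suc i < length w \<longrightarrow>
        syl_tgt Q (w ! i) = syl_src Q (w ! Suc i) \<and> w ! i \<noteq> syl_inv (w ! Suc i)) \<and>
     (\<forall>u. sublist u w \<longrightarrow> u \<notin> map Dir ` \<rho> \<and> word_inv u \<notin> map Dir ` \<rho>)"

definition word_pow :: "nat \<Rightarrow> 'c list \<Rightarrow> 'c list" where
  "word_pow m w = concat (replicate m w)"

definition is_band :: "('v, 'a) pre_digraph \<Rightarrow> 'a list set \<Rightarrow> 'a syllable list \<Rightarrow> bool" where
  "is_band Q \<rho> b \<longleftrightarrow>
     is_string Q \<rho> b \<and>
     syl_src Q (hd b) = syl_tgt Q (last b) \<and>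
     (\<forall>m\<ge>1. is_string Q \<rho> (word_pow m b)) \<and>
     (\<nexists>u m. m \<ge> 2 \<and> b = word_pow m u) \<and>
     \<not> direct (hd b) \<and> direct (last b)"


section \<open>Representations and bricks\<close>

text \<open>
  Modules over \<open>K Q / \<langle>\<rho>\<rangle>\<close> are representations of \<open>Q\<close> in which the paths in \<open>\<rho>\<close> act as zero.
  The vertex spaces are subspaces of one ambient \<open>K\<close>-vector space, whose scalar
  multiplication is \<open>rep_scale\<close>.
\<close>

record ('v, 'a, 'k, 'm) rep =
  rep_scale :: "'k \<Rightarrow> 'm \<Rightarrow> 'm"
  rep_space :: "'v \<Rightarrow> 'm set"
  rep_map :: "'a \<Rightarrow> 'm \<Rightarrow> 'm"

definition linear_between ::
  "('k \<Rightarrow> 'm \<Rightarrow> 'm::ab_group_add) \<Rightarrow> 'm set \<Rightarrow> 'm set \<Rightarrow> ('m \<Rightarrow> 'm) \<Rightarrow> bool" where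
  "linear_between scale U V f \<longleftrightarrow>
     f ` U \<subseteq> V \<and>
     (\<forall>x\<in>U. \<forall>y\<in>U. f (x + y) = f x + f y) \<and>
     (\<forall>c. \<forall>x\<in>U. f (scale c x) = scale c (f x))"

definition is_rep ::
  "('v, 'a) pre_digraph \<Rightarrow> 'a list set \<Rightarrow> ('v, 'a, 'k::field, 'm::ab_group_add) rep \<Rightarrow> bool" where
  "is_rep Q \<rho> M \<longleftrightarrow>
     vector_space (rep_scale M) \<and>
     (\<forall>v\<in>verts Q. Modules.module.subspace (rep_scale M) (rep_space M v)) \<and>
     (\<forall>\<alpha>\<in>arcs Q. linear_between (rep_scale M)
        (rep_space M (tail Q \<alpha>)) (rep_space M (head Q \<alpha>)) (rep_map M \<alpha>)) \<and>
     (\<forall>r\<in>\<rho>. \<forall>x \<in> rep_space M (tail Q (hd r)). fold (rep_map M) r x = 0)"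

definition endos ::
  "('v, 'a) pre_digraph \<Rightarrow> ('v, 'a, 'k, 'm::ab_group_add) rep \<Rightarrow> ('v \<Rightarrow> 'm \<Rightarrow> 'm) set" where
  "endos Q M =
     {\<phi> \<in> (\<Pi>\<^sub>E v\<in>verts Q. rep_space M v \<rightarrow>\<^sub>E rep_space M v).
        (\<forall>v\<in>verts Q. linear_between (rep_scale M) (rep_space M v) (rep_space M v) (\<phi> v)) \<and>
        (\<forall>\<alpha>\<in>arcs Q. \<forall>x \<in> rep_space M (tail Q \<alpha>).
           \<phi> (head Q \<alpha>) (rep_map M \<alpha> x) = rep_map M \<alpha> (\<phi> (tail Q \<alpha>) x))}"

text \<open>
  The records \<^typ>\<open>('k, 'e) module\<close> serve as carriers of \<open>K\<close>-algebra structures.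
\<close>

definition endo_algebra ::
  "('v, 'a) pre_digraph \<Rightarrow> ('v, 'a, 'k, 'm::ab_group_add) rep \<Rightarrow> ('k, 'v \<Rightarrow> 'm \<Rightarrow> 'm) module" where
  "endo_algebra Q M =
     \<lparr>carrier = endos Q M,
      monoid.mult = (\<lambda>\<phi> \<psi>. \<lambda>v\<in>verts Q. \<lambda>x\<in>rep_space M v. \<phi> v (\<psi> v x)),
      one = (\<lambda>v\<in>verts Q. \<lambda>x\<in>rep_space M v. x),
      zero = (\<lambda>v\<in>verts Q. \<lambda>x\<in>rep_space M v. 0),
      add = (\<lambda>\<phi> \<psi>. \<lambda>v\<in>verts Q. \<lambda>x\<in>rep_space M v. \<phi> v x + \<psi> v x),
      module.smult = (\<lambda>c \<phi>. \<lambda>v\<in>verts Q. \<lambda>x\<in>rep_space M v. rep_scale M c (\<phi> v x))\<rparr>"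

definition ground_algebra :: "('k::field, 'k) module" where
  "ground_algebra =
     \<lparr>carrier = UNIV, monoid.mult = (*), one = 1, zero = 0, add = (+), module.smult = (*)\<rparr>"

definition algebra_iso ::
  "('k, 'b) module \<Rightarrow> ('k, 'c) module \<Rightarrow> ('b \<Rightarrow> 'c) set" where
  "algebra_iso A B =
     {h \<in> ring_iso A B. \<forall>c. \<forall>x\<in>carrier A. h (c \<odot>\<^bsub>A\<^esub> x) = c \<odot>\<^bsub>B\<^esub> h x}"

definition is_brick ::
  "('v, 'a) pre_digraph \<Rightarrow> 'a list set \<Rightarrow> ('v, 'a, 'k::field, 'm::ab_group_add) rep \<Rightarrow> bool" where
  "is_brick Q \<rho> M \<longleftrightarrow> is_rep Q \<rho> M \<and> algebra_iso (endo_algebra Q M) ground_algebra \<noteq> {}"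


section \<open>Band modules\<close>

text \<open>
  For \<open>b = [\<alpha>\<^sub>1, \<dots>, \<alpha>\<^sub>k]\<close> the syllable \<open>b ! q\<close> joins the copies \<open>V\<^sub>q\<close> and \<open>V\<^sub>q\<^sub>+\<^sub>1\<close> of \<open>K\<^sup>l\<close>
  (indices modulo \<open>k\<close>), and \<open>V\<^sub>q\<close> sits at the vertex \<open>syl_src Q (b ! q)\<close>.
  The arrow of \<open>b ! q\<close> maps the copy \<open>arrow_from b q\<close> to the copy \<open>arrow_to b q\<close>.
\<close>

definition arrow_from :: "'a syllable list \<Rightarrow> nat \<Rightarrow> nat" where
  "arrow_from b q = (if direct (b ! q) then q else Suc q mod length b)"

definition arrow_to :: "'a syllable list \<Rightarrow> nat \<Rightarrow> nat" where
  "arrow_to b q = (if direct (b ! q) then Suc q mod length b else q)"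

text \<open>
  The parameter \<open>p\<close> is the position of the syllable carrying the Jordan block.
  A vector \<open>x\<close> has the \<open>i\<close>-th coordinate \<open>x j i\<close> in the copy \<open>V\<^sub>j\<close>, where \<open>j < k\<close> and \<open>i < l\<close>.
\<close>

definition band_module ::
  "('v, 'a) pre_digraph \<Rightarrow> 'a syllable list \<Rightarrow> nat \<Rightarrow> 'k::field \<Rightarrow> nat \<Rightarrow>
     ('v, 'a, 'k, nat \<Rightarrow> nat \<Rightarrow> 'k) rep" where
  "band_module Q b l \<mu> p =
     \<lparr>rep_scale = (\<lambda>c x j i. c * x j i),
      rep_space = (\<lambda>v. {x. \<forall>j i. x j i \<noteq> 0 \<longrightarrow> j < length b \<and> i < l \<and> syl_src Q (b ! j) = v}),
      rep_map = (\<lambda>\<alpha> x j i.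
        if i < l then
          \<Sum>q | q < length b \<and> arrow (b ! q) = \<alpha> \<and> arrow_to b q = j.
            ((if q = p then jordan_block l \<mu> else 1\<^sub>m l) *\<^sub>v vec l (x (arrow_from b q))) $ i
        else 0)\<rparr>"


section \<open>The ordered alphabet, traces, and the word of a band\<close>

fun syl_sgn :: "('a \<Rightarrow> int) \<Rightarrow> ('a \<Rightarrow> int) \<Rightarrow> 'a syllable \<Rightarrow> int" where
  "syl_sgn \<sigma> \<epsilon> (Dir \<alpha>) = \<sigma> \<alpha>"
| "syl_sgn \<sigma> \<epsilon> (Inv \<alpha>) = \<epsilon> \<alpha>"

fun syl_eps :: "('a \<Rightarrow> int) \<Rightarrow> ('a \<Rightarrow> int) \<Rightarrow> 'a syllable \<Rightarrow> int" where
  "syl_eps \<sigma> \<epsilon> (Dir \<alpha>) = \<epsilon> \<alpha>"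
| "syl_eps \<sigma> \<epsilon> (Inv \<alpha>) = \<sigma> \<alpha>"

type_synonym 'v letter = "'v \<times> int"

definition src_letter ::
  "('v, 'a) pre_digraph \<Rightarrow> ('a \<Rightarrow> int) \<Rightarrow> ('a \<Rightarrow> int) \<Rightarrow> 'a syllable \<Rightarrow> 'v letter" where
  "src_letter Q \<sigma> \<epsilon> x = (syl_src Q x, - syl_sgn \<sigma> \<epsilon> x)"

definition tgt_letter ::
  "('v, 'a) pre_digraph \<Rightarrow> ('a \<Rightarrow> int) \<Rightarrow> ('a \<Rightarrow> int) \<Rightarrow> 'a syllable \<Rightarrow> 'v letter" where
  "tgt_letter Q \<sigma> \<epsilon> x = (syl_tgt Q x, syl_eps \<sigma> \<epsilon> x)"

definition letter_rel ::
  "('v, 'a) pre_digraph \<Rightarrow> ('a \<Rightarrow> int) \<Rightarrow> ('a \<Rightarrow> int) \<Rightarrow> ('v letter \<times> 'v letter) set" where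
  "letter_rel Q \<sigma> \<epsilon> =
     {(p, q). \<exists>\<alpha>\<in>arcs Q.
        (src_letter Q \<sigma> \<epsilon> (Dir \<alpha>) = q \<and> tgt_letter Q \<sigma> \<epsilon> (Dir \<alpha>) = p) \<or>
        (src_letter Q \<sigma> \<epsilon> (Inv \<alpha>) = p \<and> tgt_letter Q \<sigma> \<epsilon> (Inv \<alpha>) = q)}"

definition letter_less ::
  "('v, 'a) pre_digraph \<Rightarrow> ('a \<Rightarrow> int) \<Rightarrow> ('a \<Rightarrow> int) \<Rightarrow> 'v letter \<Rightarrow> 'v letter \<Rightarrow> bool" where
  "letter_less Q \<sigma> \<epsilon> p q \<longleftrightarrow> (p, q) \<in> (letter_rel Q \<sigma> \<epsilon>)\<^sup>+"

definition trace_string ::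
  "('v, 'a) pre_digraph \<Rightarrow> 'a list set \<Rightarrow> ('a \<Rightarrow> int) \<Rightarrow> ('a \<Rightarrow> int) \<Rightarrow>
     'v letter \<Rightarrow> 'v letter \<Rightarrow> 'a syllable list \<Rightarrow> bool" where
  "trace_string Q \<rho> \<sigma> \<epsilon> p q z \<longleftrightarrow>
     is_string Q \<rho> z \<and>
     ((\<forall>x\<in>set z. direct x) \<or> (\<forall>x\<in>set z. \<not> direct x)) \<and>
     src_letter Q \<sigma> \<epsilon> (hd z) = p \<and> tgt_letter Q \<sigma> \<epsilon> (last z) = q"

text \<open>
  When \<open>Q\<close> is acyclic, the string in \<open>letter_trace\<close> is unique: the signs determine each
  successive syllable, and no trace passes through a letter twice.
\<close>

definition letter_trace ::
  "('v, 'a) pre_digraph \<Rightarrow> 'a list set \<Rightarrow> ('a \<Rightarrow> int) \<Rightarrow> ('a \<Rightarrow> int) \<Rightarrow>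
     'v letter \<Rightarrow> 'v letter \<Rightarrow> 'v letter list" where
  "letter_trace Q \<rho> \<sigma> \<epsilon> p q =
     (if \<exists>z. trace_string Q \<rho> \<sigma> \<epsilon> p q z
      then map (src_letter Q \<sigma> \<epsilon>) (THE z. trace_string Q \<rho> \<sigma> \<epsilon> p q z) @ [q]
      else [])"

function blocks :: "'a syllable list \<Rightarrow> 'a syllable list list" where
  "blocks [] = []"
| "blocks (x # xs) =
     (x # takeWhile (\<lambda>y. direct y = direct x) xs) # blocks (dropWhile (\<lambda>y. direct y = direct x) xs)"
  by pat_completeness auto
termination
  by (relation "measure length") (simp_all add: le_imp_less_Suc length_dropWhile_le)

definition band_word ::
  "('v, 'a) pre_digraph \<Rightarrow> ('a \<Rightarrow> int) \<Rightarrow> ('a \<Rightarrow> int) \<Rightarrow> 'a syllable list \<Rightarrow> 'v letter list" where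
  "band_word Q \<sigma> \<epsilon> b = map (\<lambda>x. src_letter Q \<sigma> \<epsilon> (hd x)) (blocks b)"


section \<open>Weakly perfectly clustering pairs\<close>

definition cyclic_perms :: "'c list \<Rightarrow> 'c list set" where
  "cyclic_perms w = {rotate i w | i. True}"

definition weakly_perfectly_clustering ::
  "('v, 'a) pre_digraph \<Rightarrow> 'a list set \<Rightarrow> ('a \<Rightarrow> int) \<Rightarrow> ('a \<Rightarrow> int) \<Rightarrow>
     'v letter list \<Rightarrow> 'v letter list \<Rightarrow> bool" where
  "weakly_perfectly_clustering Q \<rho> \<sigma> \<epsilon> w1 w2 \<longleftrightarrow>
     \<not> (\<exists>n' m' n'' m'' z z' z''.
          n' # z @ m' # z' \<in> cyclic_perms (word_pow (2 * length w2) w1) \<and>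
          n'' # z @ m'' # z'' \<in> cyclic_perms (word_pow (2 * length w1) w2) \<and>
          letter_less Q \<sigma> \<epsilon> n' n'' \<and> letter_less Q \<sigma> \<epsilon> m' m'' \<and> length z \<ge> 1) \<and>
     \<not> (\<exists>n' m' n'' m'' z' z''.
          n' # m' # z' \<in> cyclic_perms (word_pow (2 * length w2) w1) \<and>
          n'' # m'' # z'' \<in> cyclic_perms (word_pow (2 * length w1) w2) \<and>
          letter_less Q \<sigma> \<epsilon> n' n'' \<and> letter_less Q \<sigma> \<epsilon> m' m'' \<and>
          (letter_less Q \<sigma> \<epsilon> n' m' \<longleftrightarrow> letter_less Q \<sigma> \<epsilon> n'' m'') \<and>
          set (letter_trace Q \<rho> \<sigma> \<epsilon> n' m') \<inter> set (letter_trace Q \<rho> \<sigma> \<epsilon> n'' m'') \<noteq> {})"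

end

(*
  A graph map from a band module to itself matches a factor substring of the band (preceded by an inverse
  and followed by a direct syllable) with an equal submodule substring of the band or of its inverse
  (preceded by a direct and followed by an inverse syllable). Call such a match a crossing of the two
  bi-infinite periodic words. Direct syllables strictly decrease letters, inverse ones
  increase them, and a letter together with a direction determines the next syllable. Hence a crossing
  containing a common turning point is the same thing as the first forbidden pattern in the words of the
  bands (the common turning points form the word z), and a crossing inside a single direct or inverse
  run is the same thing as the second one.

  If the Jordan block has size at least two, its nilpotent part is a non-scalar endomorphism. For size
  one, a crossing spans less than one period, so it defines a non-scalar endomorphism. Conversely,
  commuting with the arrows links the matrix entry of an endomorphism at two positions to the entries
  at the neighbouring positions as long as the words agree there; at the ends of the maximal agreement
  it forces the entry to vanish unless the match is a crossing. Agreement never continues forever,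
  since a band is primitive and is not a rotation of its inverse. So without crossings all off-diagonal
  entries vanish, and all diagonal entries are equal.
*)

theory Submission
  imports Defs
begin

section \<open>Periodic sequences\<close>

text \<open>A band is unrolled to a function on the integers, so that rotations become shifts;
  positions that are congruent modulo the length stand for the same copy of the field. Every
  position t carries one letter, \<open>src (X t)\<close>, which is also the target letter of the
  syllable before it, and a vertex has exactly two letters, exchanged by \<open>flip\<close>.

  This is why two pairs of crowns occur: two positions at the same vertex carry either the same
  letter, and then the band is compared with itself, or opposite letters, and then it is compared
  with its inverse. The exponents 2|w2| and 2|w1| only leave room for a pattern: a common word z as
  long as the common period |w1||w2| would force n' = n''.

  A crossing is split into a left and a right half, because the order of two turning letters
  controls just one end of a match. The halves are glued at any pair of positions inside it.

  To treat the band and its inverse together, the module side works with an abstract orientation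
  \<open>Y\<close>, \<open>\<pi>\<close>, \<open>w\<close>, of which reading forwards and reading
  backwards are the two instances.\<close>

definition per :: "'c list \<Rightarrow> int \<Rightarrow> 'c" where
  "per w t = w ! nat (t mod int (length w))"

lemma length_word_pow [simp]: "length (word_pow m w) = m * length w"
  by (simp add: word_pow_def length_concat sum_list_replicate)

lemma word_pow_Suc: "word_pow (Suc m) w = w @ word_pow m w"
  by (simp add: word_pow_def)

lemma nth_word_pow: "i < m * length w \<Longrightarrow> word_pow m w ! i = w ! (i mod length w)"
proof (induction m arbitrary: i)
  case (Suc m)
  show ?case
  proof (cases "i < length w")
    case False
    then have "word_pow (Suc m) w ! i = word_pow m w ! (i - length w)"
      by (simp add: word_pow_Suc nth_append)
    also have "\<dots> = w ! ((i - length w) mod length w)"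
      using Suc False by simp
    finally show ?thesis
      using False by (simp add: mod_if)
  qed (simp add: word_pow_Suc nth_append)
qed simp

lemma per_of_nat: "per w (int i) = w ! (i mod length w)"
  by (simp add: per_def flip: of_nat_mod)

lemma per_mod_eq: "s mod int (length w) = t mod int (length w) \<Longrightarrow> per w s = per w t"
  by (simp add: per_def)

section \<open>Factors of bi-infinite periodic words\<close>

definition window :: "(int \<Rightarrow> 'c) \<Rightarrow> int \<Rightarrow> nat \<Rightarrow> 'c list" where
  "window X t n = map (\<lambda>i. X (t + int i)) [0..<n]"

lemma length_window [simp]: "length (window X t n) = n"
  by (simp add: window_def)

lemma nth_window [simp]: "i < n \<Longrightarrow> window X t n ! i = X (t + int i)"
  by (simp add: window_def)

lemma window_0 [simp]: "window X t 0 = []"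
  by (simp add: window_def)

lemma window_Suc: "window X t (Suc n) = window X t n @ [X (t + int n)]"
  by (simp add: window_def)

lemma window_Suc_left: "window X t (Suc n) = X t # window X (t + 1) n"
  by (rule nth_equalityI) (auto simp: nth_Cons algebra_simps split: nat.split)

lemma window_add: "window X t (m + n) = window X t m @ window X (t + int m) n"
  by (rule nth_equalityI) (auto simp: nth_append algebra_simps)

text \<open>The start is reduced modulo the period, hence is below |w|, and n is at most n|w|; so n
  + 1 copies of w contain the whole window. This exhibits windows of a band as sublists of its
  powers, which are strings.\<close>

lemma window_per_eq:
  assumes "w \<noteq> []"
  shows "window (per w) t n = take n (drop (nat (t mod int (length w))) (word_pow (Suc n) w))"
    (is "_ = take n (drop ?i _)")
proof -
  let ?k = "length w"
  have i: "?i < ?k"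
    using assms by (simp add: nat_less_iff)
  have len: "?i + n \<le> Suc n * ?k"
  proof -
    have "n * 1 \<le> n * ?k"
      using i by (intro mult_le_mono) auto
    with i show ?thesis unfolding mult_Suc by linarith
  qed
  show ?thesis
  proof (rule nth_equalityI)
    fix j assume "j < length (window (per w) t n)"
    then have j: "j < n" by simp
    have "per w (t + int j) = per w (int (?i + j))"
      using assms by (intro per_mod_eq) (simp add: mod_add_left_eq)
    then show "window (per w) t n ! j = take n (drop ?i (word_pow (Suc n) w)) ! j"
      using j len nth_word_pow[of "?i + j" "Suc n" w]
      by (simp add: per_of_nat del: of_nat_add)
  qed (use len in simp)
qed

text \<open>Rotating by i means starting the periodic sequence at i, so choosing a cyclic
  permutation becomes choosing an integer.\<close>

lemma cyclic_perms_word_pow: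
  assumes "w \<noteq> []"
  shows "cyclic_perms (word_pow n w) = {window (per w) a (n * length w) | a. True}"
proof (intro equalityI subsetI)
  fix v assume "v \<in> cyclic_perms (word_pow n w)"
  then obtain i where v: "v = rotate i (word_pow n w)"
    by (auto simp: cyclic_perms_def)
  have "v = window (per w) (int i) (n * length w)"
  proof (rule nth_equalityI)
    fix j assume "j < length v"
    then have j: "j < n * length w" by (simp add: v)
    have "v ! j = word_pow n w ! ((i + j) mod (n * length w))"
      using j by (simp add: v nth_rotate)
    also have "\<dots> = w ! ((i + j) mod length w)"
      using j by (subst nth_word_pow) (auto simp: mod_mod_cancel intro!: mod_less_divisor intro: gr0I)
    also have "\<dots> = window (per w) (int i) (n * length w) ! j"
      using j by (simp add: per_of_nat flip: of_nat_add)
    finally show "v ! j = window (per w) (int i) (n * length w) ! j" .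
  qed (simp add: v)
  then show "v \<in> {window (per w) a (n * length w) | a. True}"
    by blast
next
  fix v assume "v \<in> {window (per w) a (n * length w) | a. True}"
  then obtain a where v: "v = window (per w) a (n * length w)" by blast
  define i where "i = nat (a mod int (length w))"
  have "v = rotate i (word_pow n w)"
  proof (rule nth_equalityI)
    fix j assume "j < length v"
    then have j: "j < n * length w" by (simp add: v)
    have "v ! j = per w (int (i + j))"
      using j assms by (auto simp: v i_def mod_add_left_eq intro!: per_mod_eq)
    also have "\<dots> = w ! ((i + j) mod length w)"
      by (simp add: per_of_nat del: of_nat_add)
    also have "\<dots> = word_pow n w ! ((i + j) mod (n * length w))"
      using j by (subst nth_word_pow) (auto simp: mod_mod_cancel intro!: mod_less_divisor intro: gr0I)
    also have "\<dots> = rotate i (word_pow n w) ! j"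
      using j by (simp add: nth_rotate)
    finally show "v ! j = rotate i (word_pow n w) ! j" .
  qed (simp add: v)
  then show "v \<in> cyclic_perms (word_pow n w)"
    by (auto simp: cyclic_perms_def)
qed

text \<open>By Bezout the gcd g of d and |w| is again a period. So w is a power of its prefix of
  length g, and primitivity forces g = |w|.\<close>

lemma per_period_dvd:
  assumes w: "w \<noteq> []" and prim: "\<nexists>u m. m \<ge> 2 \<and> w = word_pow m u"
    and period: "\<And>t. per w (t + d) = per w t"
  shows "int (length w) dvd d"
proof -
  let ?k = "int (length w)"
  have mult: "per w (t + int m * d) = per w t" for t m
  proof (induction m)
    case (Suc m)
    have "t + int (Suc m) * d = (t + int m * d) + d"
      by (simp add: algebra_simps)
    with Suc period show ?case by metis
  qed simp
  have multi: "per w (t + x * d) = per w t" for t x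
  proof (cases "x \<ge> 0")
    case True
    then show ?thesis using mult[of t "nat x"] by simp
  next
    case False
    then show ?thesis using mult[of "t + x * d" "nat (- x)"] by (simp add: algebra_simps)
  qed
  define g where "g = gcd d ?k"
  have g: "g > 0" "g dvd ?k" "g dvd d"
    using w by (auto simp: g_def)
  have perg: "per w (t + y * g) = per w t" for t y
  proof -
    obtain p q where pq: "p * d + q * ?k = g"
      unfolding g_def using bezout_int by blast
    have "per w (t + y * g) = per w (t + (y * p) * d + (y * q) * ?k)"
      unfolding pq[symmetric] by (simp add: algebra_simps)
    also have "\<dots> = per w (t + (y * p) * d)"
      by (intro per_mod_eq) simp
    finally show ?thesis by (simp add: multi)
  qed
  define m where "m = length w div nat g"
  have m: "m * nat g = length w"
    using g by (simp add: m_def nat_dvd_iff dvd_div_mult_self)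
  have "w = word_pow m (take (nat g) w)"
  proof (rule nth_equalityI)
    have "nat g \<le> length w"
      using m w by (cases m) auto
    then have len: "length (take (nat g) w) = nat g"
      by simp
    show "length w = length (word_pow m (take (nat g) w))"
      using m by (simp only: length_word_pow len)
    fix i assume i: "i < length w"
    have "w ! i = per w (int i)"
      using i by (simp add: per_of_nat)
    also have "int i = int (i mod nat g) + int (i div nat g) * g"
      using g by (metis add.commute div_mult_mod_eq int_nat_eq less_imp_le of_nat_add of_nat_mult)
    also have "per w \<dots> = per w (int (i mod nat g))"
      by (rule perg)
    also have "\<dots> = w ! (i mod nat g)"
      using i by (simp add: per_of_nat) (metis le_less_trans mod_less mod_less_eq_dividend)
    also have "\<dots> = word_pow m (take (nat g) w) ! i"
      using i g by (subst nth_word_pow) (simp_all only: len m nth_take pos_mod_bound mod_less_divisor zero_less_nat_eq)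
    finally show "w ! i = word_pow m (take (nat g) w) ! i" .
  qed
  with prim have "m < 2" by (meson not_le)
  moreover have "m \<noteq> 0" using m w by (intro notI) simp
  ultimately have "m = 1" by simp
  with m g have "g = ?k" by simp
  then show ?thesis using g by simp
qed

section \<open>Strings, letters and their order\<close>

lemma syl_inv_syl_inv [simp]: "syl_inv (syl_inv x) = x"
  by (cases x) auto

lemma arrow_syl_inv [simp]: "arrow (syl_inv x) = arrow x"
  by (cases x) auto

lemma direct_simps [simp]: "direct (Dir \<alpha>)" "\<not> direct (Inv \<alpha>)"
  by (auto simp: direct_def)

lemma direct_syl_inv [simp]: "direct (syl_inv x) \<longleftrightarrow> \<not> direct x"
  by (cases x) auto

lemma syl_src_syl_inv [simp]: "syl_src Q (syl_inv x) = syl_tgt Q x"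
  by (cases x) auto

lemma syl_tgt_syl_inv [simp]: "syl_tgt Q (syl_inv x) = syl_src Q x"
  by (cases x) auto

lemma syl_inv_eq_iff [simp]: "syl_inv x = syl_inv y \<longleftrightarrow> x = y"
  by (metis syl_inv_syl_inv)

lemma word_inv_word_inv [simp]: "word_inv (word_inv w) = w"
  by (simp add: word_inv_def rev_map comp_def)

lemma length_word_inv [simp]: "length (word_inv w) = length w"
  by (simp add: word_inv_def)

lemma word_inv_eq_Nil_iff [simp]: "word_inv w = [] \<longleftrightarrow> w = []"
  by (simp add: word_inv_def)

lemma word_inv_append: "word_inv (u @ v) = word_inv v @ word_inv u"
  by (simp add: word_inv_def)

lemma nth_word_inv: "i < length w \<Longrightarrow> word_inv w ! i = syl_inv (w ! (length w - Suc i))"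
  by (simp add: word_inv_def rev_nth)

lemma word_inv_word_pow: "word_inv (word_pow m w) = word_pow m (word_inv w)"
proof (induction m)
  case (Suc m)
  have comm: "word_pow m v @ v = v @ word_pow m v" for v :: "'a syllable list"
    by (induction m) (simp_all add: word_pow_def)
  show ?case
    by (simp add: word_pow_Suc word_inv_append Suc comm)
qed (simp add: word_pow_def)

lemma sublist_word_inv: "sublist (word_inv u) (word_inv w) \<longleftrightarrow> sublist u w"
proof -
  have imp: "sublist (word_inv u) (word_inv w)" if "sublist u w" for u w :: "'a syllable list"
    using that unfolding sublist_def by (metis word_inv_append append.assoc)
  show ?thesis
    using imp[of u w] imp[of "word_inv u" "word_inv w"] by auto
qed

lemma is_string_sublist:
  assumes "is_string Q \<rho> w" "sublist u w" "u \<noteq> []"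
  shows "is_string Q \<rho> u"
  unfolding is_string_def
proof (intro conjI allI impI)
  obtain p s where w: "w = p @ u @ s"
    using assms(2) by (auto simp: sublist_def)
  show "arrow ` set u \<subseteq> arcs Q"
    using assms(1) by (auto simp: is_string_def w)
  fix i assume i: "Suc i < length u"
  then have "w ! (length p + i) = u ! i" "w ! Suc (length p + i) = u ! Suc i"
      "Suc (length p + i) < length w"
    by (simp_all add: w nth_append)
  with assms(1) show "syl_tgt Q (u ! i) = syl_src Q (u ! Suc i)" "u ! i \<noteq> syl_inv (u ! Suc i)"
    by (force simp: is_string_def)+
next
  fix v assume "sublist v u"
  with assms(2) have "sublist v w"
    using sublist_order.order.trans by blast
  with assms(1) show "v \<notin> map Dir ` \<rho>" "word_inv v \<notin> map Dir ` \<rho>"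
    by (auto simp: is_string_def)
qed (fact assms(3))

lemma is_string_word_inv:
  assumes "is_string Q \<rho> w"
  shows "is_string Q \<rho> (word_inv w)"
  unfolding is_string_def
proof (intro conjI allI impI)
  show "word_inv w \<noteq> []" "arrow ` set (word_inv w) \<subseteq> arcs Q"
    using assms by (auto simp: is_string_def word_inv_def image_image)
  fix i assume "Suc i < length (word_inv w)"
  then have i: "Suc i < length w" by simp
  let ?j = "length w - Suc (Suc i)"
  have j: "Suc ?j < length w" "word_inv w ! i = syl_inv (w ! Suc ?j)" "word_inv w ! Suc i = syl_inv (w ! ?j)"
    using i by (simp_all add: nth_word_inv Suc_diff_Suc)
  with assms have "syl_tgt Q (w ! ?j) = syl_src Q (w ! Suc ?j)" "w ! ?j \<noteq> syl_inv (w ! Suc ?j)"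
    by (auto simp: is_string_def)
  then show "syl_tgt Q (word_inv w ! i) = syl_src Q (word_inv w ! Suc i)"
    "word_inv w ! i \<noteq> syl_inv (word_inv w ! Suc i)"
    by (auto simp: j)
next
  fix u assume "sublist u (word_inv w)"
  then have "sublist (word_inv u) w"
    by (metis sublist_word_inv word_inv_word_inv)
  with assms show "u \<notin> map Dir ` \<rho>" "word_inv u \<notin> map Dir ` \<rho>"
    by (metis is_string_def word_inv_word_inv)+
qed

lemma is_band_word_inv:
  assumes "is_band Q \<rho> b"
  shows "is_band Q \<rho> (word_inv b)"
proof -
  have ne: "b \<noteq> []"
    using assms by (auto simp: is_band_def is_string_def)
  have ends: "hd (word_inv b) = syl_inv (last b)" "last (word_inv b) = syl_inv (hd b)"
    using ne by (simp_all add: word_inv_def hd_rev last_rev last_map hd_map)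
  show ?thesis
    unfolding is_band_def
  proof (intro conjI allI impI)
    fix m :: nat assume "m \<ge> 1"
    with assms show "is_string Q \<rho> (word_pow m (word_inv b))"
      by (auto simp: is_band_def is_string_word_inv simp flip: word_inv_word_pow)
  next
    show "\<nexists>u m. m \<ge> 2 \<and> word_inv b = word_pow m u"
      using assms unfolding is_band_def by (metis word_inv_word_inv word_inv_word_pow)
  qed (use assms in \<open>auto simp: is_band_def ends is_string_word_inv\<close>)
qed

text \<open>Syllable t joins the positions t and t + 1. The reflection of positions at 0 sends it to
  the syllable between -t - 1 and -t, whose index is -1 - t.\<close>

lemma per_word_inv:
  assumes "b \<noteq> []"
  shows "per (word_inv b) t = syl_inv (per b (- 1 - t))"
proof -
  let ?k = "int (length b)"
  have k: "?k > 0" using assms by simp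
  have r: "0 \<le> t mod ?k" "t mod ?k < ?k" using k by auto
  have "(- 1 - t) mod ?k = ((- 1 - t) + ?k) mod ?k"
    by simp
  also have "(- 1 - t) + ?k = (?k - 1) - t"
    by simp
  also have "((?k - 1) - t) mod ?k = ((?k - 1) - t mod ?k) mod ?k"
    by (simp only: mod_diff_right_eq)
  also have "\<dots> = (?k - 1) - t mod ?k"
    using r by (intro mod_pos_pos_trivial) auto
  finally have "nat ((- 1 - t) mod ?k) = length b - Suc (nat (t mod ?k))"
    using r by simp
  then show ?thesis
    using r by (simp add: per_def nth_word_inv nat_less_iff)
qed

lemma band_window:
  assumes "is_band Q \<rho> b" "n > 0"
  shows "is_string Q \<rho> (window (per b) t n)"
proof (rule is_string_sublist)
  have ne: "b \<noteq> []"
    using assms by (auto simp: is_band_def is_string_def)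
  show "is_string Q \<rho> (word_pow (Suc n) b)"
    using assms by (auto simp: is_band_def)
  show "sublist (window (per b) t n) (word_pow (Suc n) b)"
    using sublist_order.order.trans[OF sublist_take sublist_drop] by (simp add: window_per_eq[OF ne])
  show "window (per b) t n \<noteq> []"
    using assms by (simp flip: length_0_conv)
qed

text \<open>The two letters at a vertex are exchanged. Inverting a syllable swaps its source and
  target letters and flips both.\<close>

definition flip :: "'v letter \<Rightarrow> 'v letter" where
  "flip p = (fst p, - snd p)"

section \<open>Letters along strings and their order\<close>

locale signed_string_algebra =
  fixes Q :: "('v, 'a) pre_digraph"
    and \<rho> :: "'a list set"
    and \<sigma> \<epsilon> :: "'a \<Rightarrow> int"
  assumes string_algebra: "string_algebra Q \<rho>"
    and acyclic: "acyclic_quiver Q"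
    and sign_maps: "sign_maps Q \<rho> \<sigma> \<epsilon>"
begin

abbreviation "src \<equiv> src_letter Q \<sigma> \<epsilon>"
abbreviation "tgt \<equiv> tgt_letter Q \<sigma> \<epsilon>"
abbreviation lless (infix "\<prec>" 50) where "p \<prec> q \<equiv> letter_less Q \<sigma> \<epsilon> p q"

sublocale fin_digraph Q
  using string_algebra by (simp add: string_algebra_def)

lemma src_syl_inv: "src (syl_inv x) = flip (tgt x)"
  by (cases x) (simp_all add: src_letter_def tgt_letter_def flip_def)

lemma tgt_syl_inv: "tgt (syl_inv x) = flip (src x)"
  by (cases x) (simp_all add: src_letter_def tgt_letter_def flip_def)

lemma sign_cases: "\<alpha> \<in> arcs Q \<Longrightarrow> (\<sigma> \<alpha> = 1 \<or> \<sigma> \<alpha> = - 1) \<and> (\<epsilon> \<alpha> = 1 \<or> \<epsilon> \<alpha> = - 1)"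
  using sign_maps by (auto simp: sign_maps_def)

text \<open>The sign in a letter separates the arrows that start at the vertex (for direct
  syllables) or end there (for inverse ones).\<close>

lemma src_inj:
  assumes "arrow x \<in> arcs Q" "arrow y \<in> arcs Q" "src x = src y" "direct x = direct y"
  shows "x = y"
proof -
  have tails: "\<alpha> = \<beta>" if "\<alpha> \<in> arcs Q" "\<beta> \<in> arcs Q" "tail Q \<alpha> = tail Q \<beta>" "\<sigma> \<alpha> = \<sigma> \<beta>" for \<alpha> \<beta>
  proof (rule ccontr)
    assume "\<alpha> \<noteq> \<beta>"
    then have "\<sigma> \<alpha> = - \<sigma> \<beta>"
      using that(1-3) sign_maps unfolding sign_maps_def by blast
    with that(4) have "\<sigma> \<beta> = 0" by linarith
    with sign_cases[OF that(2)] show False by simp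
  qed
  have heads: "\<alpha> = \<beta>" if "\<alpha> \<in> arcs Q" "\<beta> \<in> arcs Q" "head Q \<alpha> = head Q \<beta>" "\<epsilon> \<alpha> = \<epsilon> \<beta>" for \<alpha> \<beta>
  proof (rule ccontr)
    assume "\<alpha> \<noteq> \<beta>"
    then have "\<epsilon> \<alpha> = - \<epsilon> \<beta>"
      using that(1-3) sign_maps unfolding sign_maps_def by blast
    with that(4) have "\<epsilon> \<beta> = 0" by linarith
    with sign_cases[OF that(2)] show False by simp
  qed
  from assms show ?thesis
    by (cases x; cases y) (auto simp: src_letter_def intro: tails heads)
qed

lemma tgt_inj:
  assumes "arrow x \<in> arcs Q" "arrow y \<in> arcs Q" "tgt x = tgt y" "direct x = direct y"
  shows "x = y"
  using src_inj[of "syl_inv x" "syl_inv y"] assms by (simp add: src_syl_inv)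

lemma tgt_less_src: "arrow x \<in> arcs Q \<Longrightarrow> direct x \<Longrightarrow> tgt x \<prec> src x"
  unfolding letter_less_def letter_rel_def by (intro r_into_trancl) (cases x; force)

lemma src_less_tgt: "arrow x \<in> arcs Q \<Longrightarrow> \<not> direct x \<Longrightarrow> src x \<prec> tgt x"
  unfolding letter_less_def letter_rel_def by (intro r_into_trancl) (cases x; force)

lemma less_trans: "p \<prec> q \<Longrightarrow> q \<prec> r \<Longrightarrow> p \<prec> r"
  by (auto simp: letter_less_def)

text \<open>Each generating pair p < q comes from an arrow from the vertex of q to the vertex of p,
  so a letter below itself would give a closed walk and hence a cycle.\<close>

lemma less_irrefl: "\<not> p \<prec> p"
proof
  assume "p \<prec> p"
  have "\<exists>w. awalk (fst q) w (fst p) \<and> w \<noteq> []" if "(p, q) \<in> (letter_rel Q \<sigma> \<epsilon>)\<^sup>+" for p q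
    using that
  proof induction
    case (base q)
    then obtain \<alpha> where "\<alpha> \<in> arcs Q" "fst q = tail Q \<alpha>" "fst p = head Q \<alpha>"
      by (auto simp: letter_rel_def src_letter_def tgt_letter_def)
    then show ?case
      by (intro exI[of _ "[\<alpha>]"]) (simp add: awalk_simps)
  next
    case (step q r)
    then obtain w where w: "awalk (fst q) w (fst p)"
      by blast
    from step obtain \<alpha> where "\<alpha> \<in> arcs Q" "fst r = tail Q \<alpha>" "fst q = head Q \<alpha>"
      by (auto simp: letter_rel_def src_letter_def tgt_letter_def)
    with w show ?case
      by (intro exI[of _ "\<alpha> # w"]) (simp add: awalk_simps)
  qed
  with \<open>p \<prec> p\<close> obtain w where "awalk (fst p) w (fst p)" "w \<noteq> []"
    unfolding letter_less_def by blast
  then have "\<exists>c. cycle c"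
    by (intro closed_w_imp_cycle) (auto simp: closed_w_def)
  with acyclic show False
    by (auto simp: acyclic_quiver_def)
qed

lemma less_asym: "p \<prec> q \<Longrightarrow> \<not> q \<prec> p"
  using less_trans less_irrefl by blast

text \<open>One clause of \<open>sign_maps\<close> fits each combination of types: equal types use
  the clause for compositions outside \<open>\<rho>\<close>, opposite types the clauses for distinct
  arrows with a common source or target.\<close>

lemma string_letters:
  assumes "is_string Q \<rho> [x, y]"
  shows "src y = tgt x"
proof -
  have arcs: "arrow x \<in> arcs Q" "arrow y \<in> arcs Q"
    and v: "syl_tgt Q x = syl_src Q y" and ne: "x \<noteq> syl_inv y"
    and rel: "[x, y] \<notin> map Dir ` \<rho>" "word_inv [x, y] \<notin> map Dir ` \<rho>"
    using assms by (force simp: is_string_def)+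
  have rel': "x = Dir \<alpha> \<Longrightarrow> y = Dir \<beta> \<Longrightarrow> [\<alpha>, \<beta>] \<notin> \<rho>" "x = Inv \<alpha> \<Longrightarrow> y = Inv \<beta> \<Longrightarrow> [\<beta>, \<alpha>] \<notin> \<rho>" for \<alpha> \<beta>
    using rel by (auto simp: word_inv_def image_iff)
  note signs = sign_maps[unfolded sign_maps_def, THEN conjunct2, rule_format]
  show ?thesis
  proof (cases x; cases y)
    fix \<alpha> \<beta> assume [simp]: "x = Dir \<alpha>" "y = Dir \<beta>"
    have "\<sigma> \<beta> = - \<epsilon> \<alpha>"
      using signs[of \<beta> \<alpha>] arcs v rel'(1) by auto
    with v show ?thesis by (simp add: src_letter_def tgt_letter_def)
  next
    fix \<alpha> \<beta> assume [simp]: "x = Dir \<alpha>" "y = Inv \<beta>"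
    have "\<epsilon> \<alpha> = - \<epsilon> \<beta>"
      using signs[of \<alpha> \<beta>] arcs v ne by simp
    with v show ?thesis by (simp add: src_letter_def tgt_letter_def)
  next
    fix \<alpha> \<beta> assume [simp]: "x = Inv \<alpha>" "y = Dir \<beta>"
    have "\<sigma> \<alpha> = - \<sigma> \<beta>"
      using signs[of \<alpha> \<beta>] arcs v ne by simp
    with v show ?thesis by (simp add: src_letter_def tgt_letter_def)
  next
    fix \<alpha> \<beta> assume [simp]: "x = Inv \<alpha>" "y = Inv \<beta>"
    have "\<sigma> \<alpha> = - \<epsilon> \<beta>"
      using signs[of \<alpha> \<beta>] arcs v rel'(2) by auto
    with v show ?thesis by (simp add: src_letter_def tgt_letter_def)
  qed
qed

definition bistring :: "(int \<Rightarrow> 'a syllable) \<Rightarrow> bool" where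
  "bistring X \<longleftrightarrow> (\<forall>t n. n > 0 \<longrightarrow> is_string Q \<rho> (window X t n))"

lemma band_bistring: "is_band Q \<rho> b \<Longrightarrow> bistring (per b)"
  by (simp add: bistring_def band_window)

lemma bistring_pair: "bistring X \<Longrightarrow> is_string Q \<rho> [X t, X (t + 1)]"
  unfolding bistring_def by (metis zero_less_Suc window_Suc_left window_0 One_nat_def)

lemma bistring_arrow: "bistring X \<Longrightarrow> arrow (X t) \<in> arcs Q"
  using bistring_pair[of X t] by (auto simp: is_string_def)

lemma bistring_tgt: "bistring X \<Longrightarrow> tgt (X t) = src (X (t + 1))"
  using bistring_pair[of X t] by (auto dest: string_letters)

lemma bistring_neq: "bistring X \<Longrightarrow> X t \<noteq> syl_inv (X (t + 1))"
  using bistring_pair[of X t] by (force simp: is_string_def)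

end

section \<open>Crossings and turning points\<close>

context signed_string_algebra
begin

text \<open>\<open>X\<close> is the factor side and \<open>Y\<close> the submodule side. The value m
  = 0 is allowed: the match is then a single vertex, and the condition on the letters fixes how both
  words pass through it.\<close>

definition crossing :: "(int \<Rightarrow> 'a syllable) \<Rightarrow> (int \<Rightarrow> 'a syllable) \<Rightarrow> bool" where
  "crossing X Y \<longleftrightarrow> (\<exists>i j m. src (X i) = src (Y j) \<and> (\<forall>\<tau><m. X (i + int \<tau>) = Y (j + int \<tau>)) \<and>
     \<not> direct (X (i - 1)) \<and> direct (X (i + int m)) \<and> direct (Y (j - 1)) \<and> \<not> direct (Y (j + int m)))"

text \<open>The right half of a crossing, seen from a pair of positions inside the match. Position t
  lies between the syllables t - 1 and t, so the left half below counts syllables from t - 1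
  downwards.\<close>

definition right_cross :: "(int \<Rightarrow> 'a syllable) \<Rightarrow> (int \<Rightarrow> 'a syllable) \<Rightarrow> int \<Rightarrow> int \<Rightarrow> bool" where
  "right_cross X Y t s \<longleftrightarrow> (\<exists>m. (\<forall>\<tau><m. X (t + int \<tau>) = Y (s + int \<tau>)) \<and>
     direct (X (t + int m)) \<and> \<not> direct (Y (s + int m)))"

definition left_cross :: "(int \<Rightarrow> 'a syllable) \<Rightarrow> (int \<Rightarrow> 'a syllable) \<Rightarrow> int \<Rightarrow> int \<Rightarrow> bool" where
  "left_cross X Y t s \<longleftrightarrow> (\<exists>m. (\<forall>\<tau><m. X (t - 1 - int \<tau>) = Y (s - 1 - int \<tau>)) \<and>
     \<not> direct (X (t - 1 - int m)) \<and> direct (Y (s - 1 - int m)))"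

lemma right_cross_0: "direct (X t) \<Longrightarrow> \<not> direct (Y s) \<Longrightarrow> right_cross X Y t s"
  unfolding right_cross_def by (rule exI[of _ 0]) simp

lemma left_cross_0: "\<not> direct (X (t - 1)) \<Longrightarrow> direct (Y (s - 1)) \<Longrightarrow> left_cross X Y t s"
  unfolding left_cross_def by (rule exI[of _ 0]) simp

lemma right_cross_step:
  assumes "X t = Y s" "right_cross X Y (t + 1) (s + 1)"
  shows "right_cross X Y t s"
proof -
  obtain m where "\<forall>\<tau><m. X (t + 1 + int \<tau>) = Y (s + 1 + int \<tau>)"
    "direct (X (t + 1 + int m))" "\<not> direct (Y (s + 1 + int m))"
    using assms(2) by (auto simp: right_cross_def)
  with assms(1) show ?thesis
    unfolding right_cross_def
    by (intro exI[of _ "Suc m"]) (auto simp: less_Suc_eq_0_disj add.assoc)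
qed

lemma left_cross_step:
  assumes "X (t - 1) = Y (s - 1)" "left_cross X Y (t - 1) (s - 1)"
  shows "left_cross X Y t s"
proof -
  obtain m where "\<forall>\<tau><m. X (t - 1 - 1 - int \<tau>) = Y (s - 1 - 1 - int \<tau>)"
    "\<not> direct (X (t - 1 - 1 - int m))" "direct (Y (s - 1 - 1 - int m))"
    using assms(2) by (auto simp: left_cross_def)
  with assms(1) show ?thesis
    unfolding left_cross_def
    by (intro exI[of _ "Suc m"]) (auto simp: less_Suc_eq_0_disj diff_diff_eq)
qed

text \<open>The match reaches from m steps left of t to n steps right of it, where m and n come from
  the two halves.\<close>

lemma crossingI:
  assumes "src (X t) = src (Y s)" "left_cross X Y t s" "right_cross X Y t s"
  shows "crossing X Y"
proof -
  obtain m where m: "\<And>\<tau>. \<tau> < m \<Longrightarrow> X (t - 1 - int \<tau>) = Y (s - 1 - int \<tau>)"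
    "\<not> direct (X (t - 1 - int m))" "direct (Y (s - 1 - int m))"
    using assms(2) by (auto simp: left_cross_def)
  obtain n where n: "\<And>\<tau>. \<tau> < n \<Longrightarrow> X (t + int \<tau>) = Y (s + int \<tau>)"
    "direct (X (t + int n))" "\<not> direct (Y (s + int n))"
    using assms(3) by (auto simp: right_cross_def)
  have agree: "X (t - int m + int \<tau>) = Y (s - int m + int \<tau>)" if "\<tau> < m + n" for \<tau>
  proof (cases "\<tau> < m")
    case True
    then show ?thesis
      using m(1)[of "m - 1 - \<tau>"] by (simp add: of_nat_diff algebra_simps)
  next
    case False
    with that n(1)[of "\<tau> - m"] show ?thesis
      by (simp add: of_nat_diff algebra_simps)
  qed
  have "src (X (t - int m)) = src (Y (s - int m))"
    using assms(1) agree[of 0] by (cases m) auto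
  with agree m(2,3) n(2,3) show ?thesis
    unfolding crossing_def
    by (intro exI[of _ "t - int m"] exI[of _ "s - int m"] exI[of _ "m + n"]) (simp add: algebra_simps)
qed

section \<open>Comparison of two runs of the same direction\<close>

definition uniform :: "(int \<Rightarrow> 'a syllable) \<Rightarrow> bool \<Rightarrow> int \<Rightarrow> int \<Rightarrow> bool" where
  "uniform X d t t' \<longleftrightarrow> (\<forall>u. t \<le> u \<and> u < t' \<longrightarrow> (direct (X u) \<longleftrightarrow> d))"

lemma uniformD: "uniform X d t t' \<Longrightarrow> t \<le> u \<Longrightarrow> u < t' \<Longrightarrow> direct (X u) \<longleftrightarrow> d"
  by (simp add: uniform_def)

lemma uniform_mono: "uniform X d t t' \<Longrightarrow> t \<le> u \<Longrightarrow> u' \<le> t' \<Longrightarrow> uniform X d u u'"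
  by (auto simp: uniform_def)

lemma uniform_less:
  assumes X: "bistring X" and "uniform X d t t'" "t < t'"
  shows "if d then src (X t') \<prec> src (X t) else src (X t) \<prec> src (X t')"
  using assms(3,2)
proof (induction t' rule: int_gr_induct)
  case base
  then show ?case
    using tgt_less_src[of "X t"] src_less_tgt[of "X t"]
    by (auto simp: uniform_def bistring_arrow[OF X] bistring_tgt[OF X])
next
  case (step t')
  then have "if d then src (X t') \<prec> src (X t) else src (X t) \<prec> src (X t')"
    by (auto simp: uniform_def)
  moreover have "if d then src (X (t' + 1)) \<prec> src (X t') else src (X t') \<prec> src (X (t' + 1))"
    using step tgt_less_src[of "X t'"] src_less_tgt[of "X t'"]
    by (auto simp: uniform_def bistring_arrow[OF X] bistring_tgt[OF X])
  ultimately show ?case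
    using less_trans[of "src (X (t' + 1))" "src (X t')" "src (X t)"]
      less_trans[of "src (X t)" "src (X t')" "src (X (t' + 1))"] by (cases d) simp_all
qed

lemma uniform_le:
  assumes "bistring X" "uniform X d t t'" "t \<le> t'"
  shows "t = t' \<or> (if d then src (X t') \<prec> src (X t) else src (X t) \<prec> src (X t'))"
  using uniform_less[OF assms(1,2)] assms(3) by (cases "t = t'") auto

lemma forward_det:
  assumes "bistring X" "bistring Y" "src (X t) = src (Y s)" "direct (X t) = direct (Y s)"
  shows "X t = Y s" "src (X (t + 1)) = src (Y (s + 1))"
proof -
  show "X t = Y s"
    using assms by (intro src_inj) (auto simp: bistring_arrow)
  with assms show "src (X (t + 1)) = src (Y (s + 1))"
    by (simp flip: bistring_tgt)
qed

lemma backward_det: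
  assumes "bistring X" "bistring Y" "src (X t) = src (Y s)" "direct (X (t - 1)) = direct (Y (s - 1))"
  shows "X (t - 1) = Y (s - 1)"
proof (intro tgt_inj)
  show "tgt (X (t - 1)) = tgt (Y (s - 1))"
    using assms by (simp add: bistring_tgt)
qed (use assms in \<open>auto simp: bistring_arrow\<close>)

text \<open>Equal letters and equal directions give equal syllables, so both runs are followed in
  step until one of them ends. Along direct runs letters fall, so the run of \<open>Y\<close>, with
  the larger end letter, stops first; along inverse runs letters rise and the run of
  \<open>X\<close> stops first. Either way \<open>X\<close> is direct and \<open>Y\<close> inverse
  at that place.\<close>

lemma right_cross_uniform:
  assumes X: "bistring X" and Y: "bistring Y"
    and "uniform X d t t'" "t \<le> t'" "direct (X t') \<longleftrightarrow> \<not> d"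
    and "uniform Y d s s'" "s \<le> s'" "direct (Y s') \<longleftrightarrow> \<not> d"
    and "src (X t) = src (Y s)" and less: "src (X t') \<prec> src (Y s')"
  shows "right_cross X Y t s"
  using assms(3-9)
proof (induction "nat (t' - t)" arbitrary: t s rule: less_induct)
  case less
  note cmpX = uniform_le[OF X \<open>uniform X d t t'\<close> \<open>t \<le> t'\<close>]
  note cmpY = uniform_le[OF Y \<open>uniform Y d s s'\<close> \<open>s \<le> s'\<close>]
  show ?case
  proof (cases "t < t' \<and> s < s'")
    case True
    then have "direct (X t) = direct (Y s)"
      using less.prems by (auto simp: uniform_def)
    note det = forward_det[OF X Y \<open>src (X t) = src (Y s)\<close> this]
    have "right_cross X Y (t + 1) (s + 1)"
      using True less.prems(1-6) det(2) by (intro less.hyps) (simp_all add: uniform_def)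
    with det(1) show ?thesis
      by (rule right_cross_step)
  next
    case False
    show ?thesis
    proof (cases d)
      case True
      have "t < t'"
      proof (rule ccontr)
        assume "\<not> t < t'"
        with less.prems(2,7) assms(10) have "src (Y s) \<prec> src (Y s')" by simp
        with cmpY True show False by (auto simp: less_irrefl dest: less_asym)
      qed
      then have "direct (X t)" "s = s'"
        using False True less.prems(1,5) by (auto simp: uniform_def)
      with True less.prems(6) show ?thesis
        by (intro right_cross_0) auto
    next
      case d: False
      have "s < s'"
      proof (rule ccontr)
        assume "\<not> s < s'"
        with less.prems(5,7) assms(10) have "src (X t') \<prec> src (X t)" by simp
        with cmpX d show False by (auto simp: less_irrefl dest: less_asym)
      qed
      then have "\<not> direct (Y s)" "t = t'"
        using False d less.prems(2,4) by (auto simp: uniform_def)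
      with d less.prems(3) show ?thesis
        by (intro right_cross_0) auto
    qed
  qed
qed

text \<open>Mirror image: going left, letters rise along direct runs, so there the run of
  \<open>X\<close>, whose start letter is smaller, is exhausted first; along inverse runs that of
  \<open>Y\<close> is.\<close>

lemma left_cross_uniform:
  assumes X: "bistring X" and Y: "bistring Y"
    and "uniform X d t' t" "t' \<le> t" "direct (X (t' - 1)) \<longleftrightarrow> \<not> d"
    and "uniform Y d s' s" "s' \<le> s" "direct (Y (s' - 1)) \<longleftrightarrow> \<not> d"
    and "src (X t) = src (Y s)" and less: "src (X t') \<prec> src (Y s')"
  shows "left_cross X Y t s"
  using assms(3-9)
proof (induction "nat (t - t')" arbitrary: t s rule: less_induct)
  case less
  note cmpX = uniform_le[OF X \<open>uniform X d t' t\<close> \<open>t' \<le> t\<close>]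
  note cmpY = uniform_le[OF Y \<open>uniform Y d s' s\<close> \<open>s' \<le> s\<close>]
  show ?case
  proof (cases "t' < t \<and> s' < s")
    case True
    then have "direct (X (t - 1)) = direct (Y (s - 1))"
      using less.prems by (auto simp: uniform_def)
    note det = backward_det[OF X Y \<open>src (X t) = src (Y s)\<close> this]
    have "left_cross X Y (t - 1) (s - 1)"
      using True less.prems(1-6) det by (intro less.hyps) (simp_all add: uniform_def)
    with det show ?thesis
      by (rule left_cross_step)
  next
    case False
    show ?thesis
    proof (cases d)
      case True
      have "s' < s"
      proof (rule ccontr)
        assume "\<not> s' < s"
        with less.prems(5,7) assms(10) have "src (X t') \<prec> src (X t)" by simp
        with cmpX True show False by (auto simp: less_irrefl dest: less_asym)
      qed
      then have "direct (Y (s - 1))" "t = t'"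
        using False True less.prems(2,4) by (auto simp: uniform_def)
      with True less.prems(3) show ?thesis
        by (intro left_cross_0) auto
    next
      case d: False
      have "t' < t"
      proof (rule ccontr)
        assume "\<not> t' < t"
        with less.prems(2,7) assms(10) have "src (Y s) \<prec> src (Y s')" by simp
        with cmpY d show False by (auto simp: less_irrefl dest: less_asym)
      qed
      then have "\<not> direct (X (t - 1))" "s = s'"
        using False d less.prems(1,5) by (auto simp: uniform_def)
      with d less.prems(6) show ?thesis
        by (intro left_cross_0) auto
    qed
  qed
qed

text \<open>Equal end letters force both runs to end together: if one ended earlier, the letters of
  the other would move strictly away from the common letter.\<close>

lemma right_cross_uniform_eq:
  assumes X: "bistring X" and Y: "bistring Y"
    and "uniform X d t t'" "t \<le> t'" "uniform Y d s s'" "s \<le> s'" "src (X t) = src (Y s)"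
    and "src (X t') = src (Y s')" "right_cross X Y t' s'"
  shows "right_cross X Y t s"
  using assms(3-7)
proof (induction "nat (t' - t)" arbitrary: t s rule: less_induct)
  case less
  note cmpX = uniform_le[OF X \<open>uniform X d t t'\<close> \<open>t \<le> t'\<close>]
  note cmpY = uniform_le[OF Y \<open>uniform Y d s s'\<close> \<open>s \<le> s'\<close>]
  show ?case
  proof (cases "t < t' \<and> s < s'")
    case True
    then have "direct (X t) = direct (Y s)"
      using less.prems by (auto simp: uniform_def)
    note det = forward_det[OF X Y \<open>src (X t) = src (Y s)\<close> this]
    have "right_cross X Y (t + 1) (s + 1)"
      using True less.prems(1-4) det(2) by (intro less.hyps) (simp_all add: uniform_def)
    with det(1) show ?thesis
      by (rule right_cross_step)
  next
    case False
    then have "t = t' \<and> s = s'"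
      using cmpX cmpY less.prems(2,4,5) assms(8) by (auto simp: less_irrefl split: if_splits)
    with assms(9) show ?thesis by simp
  qed
qed

section \<open>Turning points and the two forbidden patterns on bi-infinite words\<close>

definition turning_points :: "(int \<Rightarrow> 'a syllable) \<Rightarrow> (int \<Rightarrow> int) \<Rightarrow> bool" where
  "turning_points X P \<longleftrightarrow>
     (\<forall>a. P a < P (a + 1) \<and> uniform X (direct (X (P a))) (P a) (P (a + 1)) \<and>
          direct (X (P (a + 1))) \<noteq> direct (X (P a))) \<and>
     (\<forall>t. \<exists>a. P a \<le> t \<and> t < P (a + 1))"

lemma turning_pointsD:
  assumes "turning_points X P"
  shows "P a < P (a + 1)" "uniform X (direct (X (P a))) (P a) (P (a + 1))"
    "direct (X (P (a + 1))) \<longleftrightarrow> \<not> direct (X (P a))"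
  using assms by (auto simp: turning_points_def)

lemma turning_points_cover:
  assumes "turning_points X P"
  obtains a where "P a \<le> t" "t < P (a + 1)"
  using assms by (auto simp: turning_points_def)

lemma direct_prev_turning_point:
  assumes "turning_points X P"
  shows "direct (X (P (a + 1) - 1)) \<longleftrightarrow> direct (X (P a))"
  using turning_pointsD(1)[OF assms, of a] by (intro uniformD[OF turning_pointsD(2)[OF assms]]) auto

lemma turning_letters:
  assumes "bistring X" "turning_points X P"
  shows "if direct (X (P a)) then src (X (P (a + 1))) \<prec> src (X (P a)) else src (X (P a)) \<prec> src (X (P (a + 1)))"
  using uniform_less[OF assms(1) turning_pointsD(2,1)[OF assms(2)]] .

lemma turning_direct_iff:
  assumes "bistring X" "turning_points X P"
  shows "src (X (P a)) \<prec> src (X (P (a + 1))) \<longleftrightarrow> \<not> direct (X (P a))"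
  using turning_letters[OF assms, of a] by (auto dest: less_asym split: if_splits)

text \<open>The first forbidden pattern; the common word z occupies the n places after a and
  c.\<close>

definition zigzag_cross :: "(int \<Rightarrow> 'v letter) \<Rightarrow> (int \<Rightarrow> 'v letter) \<Rightarrow> bool" where
  "zigzag_cross V W \<longleftrightarrow> (\<exists>a c n. n \<ge> 1 \<and> V a \<prec> W c \<and> (\<forall>\<tau>. 1 \<le> \<tau> \<and> \<tau> \<le> n \<longrightarrow> V (a + int \<tau>) = W (c + int \<tau>)) \<and>
     V (a + int n + 1) \<prec> W (c + int n + 1))"

text \<open>The second forbidden pattern, with traces replaced by the positions of a run, both ends
  included.\<close>

definition trace_cross ::
  "(int \<Rightarrow> 'a syllable) \<Rightarrow> (int \<Rightarrow> int) \<Rightarrow> (int \<Rightarrow> 'a syllable) \<Rightarrow> (int \<Rightarrow> int) \<Rightarrow> bool" where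
  "trace_cross X P Y R \<longleftrightarrow> (\<exists>a c. src (X (P a)) \<prec> src (Y (R c)) \<and> src (X (P (a + 1))) \<prec> src (Y (R (c + 1))) \<and>
     direct (X (P a)) = direct (Y (R c)) \<and>
     (\<exists>t s. P a \<le> t \<and> t \<le> P (a + 1) \<and> R c \<le> s \<and> s \<le> R (c + 1) \<and> src (X t) = src (Y s)))"

context
  fixes X Y P R
  assumes X: "bistring X" and Y: "bistring Y"
    and P: "turning_points X P" and R: "turning_points Y R"
begin

text \<open>The pair of positions may also be the right ends of the two runs; this covers matches
  that pass through a common turning point.\<close>

lemma left_cross_block:
  assumes ts: "P a \<le> t" "t \<le> P (a + 1)" "R c \<le> s" "s \<le> R (c + 1)" "src (X t) = src (Y s)"
    and d: "direct (X (P a)) = direct (Y (R c))" and less: "src (X (P a)) \<prec> src (Y (R c))"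
  shows "left_cross X Y t s"
proof (rule left_cross_uniform[OF X Y])
  show "uniform X (direct (X (P a))) (P a) t"
    using ts by (intro uniform_mono[OF turning_pointsD(2)[OF P]]) auto
  show "uniform Y (direct (X (P a))) (R c) s"
    unfolding d using ts by (intro uniform_mono[OF turning_pointsD(2)[OF R]]) auto
  show "direct (X (P a - 1)) \<longleftrightarrow> \<not> direct (X (P a))" "direct (Y (R c - 1)) \<longleftrightarrow> \<not> direct (X (P a))"
    using d direct_prev_turning_point[OF P, of "a - 1"] direct_prev_turning_point[OF R, of "c - 1"]
      turning_pointsD(3)[OF P, of "a - 1"] turning_pointsD(3)[OF R, of "c - 1"] by auto
qed (use ts less in auto)

lemma right_cross_block:
  assumes ts: "P a \<le> t" "t \<le> P (a + 1)" "R c \<le> s" "s \<le> R (c + 1)" "src (X t) = src (Y s)"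
    and d: "direct (X (P a)) = direct (Y (R c))" and less: "src (X (P (a + 1))) \<prec> src (Y (R (c + 1)))"
  shows "right_cross X Y t s"
proof (rule right_cross_uniform[OF X Y])
  show "uniform X (direct (X (P a))) t (P (a + 1))"
    using ts by (intro uniform_mono[OF turning_pointsD(2)[OF P]]) auto
  show "uniform Y (direct (X (P a))) s (R (c + 1))"
    unfolding d using ts by (intro uniform_mono[OF turning_pointsD(2)[OF R]]) auto
  show "direct (X (P (a + 1))) \<longleftrightarrow> \<not> direct (X (P a))" "direct (Y (R (c + 1))) \<longleftrightarrow> \<not> direct (X (P a))"
    using d turning_pointsD(3)[OF P, of a] turning_pointsD(3)[OF R, of c] by auto
qed (use ts less in auto)

text \<open>The direction of a run can be read off from the order of its end letters, so runs with
  equal ends have equal directions.\<close>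

lemma right_cross_block_eq:
  assumes "src (X (P a)) = src (Y (R c))" "src (X (P (a + 1))) = src (Y (R (c + 1)))"
    and cross: "right_cross X Y (P (a + 1)) (R (c + 1))"
  shows "right_cross X Y (P a) (R c)"
proof -
  have d: "direct (Y (R c)) = direct (X (P a))"
    using assms(1,2) turning_direct_iff[OF X P, of a] turning_direct_iff[OF Y R, of c] by simp
  show ?thesis
  proof (rule right_cross_uniform_eq[OF X Y turning_pointsD(2)[OF P] _ turning_pointsD(2)[OF R, of c, unfolded d]])
    show "P a \<le> P (a + 1)" "R c \<le> R (c + 1)"
      using turning_pointsD(1)[OF P, of a] turning_pointsD(1)[OF R, of c] by auto
  qed (fact assms)+
qed

lemma trace_cross_imp_crossing:
  assumes "trace_cross X P Y R"
  shows "crossing X Y"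
proof -
  obtain a c t s where less: "src (X (P a)) \<prec> src (Y (R c))" "src (X (P (a + 1))) \<prec> src (Y (R (c + 1)))"
    and d: "direct (X (P a)) = direct (Y (R c))"
    and ts: "P a \<le> t" "t \<le> P (a + 1)" "R c \<le> s" "s \<le> R (c + 1)" "src (X t) = src (Y s)"
    using assms unfolding trace_cross_def by blast
  have "left_cross X Y t s"
    using ts d less(1) by (intro left_cross_block)
  moreover have "right_cross X Y t s"
    using ts d less(2) by (intro right_cross_block)
  ultimately show ?thesis
    using ts by (intro crossingI)
qed

text \<open>Induction on the number of common turning letters: common runs are passed by
  \<open>right_cross_block_eq\<close>, and the first distinct letters decide the base case.\<close>

lemma zigzag_right_cross:
  assumes "n \<ge> 1" "\<And>\<tau>. 1 \<le> \<tau> \<Longrightarrow> \<tau> \<le> n \<Longrightarrow> src (X (P (a + int \<tau>))) = src (Y (R (c + int \<tau>)))"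
    and "src (X (P (a + int n + 1))) \<prec> src (Y (R (c + int n + 1)))"
  shows "right_cross X Y (P (a + 1)) (R (c + 1))"
  using assms
proof (induction n arbitrary: a c rule: nat_induct_at_least)
  case base
  have eq: "src (X (P (a + 1))) = src (Y (R (c + 1)))"
    using base(1)[of 1] by simp
  have less: "src (X (P (a + 1 + 1))) \<prec> src (Y (R (c + 1 + 1)))"
    using base(2) by simp
  note lt = turning_pointsD(1)[OF P, of "a + 1"] turning_pointsD(1)[OF R, of "c + 1"]
  show ?case
  proof (cases "direct (X (P (a + 1))) = direct (Y (R (c + 1)))")
    case True
    show ?thesis
      using lt by (intro right_cross_block[OF _ _ _ _ eq True less]) auto
  next
    case False
    \<comment> \<open>Runs of different directions leave the common letter on different sides. The
      order of the next letters leaves only the case that \<open>X\<close> falls and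
      \<open>Y\<close> rises.\<close>
    moreover have "direct (X (P (a + 1)))"
    proof (rule ccontr)
      assume neg: "\<not> direct (X (P (a + 1)))"
      then have "src (X (P (a + 1))) \<prec> src (X (P (a + 1 + 1)))"
        using turning_letters[OF X P, of "a + 1"] by simp
      moreover have "src (Y (R (c + 1 + 1))) \<prec> src (Y (R (c + 1)))"
        using turning_letters[OF Y R, of "c + 1"] neg False by simp
      ultimately show False
        using less_asym[OF less] less_trans eq by metis
    qed
    ultimately show ?thesis
      by (intro right_cross_0) auto
  qed
next
  case (Suc n)
  have eq1: "src (X (P (a + 1))) = src (Y (R (c + 1)))"
    using Suc.prems(1)[of 1] by simp
  have eq2: "src (X (P (a + 1 + 1))) = src (Y (R (c + 1 + 1)))"
    using Suc.prems(1)[of 2] Suc.hyps by (simp add: add.assoc)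
  have "right_cross X Y (P (a + 1 + 1)) (R (c + 1 + 1))"
  proof (rule Suc.IH)
    fix \<tau> :: nat assume "1 \<le> \<tau>" "\<tau> \<le> n"
    then show "src (X (P (a + 1 + int \<tau>))) = src (Y (R (c + 1 + int \<tau>)))"
      using Suc.prems(1)[of "Suc \<tau>"] by (simp add: add.assoc)
  next
    show "src (X (P (a + 1 + int n + 1))) \<prec> src (Y (R (c + 1 + int n + 1)))"
      using Suc.prems(2) by (simp add: algebra_simps)
  qed
  with eq1 eq2 show ?case
    by (rule right_cross_block_eq)
qed

lemma zigzag_cross_imp_crossing:
  assumes "zigzag_cross (\<lambda>a. src (X (P a))) (\<lambda>c. src (Y (R c)))"
  shows "crossing X Y"
proof -
  obtain a c n where n: "n \<ge> 1" and less: "src (X (P a)) \<prec> src (Y (R c))"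
    and eq: "\<And>\<tau>. 1 \<le> \<tau> \<Longrightarrow> \<tau> \<le> n \<Longrightarrow> src (X (P (a + int \<tau>))) = src (Y (R (c + int \<tau>)))"
    and less': "src (X (P (a + int n + 1))) \<prec> src (Y (R (c + int n + 1)))"
    using assms unfolding zigzag_cross_def by blast
  have eq1: "src (X (P (a + 1))) = src (Y (R (c + 1)))"
    using eq[of 1] n by simp
  note lt = turning_pointsD(1)[OF P, of a] turning_pointsD(1)[OF R, of c]
  \<comment> \<open>Either both words reach the common letter by runs of the same direction, or, by
    the order of the preceding turning letters, \<open>X\<close> reaches it rising and
    \<open>Y\<close> falling.\<close>
  have "left_cross X Y (P (a + 1)) (R (c + 1))"
  proof (cases "direct (X (P a)) = direct (Y (R c))")
    case True
    show ?thesis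
      using lt by (intro left_cross_block[OF _ _ _ _ eq1 True less]) auto
  next
    case False
    moreover have "\<not> direct (X (P a))"
    proof
      assume neg: "direct (X (P a))"
      then have "src (X (P (a + 1))) \<prec> src (X (P a))"
        using turning_letters[OF X P, of a] by simp
      moreover have "src (Y (R c)) \<prec> src (Y (R (c + 1)))"
        using turning_letters[OF Y R, of c] neg False by simp
      ultimately show False
        using less_asym[OF less] less_trans eq1 by metis
    qed
    ultimately show ?thesis
      by (intro left_cross_0) (auto simp: direct_prev_turning_point[OF P] direct_prev_turning_point[OF R])
  qed
  moreover have "right_cross X Y (P (a + 1)) (R (c + 1))"
    using n eq less' by (rule zigzag_right_cross)
  ultimately show ?thesis
    using eq1 by (intro crossingI)
qed

text \<open>Both words are followed to the right from a common syllable, and n counts the common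
  turning points that are passed. When no further turn lies strictly before the end of the match,
  the end condition tells which run goes on, and therefore which of the next turning letters is
  smaller.\<close>

lemma crossing_march:
  assumes "m > 0" "\<forall>\<tau><m. X (i + int \<tau>) = Y (j + int \<tau>)" "direct (X (i + int m))" "\<not> direct (Y (j + int m))"
    and "P a \<le> i" "i < P (a + 1)" "R c \<le> j" "j < R (c + 1)"
  shows "src (X (P (a + 1))) \<prec> src (Y (R (c + 1))) \<or>
    (\<exists>n\<ge>1. (\<forall>\<tau>. 1 \<le> \<tau> \<and> \<tau> \<le> n \<longrightarrow> src (X (P (a + int \<tau>))) = src (Y (R (c + int \<tau>)))) \<and>
       src (X (P (a + int n + 1))) \<prec> src (Y (R (c + int n + 1))))"
  using assms
proof (induction m arbitrary: i j a c rule: less_induct)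
  case (less m)
  define x where "x = nat (P (a + 1) - i)"
  define y where "y = nat (R (c + 1) - j)"
  have x: "x > 0" "P (a + 1) = i + int x" and y: "y > 0" "R (c + 1) = j + int y"
    using less.prems by (auto simp: x_def y_def)
  have "direct (X (P a)) = direct (X i)" "direct (Y (R c)) = direct (Y j)"
    using less.prems(5-8) uniformD[OF turning_pointsD(2)[OF P, of a]] uniformD[OF turning_pointsD(2)[OF R, of c]] by blast+
  then have unX: "uniform X (direct (X i)) i (i + int x)" and unY: "uniform Y (direct (Y j)) j (j + int y)"
    using less.prems(5,7) turning_pointsD(2)[OF P, of a] turning_pointsD(2)[OF R, of c] x(2) y(2)
    by (auto intro: uniform_mono)
  note uX = uniformD[OF unX] and uY = uniformD[OF unY]
  have eX: "direct (X (i + int x)) \<longleftrightarrow> \<not> direct (X i)"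
    using turning_pointsD(3)[OF P, of a] uniformD[OF turning_pointsD(2)[OF P, of a], of i] less.prems x by simp
  have eY: "direct (Y (j + int y)) \<longleftrightarrow> \<not> direct (Y j)"
    using turning_pointsD(3)[OF R, of c] uniformD[OF turning_pointsD(2)[OF R, of c], of j] less.prems y by simp
  have agree: "X (i + int \<tau>) = Y (j + int \<tau>)" if "\<tau> < m" for \<tau>
    using less.prems that by blast
  have dij: "direct (X i) = direct (Y j)"
    using agree[of 0] less.prems(1) by simp
  show ?case
  proof (cases "x < m \<or> y < m")
    case True
    \<comment> \<open>The earlier of two different turns would lie inside the match and so be
      visible in both words.\<close>
    have "x = y"
    proof (rule ccontr)
      assume "x \<noteq> y"
      then consider "x < y" "x < m" | "y < x" "y < m"
        using True by linarith
      then show False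
      proof cases
        case 1
        then show False using agree[of x] eX uY[of "j + int x"] dij by auto
      next
        case 2
        then show False using agree[of y] eY uX[of "i + int y"] dij by auto
      qed
    qed
    with True have xm: "x < m" by simp
    have eq: "src (X (P (a + 1))) = src (Y (R (c + 1)))"
      using agree[OF xm] x y \<open>x = y\<close> by simp
    have "src (X (P (a + 1 + 1))) \<prec> src (Y (R (c + 1 + 1))) \<or>
      (\<exists>n\<ge>1. (\<forall>\<tau>. 1 \<le> \<tau> \<and> \<tau> \<le> n \<longrightarrow> src (X (P (a + 1 + int \<tau>))) = src (Y (R (c + 1 + int \<tau>)))) \<and>
         src (X (P (a + 1 + int n + 1))) \<prec> src (Y (R (c + 1 + int n + 1))))"
    proof (rule less.IH[of "m - x" "i + int x" "j + int x"])
      show "\<forall>\<tau><m - x. X (i + int x + int \<tau>) = Y (j + int x + int \<tau>)"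
      proof (intro allI impI)
        fix \<tau> assume "\<tau> < m - x"
        then show "X (i + int x + int \<tau>) = Y (j + int x + int \<tau>)"
          using agree[of "x + \<tau>"] by (simp add: add.assoc)
      qed
      show "direct (X (i + int x + int (m - x)))" "\<not> direct (Y (j + int x + int (m - x)))"
        using less.prems(3,4) xm by (simp_all add: of_nat_diff)
    qed (use x y(2) xm \<open>x = y\<close> turning_pointsD(1)[OF P, of "a + 1"] turning_pointsD(1)[OF R, of "c + 1"] in auto)
    then show ?thesis
    proof (elim disjE exE conjE)
      assume "src (X (P (a + 1 + 1))) \<prec> src (Y (R (c + 1 + 1)))"
      with eq show ?thesis
        by (intro disjI2 exI[of _ 1]) (auto simp: le_Suc_eq)
    next
      fix n assume n: "n \<ge> 1"
        "\<forall>\<tau>. 1 \<le> \<tau> \<and> \<tau> \<le> n \<longrightarrow> src (X (P (a + 1 + int \<tau>))) = src (Y (R (c + 1 + int \<tau>)))"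
        "src (X (P (a + 1 + int n + 1))) \<prec> src (Y (R (c + 1 + int n + 1)))"
      have "src (X (P (a + int \<tau>))) = src (Y (R (c + int \<tau>)))" if "1 \<le> \<tau>" "\<tau> \<le> Suc n" for \<tau>
      proof (cases "\<tau> = 1")
        case False
        with that have "1 \<le> \<tau> - 1" "\<tau> - 1 \<le> n" "a + 1 + int (\<tau> - 1) = a + int \<tau>" "c + 1 + int (\<tau> - 1) = c + int \<tau>"
          by auto
        with n(2) show ?thesis by metis
      qed (simp add: eq)
      moreover have "src (X (P (a + int (Suc n) + 1))) \<prec> src (Y (R (c + int (Suc n) + 1)))"
        using n(3) by (simp add: algebra_simps)
      ultimately show ?thesis
        by (intro disjI2 exI[of _ "Suc n"]) simp
    qed
  next
    case False
    \<comment> \<open>Both runs now reach the end of the match, where the letters still agree; one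
      of them stops there and the other continues.\<close>
    have last: "src (X (i + int m)) = src (Y (j + int m))"
      using agree[of "m - 1"] less.prems(1) bistring_tgt[OF X, of "i + int (m - 1)"] bistring_tgt[OF Y, of "j + int (m - 1)"]
      by (simp add: of_nat_diff algebra_simps)
    have "src (X (P (a + 1))) \<prec> src (Y (R (c + 1)))"
    proof (cases "direct (X i)")
      case True
      have "y = m"
        using False less.prems(4) True dij uY[of "j + int m"] by (cases "y = m") auto
      moreover have "x > m"
        using False less.prems(3) True eX by (cases "x = m") auto
      then have "src (X (i + int x)) \<prec> src (X (i + int m))"
        using uniform_less[OF X uniform_mono[OF unX], of "i + int m" "i + int x"] True by simp
      ultimately show ?thesis
        using x y last by simp
    next
      case d: False
      have "x = m"
        using False less.prems(3) d uX[of "i + int m"] by (cases "x = m") auto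
      moreover have "y > m"
        using False less.prems(4) d dij eY by (cases "y = m") auto
      then have "src (Y (j + int m)) \<prec> src (Y (j + int y))"
        using uniform_less[OF Y uniform_mono[OF unY], of "j + int m" "j + int y"] d dij by simp
      ultimately show ?thesis
        using x y last by simp
    qed
    then show ?thesis ..
  qed
qed

text \<open>The crossing is entered on a rising run of \<open>X\<close> and a falling run of
  \<open>Y\<close>. An empty match is a turning point of both words and gives the first pattern with
  n = 1; a nonempty one is followed by \<open>crossing_march\<close>.\<close>

lemma crossing_imp_zigzag_or_trace:
  assumes "crossing X Y"
  shows "zigzag_cross (\<lambda>a. src (X (P a))) (\<lambda>c. src (Y (R c))) \<or> trace_cross X P Y R"
proof -
  obtain i j m where ij: "src (X i) = src (Y j)" "\<forall>\<tau><m. X (i + int \<tau>) = Y (j + int \<tau>)"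
    "\<not> direct (X (i - 1))" "direct (X (i + int m))" "direct (Y (j - 1))" "\<not> direct (Y (j + int m))"
    using assms unfolding crossing_def by blast
  obtain a where a: "P a \<le> i - 1" "i - 1 < P (a + 1)"
    using turning_points_cover[OF P] .
  obtain c where c: "R c \<le> j - 1" "j - 1 < R (c + 1)"
    using turning_points_cover[OF R] .
  have uX: "\<not> direct (X u)" if "P a \<le> u" "u < P (a + 1)" for u
    using uniformD[OF turning_pointsD(2)[OF P, of a], of u] uniformD[OF turning_pointsD(2)[OF P, of a], of "i - 1"] that a ij by simp
  have uY: "direct (Y u)" if "R c \<le> u" "u < R (c + 1)" for u
    using uniformD[OF turning_pointsD(2)[OF R, of c], of u] uniformD[OF turning_pointsD(2)[OF R, of c], of "j - 1"] that c ij by simp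
  have endX: "P (a + 1) = i" if "direct (X i)"
    using uX[of i] that a by (cases "P (a + 1) = i") auto
  have endY: "R (c + 1) = j" if "\<not> direct (Y j)"
    using uY[of j] that c by (cases "R (c + 1) = j") auto
  have lessX: "src (X (P a)) \<prec> src (X i)"
    using uniform_less[OF X, of False "P a" i] uX a by (auto simp: uniform_def)
  have lessY: "src (Y j) \<prec> src (Y (R c))"
    using uniform_less[OF Y, of True "R c" j] uY c by (auto simp: uniform_def)
  show ?thesis
  proof (cases "m = 0")
    case True
    with ij endX endY have e: "P (a + 1) = i" "R (c + 1) = j" "direct (X i)" "\<not> direct (Y j)" by auto
    have "src (X (P (a + 1 + 1))) \<prec> src (X i)"
      using turning_letters[OF X P, of "a + 1"] e by simp
    moreover have "src (Y j) \<prec> src (Y (R (c + 1 + 1)))"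
      using turning_letters[OF Y R, of "c + 1"] e by simp
    ultimately have "src (X (P (a + 1 + 1))) \<prec> src (Y (R (c + 1 + 1)))" "src (X (P a)) \<prec> src (Y (R c))"
      using less_trans lessX lessY ij(1) by metis+
    then have "zigzag_cross (\<lambda>a. src (X (P a))) (\<lambda>c. src (Y (R c)))"
      unfolding zigzag_cross_def using ij(1) e
      by (intro exI[of _ a] exI[of _ c] exI[of _ 1]) (auto simp: le_Suc_eq)
    then show ?thesis ..
  next
    case False
    then have XY: "X i = Y j" using ij(2) by force
    \<comment> \<open>A direct first common syllable starts a run of \<open>X\<close> and continues
      the run of \<open>Y\<close>; an inverse one does the opposite. In both cases the run that
      started before the match supplies the strict inequality.\<close>
    have "\<exists>a c. P a \<le> i \<and> i < P (a + 1) \<and> R c \<le> j \<and> j < R (c + 1) \<and> src (X (P a)) \<prec> src (Y (R c))"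
    proof (cases "direct (X i)")
      case True
      then have "P (a + 1) = i" "direct (Y j)" using endX XY by auto
      moreover have "R (c + 1) \<noteq> j"
        using calculation turning_pointsD(3)[OF R, of c] uY[of "R c"] turning_pointsD(1)[OF R, of c] by auto
      ultimately show ?thesis
        using c lessY ij(1) turning_pointsD(1)[OF P, of "a + 1"]
        by (intro exI[of _ "a + 1"] exI[of _ c]) auto
    next
      case False
      then have "R (c + 1) = j" "\<not> direct (Y j)" using endY XY by auto
      moreover have "P (a + 1) \<noteq> i"
        using False turning_pointsD(3)[OF P, of a] uX[of "P a"] turning_pointsD(1)[OF P, of a] by auto
      ultimately show ?thesis
        using a lessX ij(1) turning_pointsD(1)[OF R, of "c + 1"]
        by (intro exI[of _ a] exI[of _ "c + 1"]) auto
    qed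
    then obtain a c where ac: "P a \<le> i" "i < P (a + 1)" "R c \<le> j" "j < R (c + 1)"
      and less: "src (X (P a)) \<prec> src (Y (R c))" by blast
    have d: "direct (X (P a)) = direct (Y (R c))"
      using uniformD[OF turning_pointsD(2)[OF P] ac(1,2)] uniformD[OF turning_pointsD(2)[OF R] ac(3,4)] XY by simp
    have "m > 0" using False by simp
    from crossing_march[OF this ij(2,4,6) ac]
    show ?thesis
    proof (elim disjE exE conjE)
      assume "src (X (P (a + 1))) \<prec> src (Y (R (c + 1)))"
      with less d ac ij(1) have "trace_cross X P Y R"
        unfolding trace_cross_def
        by (intro exI[of _ a] exI[of _ c] conjI exI[of _ i] exI[of _ j]) auto
      then show ?thesis ..
    next
      fix n assume "n \<ge> 1"
        "\<forall>\<tau>. 1 \<le> \<tau> \<and> \<tau> \<le> n \<longrightarrow> src (X (P (a + int \<tau>))) = src (Y (R (c + int \<tau>)))"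
        "src (X (P (a + int n + 1))) \<prec> src (Y (R (c + int n + 1)))"
      with less show ?thesis
        unfolding zigzag_cross_def by blast
    qed
  qed
qed

theorem crossing_iff_zigzag_or_trace:
  "crossing X Y \<longleftrightarrow> zigzag_cross (\<lambda>a. src (X (P a))) (\<lambda>c. src (Y (R c))) \<or> trace_cross X P Y R"
  using crossing_imp_zigzag_or_trace zigzag_cross_imp_crossing trace_cross_imp_crossing by blast

end

end

section \<open>The word of a band\<close>

lemma concat_blocks [simp]: "concat (blocks w) = w"
  by (induction w rule: blocks.induct) simp_all

lemma blocks_eq_Nil_iff [simp]: "blocks w = [] \<longleftrightarrow> w = []"
  by (cases w) simp_all

lemma blocks_mem:
  "x \<in> set (blocks w) \<Longrightarrow> x \<noteq> [] \<and> (\<forall>y\<in>set x. direct y = direct (hd x))"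
proof (induction w rule: blocks.induct)
  case (2 a w)
  from 2(2) consider "x = a # takeWhile (\<lambda>y. direct y = direct a) w"
    | "x \<in> set (blocks (dropWhile (\<lambda>y. direct y = direct a) w))"
    by auto
  then show ?case
  proof cases
    case 1
    have "direct y = direct a" if "y \<in> set x" for y
      using that[unfolded 1] set_takeWhileD[of y "\<lambda>y. direct y = direct a" w] by auto
    moreover have "x \<noteq> []" "hd x = a"
      by (simp_all add: 1)
    ultimately show ?thesis by blast
  next
    case 2
    with "2.IH" show ?thesis by blast
  qed
qed simp

lemma blocks_alternate:
  "Suc i < length (blocks w) \<Longrightarrow> direct (hd (blocks w ! Suc i)) \<noteq> direct (hd (blocks w ! i))"
proof (induction w arbitrary: i rule: blocks.induct)
  case (2 x xs)
  let ?d = "dropWhile (\<lambda>y. direct y = direct x) xs"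
  show ?case
  proof (cases i)
    case 0
    with 2(2) have "?d \<noteq> []" by auto
    moreover from this have "direct (hd ?d) \<noteq> direct x"
      by (rule hd_dropWhile)
    moreover from \<open>?d \<noteq> []\<close> have "hd (blocks ?d ! 0) = hd ?d"
      by (cases ?d) simp_all
    ultimately show ?thesis using 0 by simp
  next
    case (Suc j)
    with 2 show ?thesis by simp
  qed
qed simp

lemma nth_concat_take:
  assumes "i < length xss" "j < length (xss ! i)"
  shows "concat xss ! (length (concat (take i xss)) + j) = xss ! i ! j"
    "length (concat (take i xss)) + j < length (concat xss)"
proof -
  have "concat xss = concat (take i xss) @ xss ! i @ concat (drop (Suc i) xss)"
    using assms(1) by (metis concat.simps(2) concat_append id_take_nth_drop)
  with assms(2) show "concat xss ! (length (concat (take i xss)) + j) = xss ! i ! j"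
    "length (concat (take i xss)) + j < length (concat xss)"
    by (simp_all add: nth_append)
qed

lemma concat_position:
  assumes "j < length (concat xss)"
  shows "\<exists>i<length xss. length (concat (take i xss)) \<le> j \<and> j < length (concat (take (Suc i) xss))"
  using assms
proof (induction xss arbitrary: j)
  case (Cons x xss)
  show ?case
  proof (cases "j < length x")
    case False
    with Cons.prems have "j - length x < length (concat xss)" by simp
    then obtain i where "i < length xss" "length (concat (take i xss)) \<le> j - length x"
      "j - length x < length (concat (take (Suc i) xss))"
      using Cons.IH by blast
    with False show ?thesis
      by (intro exI[of _ "Suc i"]) auto
  qed (auto intro: exI[of _ 0])
qed simp

section \<open>Patterns in rotations of powers, and turning points of a band\<close>

lemma cyclic_perms_factor:
  assumes "w \<noteq> []"
  shows "(\<exists>y. n # z @ m # y \<in> cyclic_perms (word_pow N w)) \<longleftrightarrow>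
    length z + 2 \<le> N * length w \<and>
    (\<exists>a. n = per w a \<and> z = window (per w) (a + 1) (length z) \<and> m = per w (a + int (length z) + 1))"
    (is "?L \<longleftrightarrow> ?R")
proof -
  have split: "window (per w) a (Suc (length z + Suc q)) =
      per w a # window (per w) (a + 1) (length z) @ per w (a + int (length z) + 1) # window (per w) (a + int (length z) + 2) q" for a q
    by (simp only: window_Suc_left window_add) (simp add: algebra_simps)
  show ?thesis
  proof
    assume ?L
    then obtain y a where ya: "n # z @ m # y = window (per w) a (N * length w)"
      using cyclic_perms_word_pow[OF assms, of N] by blast
    have "N * length w = Suc (length z + Suc (length y))"
      using arg_cong[OF ya, of length] by simp
    with ya[unfolded this split] show ?R
      by (auto simp: append_eq_append_conv)
  next
    assume ?R
    then obtain a where a: "n = per w a" "z = window (per w) (a + 1) (length z)" "m = per w (a + int (length z) + 1)"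
      and len: "length z + 2 \<le> N * length w" by blast
    define q where "q = N * length w - (length z + 2)"
    have q: "N * length w = Suc (length z + Suc q)"
      using len by (simp add: q_def)
    have "n # z @ m # window (per w) (a + int (length z) + 2) q = window (per w) a (N * length w)"
      unfolding q split using a by simp
    then show ?L
      using cyclic_perms_word_pow[OF assms, of N] by blast
  qed
qed

context signed_string_algebra
begin

text \<open>A band starts with an inverse and ends with a direct syllable, so no run continues
  across the seam between two copies. Hence the blocks of \<open>b\<close>, repeated periodically,
  are exactly the runs of the bi-infinite word.\<close>

lemma band_turning_points:
  assumes b: "is_band Q \<rho> b"
  obtains P where "turning_points (per b) P"
    "\<And>a. per (band_word Q \<sigma> \<epsilon> b) a = src (per b (P a))"
proof -
  let ?bs = "blocks b"
  define r where "r = length ?bs"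
  define off where "off i = length (concat (take i ?bs))" for i
  define idx where "idx a = nat (a mod int r)" for a
  \<comment> \<open>Run a is block \<open>idx a\<close> of the copy of \<open>b\<close> with number
    \<open>a div int r\<close>.\<close>
  define P where "P a = a div int r * int (length b) + int (off (idx a))" for a
  have ne: "b \<noteq> []" and ends: "\<not> direct (hd b)" "direct (last b)"
    using b by (auto simp: is_band_def is_string_def)
  have r: "r > 0"
    using ne by (simp add: r_def)
  have idx: "idx a < r" for a
    using r by (simp add: idx_def nat_less_iff)
  have mem: "?bs ! i \<noteq> []" "y \<in> set (?bs ! i) \<Longrightarrow> direct y = direct (hd (?bs ! i))" if "i < r" for i y
    using blocks_mem[OF nth_mem, of i b] that unfolding r_def by blast+
  have off_Suc: "off (Suc i) = off i + length (?bs ! i)" if "i < r" for i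
    using that by (simp add: off_def r_def take_Suc_conv_app_nth)
  have off_r: "off r = length b"
    by (simp add: off_def r_def)
  have nth: "b ! (off i + j) = ?bs ! i ! j" "off i + j < length b" if "i < r" "j < length (?bs ! i)" for i j
    using nth_concat_take[of i ?bs j] that by (simp_all add: off_def r_def)
  have per_shift: "per b (x * int (length b) + int j) = b ! j" if "j < length b" for x j
    using that by (simp add: per_def)
  have block: "per b (P a + int j) = ?bs ! idx a ! j" if "j < length (?bs ! idx a)" for a j
    using per_shift[of "off (idx a) + j" "a div int r"] nth[OF idx that] by (simp add: P_def add.assoc)
  have start: "per b (P a) = hd (?bs ! idx a)" for a
    using block[of 0 a] mem(1)[OF idx] by (simp add: hd_conv_nth)
  \<comment> \<open>The next block lies in the same copy of \<open>b\<close>, or it is the first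
    block of the next copy.\<close>
  have idx_step: "Suc (idx a) < r \<and> idx (a + 1) = Suc (idx a) \<and> (a + 1) div int r = a div int r \<or>
      Suc (idx a) = r \<and> idx (a + 1) = 0 \<and> (a + 1) div int r = a div int r + 1" for a
  proof -
    have a: "a = a div int r * int r + int (idx a)"
      using r by (simp add: idx_def)
    show ?thesis
    proof (cases "Suc (idx a) < r")
      case True
      have "a + 1 = int (Suc (idx a)) + a div int r * int r"
        using a by linarith
      moreover have "(int (Suc (idx a)) + y * int r) mod int r = int (Suc (idx a))"
          "(int (Suc (idx a)) + y * int r) div int r = y" for y
        using True by simp_all
      ultimately have "(a + 1) mod int r = int (Suc (idx a))" "(a + 1) div int r = a div int r"
        by metis+
      with True show ?thesis
        unfolding idx_def[of "a + 1"] by simp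
    next
      case False
      with idx[of a] have e: "Suc (idx a) = r" by simp
      have "a + 1 = (a div int r + 1) * int r"
        using a e by (simp add: algebra_simps)
      moreover have "(y * int r) mod int r = 0" "(y * int r) div int r = y" for y
        using r by simp_all
      ultimately have "(a + 1) mod int r = 0" "(a + 1) div int r = a div int r + 1"
        by metis+
      with e show ?thesis
        unfolding idx_def[of "a + 1"] by simp
    qed
  qed
  have P_step: "P (a + 1) = P a + int (length (?bs ! idx a))" for a
    using idx_step[of a] off_Suc[OF idx, of a] off_r
    by (auto simp: P_def algebra_simps) (simp add: off_def)
  have alternate: "direct (hd (?bs ! idx (a + 1))) \<noteq> direct (hd (?bs ! idx a))" for a
    using idx_step[of a]
  proof (elim disjE conjE)
    assume "Suc (idx a) < r" "idx (a + 1) = Suc (idx a)"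
    then show ?thesis
      using blocks_alternate[of "idx a" b] by (simp add: r_def)
  next
    assume e: "Suc (idx a) = r" "idx (a + 1) = 0"
    have "last ?bs \<in> set ?bs"
      using ne by (intro last_in_set) simp
    then have last_bs: "last ?bs \<noteq> []" "\<forall>y\<in>set (last ?bs). direct y = direct (hd (last ?bs))"
      using blocks_mem by blast+
    have "idx a = r - 1"
      using e(1) by simp
    have "?bs ! idx (a + 1) = hd ?bs" "?bs ! idx a = last ?bs"
      unfolding e(2) \<open>idx a = r - 1\<close> r_def using ne by (simp_all add: hd_conv_nth last_conv_nth)
    moreover have "hd (hd ?bs) = hd b"
      using ne by (cases b) simp_all
    moreover have "last (last ?bs) = last b"
    proof -
      have "?bs = butlast ?bs @ [last ?bs]" using ne by simp
      then have "b = concat (butlast ?bs) @ last ?bs"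
        by (metis concat_append concat_blocks concat.simps append_Nil2)
      with last_bs show ?thesis by (metis last_appendR)
    qed
    moreover have "direct (last (last ?bs)) = direct (hd (last ?bs))"
      using last_bs by (metis last_in_set)
    ultimately show ?thesis using ends by simp
  qed
  have uni: "uniform (per b) (direct (hd (?bs ! idx a))) (P a) (P (a + 1))" for a
    unfolding uniform_def
  proof (intro allI impI)
    fix u assume u: "P a \<le> u \<and> u < P (a + 1)"
    then have j: "nat (u - P a) < length (?bs ! idx a)"
      by (simp add: P_step nat_less_iff)
    have "per b u = ?bs ! idx a ! nat (u - P a)"
      using block[OF j] u by simp
    then show "direct (per b u) \<longleftrightarrow> direct (hd (?bs ! idx a))"
      using mem(2)[OF idx nth_mem[OF j]] by simp
  qed
  have cover: "\<exists>a. P a \<le> t \<and> t < P (a + 1)" for t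
  proof -
    let ?k = "int (length b)"
    have t: "t = t div ?k * ?k + int (nat (t mod ?k))"
      using ne by simp
    have "nat (t mod ?k) < length (concat ?bs)"
      using ne by (simp add: nat_less_iff)
    then obtain i where i: "i < r" "off i \<le> nat (t mod ?k)" "nat (t mod ?k) < off (Suc i)"
      using concat_position unfolding off_def r_def by blast
    define a where "a = t div ?k * int r + int i"
    have "a div int r = t div ?k" "idx a = i"
      using i(1) by (simp_all add: a_def idx_def)
    then have "P a = t div ?k * ?k + int (off i)" "P (a + 1) = t div ?k * ?k + int (off (Suc i))"
      using off_Suc[OF i(1)] by (simp_all add: P_step) (simp_all add: P_def)
    with i t have "P a \<le> t \<and> t < P (a + 1)" by linarith
    then show ?thesis ..
  qed
  have lt: "P a < P (a + 1)" for a
    using mem(1)[OF idx] by (simp add: P_step)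
  show thesis
  proof
    show "turning_points (per b) P"
      unfolding turning_points_def start using lt uni alternate cover by blast
    show "per (band_word Q \<sigma> \<epsilon> b) a = src (per b (P a))" for a
      using idx[of a] by (simp add: start) (simp add: per_def band_word_def idx_def r_def)
  qed
qed

section \<open>Uniqueness of traces\<close>

lemma is_string_ConsD:
  assumes "is_string Q \<rho> (x # z)" "z \<noteq> []"
  shows "is_string Q \<rho> z" "src (hd z) = tgt x"
proof -
  have "x # z = [x] @ z @ []" "x # z = [] @ [x, hd z] @ tl z"
    using assms(2) by simp_all
  then have sub: "sublist z (x # z)" "sublist [x, hd z] (x # z)"
    unfolding sublist_def by blast+
  show "is_string Q \<rho> z"
    by (rule is_string_sublist[OF assms(1) sub(1) assms(2)])
  show "src (hd z) = tgt x"
    by (rule string_letters[OF is_string_sublist[OF assms(1) sub(2)]]) simp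
qed

lemma monotone_string_less:
  assumes "is_string Q \<rho> z" "\<forall>x\<in>set z. direct x \<longleftrightarrow> d"
  shows "if d then tgt (last z) \<prec> src (hd z) else src (hd z) \<prec> tgt (last z)"
  using assms
proof (induction z)
  case (Cons x z)
  have x: "arrow x \<in> arcs Q"
    using Cons.prems by (simp add: is_string_def)
  show ?case
  proof (cases "z = []")
    case True
    with x Cons.prems show ?thesis
      by (auto simp: tgt_less_src src_less_tgt)
  next
    case False
    note tail = is_string_ConsD[OF Cons.prems(1) False]
    have IH: "if d then tgt (last z) \<prec> src (hd z) else src (hd z) \<prec> tgt (last z)"
      using Cons.IH tail(1) Cons.prems(2) by simp
    have "if d then tgt x \<prec> src x else src x \<prec> tgt x"
      using x Cons.prems by (auto simp: tgt_less_src src_less_tgt)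
    then show ?thesis
      using IH tail(2) False less_trans[of "tgt (last z)" "tgt x" "src x"] less_trans[of "src x" "tgt x" "tgt (last z)"]
      by (cases d) simp_all
  qed
qed (simp add: is_string_def)

text \<open>This evaluates the \<open>THE\<close> in \<open>letter_trace\<close>. The order of p and
  q fixes the direction, and each source letter then fixes the next syllable. Neither string is a
  proper prefix of the other, because letters move strictly and never return to q.\<close>

lemma trace_string_unique:
  assumes "trace_string Q \<rho> \<sigma> \<epsilon> p q y" "trace_string Q \<rho> \<sigma> \<epsilon> p q z"
  shows "y = z"
proof -
  obtain d where d: "\<forall>x\<in>set y. direct x \<longleftrightarrow> d"
    using assms(1) unfolding trace_string_def by blast
  obtain d' where d': "\<forall>x\<in>set z. direct x \<longleftrightarrow> d'"
    using assms(2) unfolding trace_string_def by blast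
  have "d = d'"
    using monotone_string_less[OF _ d] monotone_string_less[OF _ d'] assms less_asym[of p q]
    by (cases d; cases d') (auto simp: trace_string_def)
  with d' have "\<forall>x\<in>set z. direct x \<longleftrightarrow> d" by simp
  moreover have "is_string Q \<rho> y" "is_string Q \<rho> z" "src (hd y) = src (hd z)" "tgt (last y) = tgt (last z)"
    using assms by (auto simp: trace_string_def)
  ultimately show ?thesis
    using d
  proof (induction y arbitrary: z)
    case (Cons x y z')
    have "z' \<noteq> []"
      using Cons.prems(3) by (simp add: is_string_def)
    then obtain x' z where z': "z' = x' # z"
      by (cases z') simp_all
    have arcs: "arrow x \<in> arcs Q" "arrow x' \<in> arcs Q"
      using Cons.prems by (auto simp: is_string_def z')
    have "x = x'"
      using Cons.prems arcs by (intro src_inj) (auto simp: z')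
    have no_return: "tgt (last v) \<noteq> tgt u" if "is_string Q \<rho> (u # v)" "v \<noteq> []" "\<forall>x\<in>set v. direct x \<longleftrightarrow> d" for u v
      using monotone_string_less[OF is_string_ConsD(1)[OF that(1,2)] that(3)] is_string_ConsD(2)[OF that(1,2)]
      by (cases d) (auto simp: less_irrefl)
    have ds: "\<forall>x\<in>set y. direct x \<longleftrightarrow> d" "\<forall>x\<in>set z. direct x \<longleftrightarrow> d"
      using Cons.prems by (auto simp: z')
    have last: "tgt (last (x # y)) = tgt (last (x # z))"
      using Cons.prems \<open>x = x'\<close> by (simp add: z')
    have strings: "is_string Q \<rho> (x # y)" "is_string Q \<rho> (x # z)"
      using Cons.prems \<open>x = x'\<close> by (simp_all add: z')
    have Nil: "y = [] \<longleftrightarrow> z = []"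
      using no_return[OF strings(1) _ ds(1)] no_return[OF strings(2) _ ds(2)] last
      by (metis last_ConsL last_ConsR)
    show ?case
    proof (cases "y = []")
      case True
      with Nil \<open>x = x'\<close> show ?thesis by (simp add: z')
    next
      case False
      with Nil have "z \<noteq> []" by simp
      note tails = is_string_ConsD[OF strings(1) False] is_string_ConsD[OF strings(2) this]
      have "y = z"
      proof (rule Cons.IH)
        show "tgt (last y) = tgt (last z)"
          using last False \<open>z \<noteq> []\<close> by simp
      qed (use tails ds in simp_all)
      with \<open>x = x'\<close> show ?thesis by (simp add: z')
    qed
  qed (simp add: is_string_def)
qed

text \<open>The run between two consecutive turning points is itself a trace string, hence the one
  that the definition selects.\<close>

lemma set_letter_trace:
  assumes X: "bistring X" and P: "turning_points X P"
  shows "set (letter_trace Q \<rho> \<sigma> \<epsilon> (src (X (P a))) (src (X (P (a + 1))))) = (\<lambda>t. src (X t)) ` {P a..P (a + 1)}"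
proof -
  define n where "n = nat (P (a + 1) - P a)"
  have n: "n > 0" "P (a + 1) = P a + int n"
    using turning_pointsD(1)[OF P, of a] by (auto simp: n_def)
  let ?z = "window X (P a) n"
  have "direct x \<longleftrightarrow> direct (X (P a))" if x: "x \<in> set ?z" for x
  proof -
    from x obtain i where "i < n" "x = X (P a + int i)"
      by (auto simp: window_def)
    with n show ?thesis
      using uniformD[OF turning_pointsD(2)[OF P, of a], of "P a + int i"] by simp
  qed
  then have "(\<forall>x\<in>set ?z. direct x) \<or> (\<forall>x\<in>set ?z. \<not> direct x)"
    by blast
  moreover have "hd ?z = X (P a)" "last ?z = X (P a + int (n - 1))"
    using n(1) by (simp_all add: window_def hd_map last_map)
  moreover have "tgt (X (P a + int (n - 1))) = src (X (P (a + 1)))"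
    using n by (simp add: bistring_tgt[OF X] of_nat_diff)
  ultimately have z: "trace_string Q \<rho> \<sigma> \<epsilon> (src (X (P a))) (src (X (P (a + 1)))) ?z"
    using X n(1) by (simp add: trace_string_def bistring_def)
  then have the: "(THE z. trace_string Q \<rho> \<sigma> \<epsilon> (src (X (P a))) (src (X (P (a + 1)))) z) = ?z"
    by (intro the_equality) (auto intro: trace_string_unique)
  have "{P a..P (a + 1)} = (\<lambda>i. P a + int i) ` {0..<n} \<union> {P (a + 1)}"
  proof (intro equalityI subsetI)
    fix t assume t: "t \<in> {P a..P (a + 1)}"
    show "t \<in> (\<lambda>i. P a + int i) ` {0..<n} \<union> {P (a + 1)}"
    proof (cases "t = P (a + 1)")
      case False
      with t n have "t = P a + int (nat (t - P a))" "nat (t - P a) \<in> {0..<n}" by auto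
      then show ?thesis by blast
    qed simp
  qed (use n in auto)
  then have "(\<lambda>t. src (X t)) ` {P a..P (a + 1)} = set (map src ?z @ [src (X (P (a + 1)))])"
    by (simp add: window_def image_Un image_image insert_commute)
  moreover have "letter_trace Q \<rho> \<sigma> \<epsilon> (src (X (P a))) (src (X (P (a + 1)))) = map src ?z @ [src (X (P (a + 1)))]"
    unfolding letter_trace_def the using z by auto
  ultimately show ?thesis by simp
qed

text \<open>Powers and rotations disappear: both patterns become statements about positions in the
  bi-infinite words.\<close>

lemma weakly_perfectly_clustering_iff:
  assumes "w1 \<noteq> []" "w2 \<noteq> []"
  shows "weakly_perfectly_clustering Q \<rho> \<sigma> \<epsilon> w1 w2 \<longleftrightarrow>
    \<not> zigzag_cross (per w1) (per w2) \<and>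
    \<not> (\<exists>a c. per w1 a \<prec> per w2 c \<and> per w1 (a + 1) \<prec> per w2 (c + 1) \<and>
         (per w1 a \<prec> per w1 (a + 1) \<longleftrightarrow> per w2 c \<prec> per w2 (c + 1)) \<and>
         set (letter_trace Q \<rho> \<sigma> \<epsilon> (per w1 a) (per w1 (a + 1))) \<inter>
         set (letter_trace Q \<rho> \<sigma> \<epsilon> (per w2 c) (per w2 (c + 1))) \<noteq> {})"
proof -
  let ?V = "per w1" and ?W = "per w2"
  define N where "N = length w1 * length w2"
  have N: "N > 0" "2 * length w2 * length w1 = 2 * N" "2 * length w1 * length w2 = 2 * N"
    using assms by (simp_all add: N_def)
  note factor = cyclic_perms_factor[OF assms(1), of _ _ _ "2 * length w2", unfolded N]
    cyclic_perms_factor[OF assms(2), of _ _ _ "2 * length w1", unfolded N]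
  have win: "window ?V a n = window ?W c n \<longleftrightarrow> (\<forall>i<n. ?V (a + int i) = ?W (c + int i))" for a c n
    by (auto simp: list_eq_iff_nth_eq)
  have shift: "(\<forall>i<n. ?V (a + 1 + int i) = ?W (c + 1 + int i)) \<longleftrightarrow>
      (\<forall>\<tau>. 1 \<le> \<tau> \<and> \<tau> \<le> n \<longrightarrow> ?V (a + int \<tau>) = ?W (c + int \<tau>))" for a c n
  proof (intro iffI allI impI)
    fix \<tau> assume eq: "\<forall>i<n. ?V (a + 1 + int i) = ?W (c + 1 + int i)" and \<tau>: "1 \<le> \<tau> \<and> \<tau> \<le> n"
    from \<tau> have "\<tau> - 1 < n" "a + 1 + int (\<tau> - 1) = a + int \<tau>" "c + 1 + int (\<tau> - 1) = c + int \<tau>"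
      by auto
    with eq show "?V (a + int \<tau>) = ?W (c + int \<tau>)"
      by metis
  next
    fix i assume eq: "\<forall>\<tau>. 1 \<le> \<tau> \<and> \<tau> \<le> n \<longrightarrow> ?V (a + int \<tau>) = ?W (c + int \<tau>)" and "i < n"
    then have "1 \<le> Suc i \<and> Suc i \<le> n" by simp
    with eq have "?V (a + int (Suc i)) = ?W (c + int (Suc i))" by blast
    then show "?V (a + 1 + int i) = ?W (c + 1 + int i)"
      by (simp add: algebra_simps)
  qed
  \<comment> \<open>\<open>N\<close> is a period of both words. An agreement of \<open>N\<close>
    letters would reach the places \<open>a + int N\<close> and \<open>c + int N\<close> and make
    \<open>?V a\<close> equal to \<open>?W c\<close>. So n < N, and n + 2 \<le> N + 1 \<le>
    2N.\<close>
  have bound: "n + 2 \<le> 2 * N" if less: "?V a \<prec> ?W c"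
    and eq: "\<forall>\<tau>. 1 \<le> \<tau> \<and> \<tau> \<le> n \<longrightarrow> ?V (a + int \<tau>) = ?W (c + int \<tau>)" for a c n
  proof -
    have "?V (a + int N) = ?V a" "?W (c + int N) = ?W c"
      by (intro per_mod_eq; simp add: N_def)+
    then have "\<not> (1 \<le> N \<and> N \<le> n)"
      using eq less less_irrefl by metis
    with N(1) show ?thesis by simp
  qed
  have factors: "(\<exists>n' m' n'' m'' z z' z''.
      n' # z @ m' # z' \<in> cyclic_perms (word_pow (2 * length w2) w1) \<and>
      n'' # z @ m'' # z'' \<in> cyclic_perms (word_pow (2 * length w1) w2) \<and>
      n' \<prec> n'' \<and> m' \<prec> m'' \<and> length z \<ge> 1) \<longleftrightarrow> zigzag_cross ?V ?W" (is "?L \<longleftrightarrow> ?R")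
  proof
    assume ?L
    then obtain n' m' n'' m'' z where
      "\<exists>y. n' # z @ m' # y \<in> cyclic_perms (word_pow (2 * length w2) w1)"
      "\<exists>y. n'' # z @ m'' # y \<in> cyclic_perms (word_pow (2 * length w1) w2)"
      and less: "n' \<prec> n''" "m' \<prec> m''" "length z \<ge> 1" by blast
    then obtain a c where a: "n' = ?V a" "z = window ?V (a + 1) (length z)" "m' = ?V (a + int (length z) + 1)"
      and c: "n'' = ?W c" "z = window ?W (c + 1) (length z)" "m'' = ?W (c + int (length z) + 1)"
      unfolding factor by blast
    have "window ?V (a + 1) (length z) = window ?W (c + 1) (length z)"
      using a(2) c(2) by metis
    with a c less show ?R
      unfolding zigzag_cross_def win shift by blast
  next
    assume ?R
    then obtain a c n where n: "n \<ge> 1" and less: "?V a \<prec> ?W c" "?V (a + int n + 1) \<prec> ?W (c + int n + 1)"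
      and eq: "\<forall>\<tau>. 1 \<le> \<tau> \<and> \<tau> \<le> n \<longrightarrow> ?V (a + int \<tau>) = ?W (c + int \<tau>)"
      unfolding zigzag_cross_def by blast
    define z where "z = window ?V (a + 1) n"
    have z: "length z = n" "z = window ?V (a + 1) n" "z = window ?W (c + 1) n"
      using eq unfolding z_def win shift by simp_all
    have "\<exists>y. ?V a # z @ ?V (a + int n + 1) # y \<in> cyclic_perms (word_pow (2 * length w2) w1)"
      "\<exists>y. ?W c # z @ ?W (c + int n + 1) # y \<in> cyclic_perms (word_pow (2 * length w1) w2)"
      unfolding factor z(1) using z(2,3) bound[OF less(1) eq] by blast+
    with less n z(1) show ?L by blast
  qed
  \<comment> \<open>For two consecutive letters the length condition is 2 \<le> 2N, so it holds
    whatever the relation \<open>S\<close> between the letters is.\<close>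
  have "(\<exists>n' m' n'' m'' z' z''.
      n' # m' # z' \<in> cyclic_perms (word_pow (2 * length w2) w1) \<and>
      n'' # m'' # z'' \<in> cyclic_perms (word_pow (2 * length w1) w2) \<and> S n' m' n'' m'') \<longleftrightarrow>
      (\<exists>a c. S (?V a) (?V (a + 1)) (?W c) (?W (c + 1)))" for S
  proof -
    have "(\<exists>y. n # m # y \<in> cyclic_perms (word_pow (2 * length w2) w1)) \<longleftrightarrow> (\<exists>a. n = ?V a \<and> m = ?V (a + 1))"
      "(\<exists>y. n # m # y \<in> cyclic_perms (word_pow (2 * length w1) w2)) \<longleftrightarrow> (\<exists>a. n = ?W a \<and> m = ?W (a + 1))" for n m
      using factor[of n "[]" m] N(1) by simp_all
    note pair = this
    have "(\<exists>n' m' n'' m'' z' z''.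
      n' # m' # z' \<in> cyclic_perms (word_pow (2 * length w2) w1) \<and>
      n'' # m'' # z'' \<in> cyclic_perms (word_pow (2 * length w1) w2) \<and> S n' m' n'' m'') \<longleftrightarrow>
      (\<exists>n' m' n'' m''. (\<exists>z'. n' # m' # z' \<in> cyclic_perms (word_pow (2 * length w2) w1)) \<and>
      (\<exists>z''. n'' # m'' # z'' \<in> cyclic_perms (word_pow (2 * length w1) w2)) \<and> S n' m' n'' m'')"
      by blast
    then show ?thesis unfolding pair by blast
  qed
  note pairs = this[of "\<lambda>n' m' n'' m''. n' \<prec> n'' \<and> m' \<prec> m'' \<and> (n' \<prec> m' \<longleftrightarrow> n'' \<prec> m'') \<and>
    set (letter_trace Q \<rho> \<sigma> \<epsilon> n' m') \<inter> set (letter_trace Q \<rho> \<sigma> \<epsilon> n'' m'') \<noteq> {}"]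
  show ?thesis
    unfolding weakly_perfectly_clustering_def factors pairs ..
qed

text \<open>By \<open>turning_direct_iff\<close>, the requirement that both pairs of letters are
  ordered alike says that the two runs have the same direction.\<close>

theorem weakly_perfectly_clustering_iff_not_crossing:
  assumes b: "is_band Q \<rho> b" and c: "is_band Q \<rho> c"
  shows "weakly_perfectly_clustering Q \<rho> \<sigma> \<epsilon> (band_word Q \<sigma> \<epsilon> b) (band_word Q \<sigma> \<epsilon> c) \<longleftrightarrow> \<not> crossing (per b) (per c)"
proof -
  obtain P where P: "turning_points (per b) P" "\<And>a. per (band_word Q \<sigma> \<epsilon> b) a = src (per b (P a))"
    using band_turning_points[OF b] by blast
  obtain R where R: "turning_points (per c) R" "\<And>a. per (band_word Q \<sigma> \<epsilon> c) a = src (per c (R a))"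
    using band_turning_points[OF c] by blast
  have ne: "band_word Q \<sigma> \<epsilon> b \<noteq> []" "band_word Q \<sigma> \<epsilon> c \<noteq> []"
    using b c by (auto simp: band_word_def is_band_def is_string_def)
  note X = band_bistring[OF b] and Y = band_bistring[OF c]
  have words: "per (band_word Q \<sigma> \<epsilon> b) = (\<lambda>a. src (per b (P a)))" "per (band_word Q \<sigma> \<epsilon> c) = (\<lambda>a. src (per c (R a)))"
    using P(2) R(2) by blast+
  have inter: "(\<lambda>t. src (per b t)) ` {i..j} \<inter> (\<lambda>s. src (per c s)) ` {i'..j'} \<noteq> {} \<longleftrightarrow>
      (\<exists>t s. i \<le> t \<and> t \<le> j \<and> i' \<le> s \<and> s \<le> j' \<and> src (per b t) = src (per c s))" for i j i' j'
    by fastforce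
  have neg: "(\<not> x \<longleftrightarrow> \<not> y) \<longleftrightarrow> x = y" for x y
    by blast
  show ?thesis
    unfolding weakly_perfectly_clustering_iff[OF ne] crossing_iff_zigzag_or_trace[OF X Y P(1) R(1)]
      trace_cross_def words set_letter_trace[OF X P(1)] set_letter_trace[OF Y R(1)]
      turning_direct_iff[OF X P(1)] turning_direct_iff[OF Y R(1)] inter neg de_Morgan_disj ..
qed

end

section \<open>Bricks and scalar endomorphisms\<close>

definition scalar_endo :: "('v, 'a) pre_digraph \<Rightarrow> ('v, 'a, 'k, 'm) rep \<Rightarrow> 'k \<Rightarrow> 'v \<Rightarrow> 'm \<Rightarrow> 'm" where
  "scalar_endo Q M c = (\<lambda>v\<in>verts Q. \<lambda>x\<in>rep_space M v. rep_scale M c x)"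

lemma scalar_endo_in_endos:
  assumes "wf_digraph Q" and rep: "is_rep Q \<rho> M"
  shows "scalar_endo Q M c \<in> endos Q M"
proof -
  interpret wf_digraph Q by fact
  interpret vector_space "rep_scale M"
    using rep by (simp add: is_rep_def)
  have sub: "subspace (rep_space M v)" if "v \<in> verts Q" for v
    using rep that by (simp add: is_rep_def)
  have lin: "linear_between (rep_scale M) (rep_space M (tail Q \<alpha>)) (rep_space M (head Q \<alpha>)) (rep_map M \<alpha>)"
    if "\<alpha> \<in> arcs Q" for \<alpha>
    using rep that by (simp add: is_rep_def)
  have "linear_between (rep_scale M) (rep_space M v) (rep_space M v) (scalar_endo Q M c v)" if v: "v \<in> verts Q" for v
    using subspace_scale[OF sub[OF v]] subspace_add[OF sub[OF v]] v
    by (auto simp: linear_between_def scalar_endo_def scale_right_distrib mult.commute)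
  moreover have "scalar_endo Q M c (head Q \<alpha>) (rep_map M \<alpha> x) = rep_map M \<alpha> (scalar_endo Q M c (tail Q \<alpha>) x)"
    if "\<alpha> \<in> arcs Q" "x \<in> rep_space M (tail Q \<alpha>)" for \<alpha> x
    using lin[OF that(1)] that by (auto simp: linear_between_def scalar_endo_def image_subset_iff)
  moreover have "scalar_endo Q M c \<in> (\<Pi>\<^sub>E v\<in>verts Q. rep_space M v \<rightarrow>\<^sub>E rep_space M v)"
    using subspace_scale[OF sub] by (auto simp: scalar_endo_def PiE_iff)
  ultimately show ?thesis
    by (simp add: endos_def)
qed

text \<open>An algebra isomorphism h to the field sends the scalar endomorphism c to c. So
  \<open>\<phi>\<close> and the scalar \<open>h \<phi>\<close> have the same image and
  coincide.\<close>

lemma brick_endo_scalar: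
  assumes wf: "wf_digraph Q" and brick: "is_brick Q \<rho> M" and \<phi>: "\<phi> \<in> endos Q M"
  obtains c where "\<phi> = scalar_endo Q M c"
proof -
  let ?E = "endo_algebra Q M"
  have rep: "is_rep Q \<rho> M"
    using brick by (simp add: is_brick_def)
  interpret vector_space "rep_scale M"
    using rep by (simp add: is_rep_def)
  obtain h where h: "h \<in> ring_iso ?E ground_algebra"
    "\<And>c x. x \<in> carrier ?E \<Longrightarrow> h (c \<odot>\<^bsub>?E\<^esub> x) = c * h x"
    using brick by (auto simp: is_brick_def algebra_iso_def ground_algebra_def)
  have smult: "c \<odot>\<^bsub>?E\<^esub> \<one>\<^bsub>?E\<^esub> = scalar_endo Q M c" for c
    by (simp add: endo_algebra_def scalar_endo_def restrict_def fun_eq_iff)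
  have one: "\<one>\<^bsub>?E\<^esub> = scalar_endo Q M 1"
    by (simp add: endo_algebra_def scalar_endo_def)
  have carrier: "carrier ?E = endos Q M"
    by (simp add: endo_algebra_def)
  have scalar: "scalar_endo Q M c \<in> endos Q M" for c
    by (rule scalar_endo_in_endos[OF wf rep])
  have "h (scalar_endo Q M (h \<phi>)) = h \<phi> * h \<one>\<^bsub>?E\<^esub>"
    using h(2)[of "\<one>\<^bsub>?E\<^esub>" "h \<phi>"] scalar unfolding carrier one smult[symmetric, of "h \<phi>"] by simp
  also have "h \<one>\<^bsub>?E\<^esub> = 1"
    using h(1) by (simp add: ring_iso_def Ring.ring_hom_def ground_algebra_def)
  finally have "h \<phi> = h (scalar_endo Q M (h \<phi>))"
    by simp
  then have "\<phi> = scalar_endo Q M (h \<phi>)"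
    using h(1) \<phi> scalar unfolding ring_iso_def bij_betw_def carrier by (auto dest: inj_onD)
  with that show thesis .
qed

text \<open>The nonzero vector makes distinct scalars act differently, so the map from scalars to
  endomorphisms has an inverse, which is the required isomorphism.\<close>

lemma brickI_scalar:
  fixes M :: "('v, 'a, 'k::field, 'm::ab_group_add) rep"
  assumes "wf_digraph Q" and rep: "is_rep Q \<rho> M"
    and v: "v \<in> verts Q" and x: "x \<in> rep_space M v" "x \<noteq> 0"
    and scalar: "\<And>\<phi>. \<phi> \<in> endos Q M \<Longrightarrow> \<exists>c. \<phi> = scalar_endo Q M c"
  shows "is_brick Q \<rho> M"
proof -
  let ?E = "endo_algebra Q M"
  interpret vector_space "rep_scale M"
    using rep by (simp add: is_rep_def)
  have sub: "subspace (rep_space M v)" if "v \<in> verts Q" for v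
    using rep that by (simp add: is_rep_def)
  have inj: "c = d" if "scalar_endo Q M c = scalar_endo Q M d" for c d
  proof -
    have "scalar_endo Q M c v x = scalar_endo Q M d v x"
      by (simp add: that)
    with v x have "rep_scale M c x = rep_scale M d x"
      by (simp add: scalar_endo_def)
    with x(2) show ?thesis
      by (rule scale_right_imp_eq)
  qed
  have carrier: "carrier ?E = range (scalar_endo Q M)"
    using scalar scalar_endo_in_endos[OF assms(1,2)] by (auto simp: endo_algebra_def)
  define h where "h = inv_into UNIV (scalar_endo Q M)"
  have h: "h (scalar_endo Q M c) = c" for c
    unfolding h_def by (intro inv_f_f injI inj)
  have ops: "scalar_endo Q M c \<otimes>\<^bsub>?E\<^esub> scalar_endo Q M d = scalar_endo Q M (c * d)"
    "scalar_endo Q M c \<oplus>\<^bsub>?E\<^esub> scalar_endo Q M d = scalar_endo Q M (c + d)"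
    "\<one>\<^bsub>?E\<^esub> = scalar_endo Q M 1"
    "c \<odot>\<^bsub>?E\<^esub> scalar_endo Q M d = scalar_endo Q M (c * d)" for c d
    using subspace_scale[OF sub]
    by (auto simp: endo_algebra_def scalar_endo_def restrict_def fun_eq_iff scale_left_distrib)
  have "h \<in> Ring.ring_hom ?E ground_algebra"
    by (intro ring_hom_memI) (auto simp: carrier ops h ground_algebra_def)
  moreover have "bij_betw h (carrier ?E) (carrier (ground_algebra :: ('k, 'k) module))"
    by (auto simp: bij_betw_def inj_on_def carrier h ground_algebra_def image_image)
  ultimately have "h \<in> algebra_iso ?E ground_algebra"
    by (auto simp: algebra_iso_def ring_iso_def carrier ops h ground_algebra_def)
  with rep show ?thesis
    by (auto simp: is_brick_def)
qed

section \<open>Jordan blocks of size at least two\<close>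

text \<open>Row i of a Jordan block has nonzero entries at most in the columns i and i + 1; this is
  the form in which arrows are computed below.\<close>

lemma band_module_map:
  fixes \<mu> :: "'k::field"
  assumes "i < l"
  shows "rep_map (band_module Q b l \<mu> p) \<alpha> x j i =
    (\<Sum>q | q < length b \<and> arrow (b ! q) = \<alpha> \<and> arrow_to b q = j.
      if q = p then \<mu> * x (arrow_from b q) i + (if Suc i < l then x (arrow_from b q) (Suc i) else 0)
      else x (arrow_from b q) i)"
proof -
  have row: "(jordan_block l \<mu> *\<^sub>v vec l y) $ i = \<mu> * y i + (if Suc i < l then y (Suc i) else 0)" for y :: "nat \<Rightarrow> 'k"
  proof -
    have "(jordan_block l \<mu> *\<^sub>v vec l y) $ i = (\<Sum>j = 0..<l. (if i = j then \<mu> else if Suc i = j then 1 else 0) * y j)"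
      using assms by (simp add: scalar_prod_def jordan_block_def)
    also have "\<dots> = (\<Sum>j = 0..<l. (if j = i then \<mu> * y j else 0) + (if j = Suc i then y j else 0))"
      by (intro sum.cong) auto
    also have "\<dots> = \<mu> * y i + (if Suc i < l then y (Suc i) else 0)"
      using assms by (simp add: sum.distrib sum.delta)
    finally show ?thesis .
  qed
  have unit: "(1\<^sub>m l *\<^sub>v vec l y) $ i = y i" for y :: "nat \<Rightarrow> 'k"
    using assms by (simp add: one_mult_mat_vec)
  have "rep_map (band_module Q b l \<mu> p) \<alpha> x j i =
    (\<Sum>q | q < length b \<and> arrow (b ! q) = \<alpha> \<and> arrow_to b q = j.
      ((if q = p then jordan_block l \<mu> else 1\<^sub>m l) *\<^sub>v vec l (x (arrow_from b q))) $ i)"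
    using assms by (simp add: band_module_def del: index_mult_mat_vec)
  also have "\<dots> = (\<Sum>q | q < length b \<and> arrow (b ! q) = \<alpha> \<and> arrow_to b q = j.
      if q = p then \<mu> * x (arrow_from b q) i + (if Suc i < l then x (arrow_from b q) (Suc i) else 0)
      else x (arrow_from b q) i)"
    by (intro sum.cong refl) (simp only: row unit split: if_split, blast)
  finally show ?thesis .
qed

lemma band_module_space:
  "x \<in> rep_space (band_module Q b l \<mu> p) v \<longleftrightarrow> (\<forall>j i. x j i \<noteq> 0 \<longrightarrow> j < length b \<and> i < l \<and> syl_src Q (b ! j) = v)"
  by (simp add: band_module_def)

lemma band_module_scale: "rep_scale (band_module Q b l \<mu> p) c x j i = c * x j i"
  by (simp add: band_module_def)

text \<open>The nilpotent part of the Jordan block, acting on every copy of \<open>K\<^sup>l\<close>, is an endomorphism.\<close>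

lemma band_module_not_brick:
  fixes \<mu> :: "'k::field"
  assumes wf: "wf_digraph Q" and l: "l \<ge> 2" and b: "b \<noteq> []" "syl_src Q (b ! 0) \<in> verts Q"
  shows "\<not> is_brick Q \<rho> (band_module Q b l \<mu> p)"
proof
  let ?M = "band_module Q b l \<mu> p"
  \<comment> \<open>Being a brick includes being a representation; from this
    \<open>map_space\<close> takes that arrows respect the vertex spaces.\<close>
  assume brick: "is_brick Q \<rho> ?M"
  interpret wf_digraph Q by fact
  define N :: "(nat \<Rightarrow> nat \<Rightarrow> 'k) \<Rightarrow> nat \<Rightarrow> nat \<Rightarrow> 'k" where
    "N x j i = (if Suc i < l then x j (Suc i) else 0)" for x j i
  define \<phi> where "\<phi> = (\<lambda>v\<in>verts Q. \<lambda>x\<in>rep_space ?M v. N x)"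
  have N_space: "N x \<in> rep_space ?M v" if "x \<in> rep_space ?M v" for x v
    using that unfolding band_module_space by (auto simp: N_def split: if_splits)
  have lin: "x + y \<in> rep_space ?M v" "rep_scale ?M c x \<in> rep_space ?M v"
    if "x \<in> rep_space ?M v" "y \<in> rep_space ?M v" for x y v c
    using that unfolding band_module_space by (auto simp: band_module_scale) (metis add_0)+
  have map_space: "rep_map ?M \<alpha> x \<in> rep_space ?M (head Q \<alpha>)"
    if "\<alpha> \<in> arcs Q" "x \<in> rep_space ?M (tail Q \<alpha>)" for \<alpha> x
  proof -
    have "linear_between (rep_scale ?M) (rep_space ?M (tail Q \<alpha>)) (rep_space ?M (head Q \<alpha>)) (rep_map ?M \<alpha>)"
      using brick that(1) unfolding is_brick_def is_rep_def by blast
    with that(2) show ?thesis unfolding linear_between_def by blast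
  qed
  \<comment> \<open>The Jordan block is \<open>\<mu>\<close> times the identity plus the shift
    \<open>N\<close>, so it commutes with \<open>N\<close>. In the last row both sides are
    zero.\<close>
  have N_map: "N (rep_map ?M \<alpha> x) = rep_map ?M \<alpha> (N x)" for \<alpha> x
  proof (intro ext)
    fix j i
    show "N (rep_map ?M \<alpha> x) j i = rep_map ?M \<alpha> (N x) j i"
    proof (cases "i < l")
      case True
      show ?thesis
      proof (cases "Suc i < l")
        case Suc: True
        then show ?thesis
          using True by (simp add: N_def band_module_map cong: if_cong)
      next
        case False
        then show ?thesis
          using True by (simp add: N_def band_module_map cong: if_cong)
      qed
    next
      case False
      then show ?thesis by (simp add: N_def band_module_def)
    qed
  qed
  have "\<phi> \<in> endos Q ?M"
  proof -
    have "\<phi> \<in> (\<Pi>\<^sub>E v\<in>verts Q. rep_space ?M v \<rightarrow>\<^sub>E rep_space ?M v)"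
      by (auto simp: \<phi>_def PiE_iff N_space)
    moreover have "linear_between (rep_scale ?M) (rep_space ?M v) (rep_space ?M v) (\<phi> v)" if "v \<in> verts Q" for v
      using that lin by (auto simp: linear_between_def \<phi>_def N_space fun_eq_iff N_def band_module_scale)
    moreover have "\<phi> (head Q \<alpha>) (rep_map ?M \<alpha> x) = rep_map ?M \<alpha> (\<phi> (tail Q \<alpha>) x)"
      if "\<alpha> \<in> arcs Q" "x \<in> rep_space ?M (tail Q \<alpha>)" for \<alpha> x
      using that map_space[OF that] N_map by (simp add: \<phi>_def)
    ultimately show ?thesis by (simp add: endos_def)
  qed
  then obtain c where c: "\<phi> = scalar_endo Q ?M c"
    using brick_endo_scalar[OF wf brick] by blast
  \<comment> \<open>The second basis vector of copy 0. \<open>N\<close> sends it to the first one,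
    so \<open>N x\<close> has a 1 at a place where every multiple of x has a 0.\<close>
  define x :: "nat \<Rightarrow> nat \<Rightarrow> 'k" where "x j i = (if j = 0 \<and> i = 1 then 1 else 0)" for j i
  have x: "x \<in> rep_space ?M (syl_src Q (b ! 0))"
    using b l by (auto simp: band_module_space x_def)
  have "N x = rep_scale ?M c x"
    using fun_cong[OF fun_cong[OF c, of "syl_src Q (b ! 0)"], of x] x b by (simp add: \<phi>_def scalar_endo_def)
  then have "N x 0 0 = rep_scale ?M c x 0 0" by simp
  with l show False
    by (simp add: N_def x_def band_module_scale)
qed

section \<open>Band modules of rank one\<close>

locale rank_one_band = signed_string_algebra Q \<rho> \<sigma> \<epsilon>
  for Q :: "('v, 'a) pre_digraph" and \<rho> \<sigma> \<epsilon> +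
  fixes b :: "'a syllable list" and \<mu> :: "'k::field" and p :: nat
  assumes band: "is_band Q \<rho> b" and mu: "\<mu> \<noteq> 0" and p: "p < length b"
begin

section \<open>Coordinates of a rank-one band module, indexed by integers\<close>

definition M :: "('v, 'a, 'k, nat \<Rightarrow> nat \<Rightarrow> 'k) rep" where
  "M = band_module Q b 1 \<mu> p"

abbreviation "k \<equiv> int (length b)"
abbreviation "X \<equiv> per b"

definition vx :: "int \<Rightarrow> 'v" where
  "vx t = syl_src Q (X t)"

definition co :: "(nat \<Rightarrow> nat \<Rightarrow> 'k) \<Rightarrow> int \<Rightarrow> 'k" where
  "co x t = x (nat (t mod k)) 0"

text \<open>Only the values of f at 0, ..., k - 1 are read, whence the reduction modulo k in
  \<open>co_of_co\<close>.\<close>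

definition of_co :: "(int \<Rightarrow> 'k) \<Rightarrow> nat \<Rightarrow> nat \<Rightarrow> 'k" where
  "of_co f j i = (if j < length b \<and> i = 0 then f (int j) else 0)"

text \<open>On these vectors of the ambient space the coordinates \<open>co\<close> are faithful,
  see \<open>co_eqI\<close>.\<close>

definition supported :: "(nat \<Rightarrow> nat \<Rightarrow> 'k) \<Rightarrow> bool" where
  "supported x \<longleftrightarrow> (\<forall>j i. x j i \<noteq> 0 \<longrightarrow> j < length b \<and> i = 0)"

text \<open>The scalar by which the arrow of syllable t acts; a Jordan block of size one is just
  \<open>\<mu>\<close>.\<close>

definition weight :: "int \<Rightarrow> 'k" where
  "weight t = (if nat (t mod k) = p then \<mu> else 1)"

definition basis_vec :: "int \<Rightarrow> nat \<Rightarrow> nat \<Rightarrow> 'k" where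
  "basis_vec t = of_co (\<lambda>s. if s mod k = t mod k then 1 else 0)"

lemma X: "bistring X"
  using band by (rule band_bistring)

lemma k_pos: "k > 0"
  using p by linarith

lemma mod_nonneg [simp]: "0 \<le> t mod k"
  using k_pos by simp

lemma nat_mod_less: "nat (t mod k) < length b"
  using k_pos by (simp add: nat_less_iff)

lemma weight_nonzero [simp]: "weight t \<noteq> 0"
  using mu by (simp add: weight_def)

lemma cong_X: "s mod k = t mod k \<Longrightarrow> X s = X t"
  by (rule per_mod_eq)

lemma cong_vx: "s mod k = t mod k \<Longrightarrow> vx s = vx t"
  by (simp add: vx_def cong_X[of s t])

lemma cong_co: "s mod k = t mod k \<Longrightarrow> co x s = co x t"
  by (simp add: co_def)

lemma vx_in_verts: "vx t \<in> verts Q"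
  using bistring_arrow[OF X, of t] by (cases "X t") (auto simp: vx_def)

lemma vx_Suc: "vx (t + 1) = syl_tgt Q (X t)"
  using bistring_tgt[OF X, of t] by (simp add: vx_def src_letter_def tgt_letter_def)

lemma co_of_co [simp]: "co (of_co f) t = f (t mod k)"
  using nat_mod_less[of t] by (simp add: co_def of_co_def)

lemma supported_of_co [simp]: "supported (of_co f)"
  by (simp add: supported_def of_co_def)

lemma co_basis_vec: "co (basis_vec t) s = (if s mod k = t mod k then 1 else 0)"
  by (simp add: basis_vec_def)

lemma co_eqI:
  assumes "supported x" "supported y" "\<And>t. co x t = co y t"
  shows "x = y"
proof (intro ext)
  fix j i
  show "x j i = y j i"
  proof (cases "j < length b \<and> i = 0")
    case True
    then show ?thesis
      using assms(3)[of "int j"] by (simp add: co_def)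
  next
    case False
    with assms(1,2) show ?thesis
      unfolding supported_def by metis
  qed
qed

lemma space_iff: "x \<in> rep_space M v \<longleftrightarrow> supported x \<and> (\<forall>t. co x t \<noteq> 0 \<longrightarrow> vx t = v)"
proof
  assume x: "x \<in> rep_space M v"
  then show "supported x \<and> (\<forall>t. co x t \<noteq> 0 \<longrightarrow> vx t = v)"
    by (auto simp: M_def band_module_space supported_def co_def vx_def per_def)
next
  assume x: "supported x \<and> (\<forall>t. co x t \<noteq> 0 \<longrightarrow> vx t = v)"
  show "x \<in> rep_space M v"
    unfolding M_def band_module_space
  proof (intro allI impI)
    fix j i assume "x j i \<noteq> 0"
    with x have "j < length b" "i = 0"
      by (auto simp: supported_def)
    moreover from this \<open>x j i \<noteq> 0\<close> have "co x (int j) \<noteq> 0"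
      by (simp add: co_def)
    ultimately show "j < length b \<and> i < 1 \<and> syl_src Q (b ! j) = v"
      using x by (auto simp: vx_def per_def)
  qed
qed

lemma spaceD: "x \<in> rep_space M v \<Longrightarrow> supported x" "x \<in> rep_space M v \<Longrightarrow> co x t \<noteq> 0 \<Longrightarrow> vx t = v"
  by (auto simp: space_iff)

lemma basis_vec_space: "basis_vec t \<in> rep_space M (vx t)"
  unfolding space_iff co_basis_vec by (auto simp: basis_vec_def intro: cong_vx split: if_splits)

lemma co_add: "co (x + y) t = co x t + co y t"
  by (simp add: co_def)

lemma co_scale: "co (rep_scale M c x) t = c * co x t"
  by (simp add: co_def M_def band_module_scale)

lemma co_0 [simp]: "co 0 t = 0"
  by (simp add: co_def)

lemma supported_add: "supported x \<Longrightarrow> supported y \<Longrightarrow> supported (x + y)"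
  unfolding supported_def by (metis add_0 plus_fun_apply)

lemma supported_scale: "supported x \<Longrightarrow> supported (rep_scale M c x)"
  by (auto simp: supported_def M_def band_module_scale)

lemma supported_0 [simp]: "supported 0"
  by (simp add: supported_def)

lemma supported_map: "supported (rep_map M \<alpha> x)"
  unfolding supported_def
proof (intro allI impI)
  fix j i assume nz: "rep_map M \<alpha> x j i \<noteq> 0"
  then have i: "i = 0"
    by (simp add: M_def band_module_def split: if_splits)
  have "arrow_to b q < length b" if "q < length b" for q
    using that by (simp add: arrow_to_def) (metis gr_implies_not0 mod_less_divisor not_gr_zero)
  then have "{q. q < length b \<and> arrow (b ! q) = \<alpha> \<and> arrow_to b q = j} = {}" if "\<not> j < length b"
    using that by blast
  with nz i show "j < length b \<and> i = 0"
    by (cases "j < length b") (simp_all add: M_def band_module_def)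
qed

text \<open>The arrow \<open>\<alpha>\<close> reaches copy t from t - 1 through a direct syllable or
  from t + 1 through an inverse one. Both together would put \<open>\<alpha>\<close> next to its
  inverse in a string, so the defining sum has at most one term.\<close>

lemma co_map:
  "co (rep_map M \<alpha> x) t = (if X (t - 1) = Dir \<alpha> then weight (t - 1) * co x (t - 1)
     else if X t = Inv \<alpha> then weight t * co x (t + 1) else 0)"
proof -
  define j where "j = nat (t mod k)"
  define j' where "j' = nat ((t - 1) mod k)"
  define S where "S = {q. q < length b \<and> arrow (b ! q) = \<alpha> \<and> arrow_to b q = j}"
  define f where "f q = (if q = p then \<mu> * x (arrow_from b q) 0 else x (arrow_from b q) 0)" for q
  have j: "j < length b" "j' < length b"
    by (simp_all add: j_def j'_def nat_mod_less)
  have suc: "Suc q mod length b = nat ((t + 1) mod k)" if "q = nat (t mod k)" for q t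
  proof -
    have "int (Suc q mod length b) = (t mod k + 1) mod k"
      using that by (simp add: zmod_int add.commute)
    also have "\<dots> = (t + 1) mod k"
      by (rule mod_add_left_eq)
    finally show ?thesis by linarith
  qed
  have pred: "Suc q mod length b = j \<longleftrightarrow> q = j'" if "q < length b" for q
  proof
    assume "Suc q mod length b = j"
    then have "int (Suc q mod length b) = t mod k"
      by (simp add: j_def)
    then have "(int q + 1) mod k = t mod k"
      by (simp add: zmod_int add.commute)
    then have "(int q + 1 - 1) mod k = (t - 1) mod k"
      by (intro mod_diff_cong refl)
    with that show "q = j'"
      by (simp add: j'_def)
  next
    assume "q = j'"
    then show "Suc q mod length b = j"
      using suc[of q "t - 1"] by (simp add: j_def j'_def)
  qed
  have S: "S = (if X (t - 1) = Dir \<alpha> then {j'} else {}) \<union> (if X t = Inv \<alpha> then {j} else {})"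
  proof (rule Set.set_eqI)
    fix q
    have "q \<in> S \<longleftrightarrow> q < length b \<and> (b ! q = Dir \<alpha> \<and> q = j' \<or> b ! q = Inv \<alpha> \<and> q = j)"
    proof (cases "q < length b")
      case True
      then show ?thesis
        by (cases "b ! q") (auto simp: S_def arrow_to_def pred)
    qed (simp add: S_def)
    also have "\<dots> \<longleftrightarrow> X (t - 1) = Dir \<alpha> \<and> q = j' \<or> X t = Inv \<alpha> \<and> q = j"
      using j by (auto simp: per_def j_def j'_def)
    finally show "q \<in> S \<longleftrightarrow> q \<in> (if X (t - 1) = Dir \<alpha> then {j'} else {}) \<union> (if X t = Inv \<alpha> then {j} else {})"
      by simp
  qed
  have excl: "\<not> (X (t - 1) = Dir \<alpha> \<and> X t = Inv \<alpha>)"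
    using bistring_neq[OF X, of "t - 1"] by auto
  have co: "co (rep_map M \<alpha> x) t = sum f S"
    by (simp add: co_def M_def band_module_map S_def f_def j_def cong: if_cong)
  have "f j' = weight (t - 1) * co x (t - 1)" if "X (t - 1) = Dir \<alpha>"
  proof -
    have "arrow_from b j' = j'"
      using that by (simp add: arrow_from_def j'_def per_def)
    then show ?thesis
      unfolding f_def by (simp only:) (simp add: weight_def co_def flip: j'_def)
  qed
  moreover have "f j = weight t * co x (t + 1)" if "X t = Inv \<alpha>"
  proof -
    have "arrow_from b j = nat ((t + 1) mod k)"
      using that suc[of j t] by (simp add: arrow_from_def j_def per_def)
    then show ?thesis
      unfolding f_def by (simp only:) (simp add: weight_def co_def flip: j_def)
  qed
  ultimately show ?thesis
    using excl unfolding co S by auto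
qed

section \<open>The rank-one band module is a representation\<close>

lemma map_add: "rep_map M \<alpha> (x + y) = rep_map M \<alpha> x + rep_map M \<alpha> y"
  by (rule co_eqI) (simp_all add: supported_map supported_add co_map co_add distrib_left)

lemma map_scale: "rep_map M \<alpha> (rep_scale M c x) = rep_scale M c (rep_map M \<alpha> x)"
  by (rule co_eqI) (simp_all add: supported_map supported_scale co_map co_scale mult.left_commute)

lemma map_space:
  "rep_map M \<alpha> x \<in> rep_space M (head Q \<alpha>)"
  unfolding space_iff
proof (intro conjI allI impI supported_map)
  fix t assume "co (rep_map M \<alpha> x) t \<noteq> 0"
  then consider "X (t - 1) = Dir \<alpha>" | "X t = Inv \<alpha>"
    unfolding co_map by metis
  then show "vx t = head Q \<alpha>"
  proof cases
    case 1
    then show ?thesis using vx_Suc[of "t - 1"] by simp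
  next
    case 2
    then show ?thesis by (simp add: vx_def)
  qed
qed

text \<open>A coordinate survives a path only if the arrows are read consecutively along the word,
  all forwards or all backwards. Changing the direction midway would make one syllable both direct
  and inverse.\<close>

lemma fold_map_nonzero:
  assumes "co (fold (rep_map M) r x) s \<noteq> 0"
  shows "window X (s - int (length r)) (length r) = map Dir r \<or> window X s (length r) = rev (map Inv r)"
  using assms
proof (induction r arbitrary: s rule: rev_induct)
  case (snoc \<alpha> r)
  let ?n = "length r"
  have nz: "co (rep_map M \<alpha> (fold (rep_map M) r x)) s \<noteq> 0"
    using snoc.prems by simp
  show ?case
  proof (cases "X (s - 1) = Dir \<alpha>")
    case True
    with nz have "co (fold (rep_map M) r x) (s - 1) \<noteq> 0"
      by (auto simp: co_map)
    then consider "window X (s - 1 - int ?n) ?n = map Dir r" | "window X (s - 1) ?n = rev (map Inv r)"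
      using snoc.IH by blast
    then show ?thesis
    proof cases
      case 1
      then show ?thesis
        using True by (simp add: window_Suc algebra_simps)
    next
      case 2
      have "r = []"
      proof (rule ccontr)
        assume "r \<noteq> []"
        then have "hd (window X (s - 1) ?n) = X (s - 1)"
          by (cases ?n) (simp_all add: window_Suc_left)
        with 2 True \<open>r \<noteq> []\<close> show False
          by (simp add: hd_rev last_map)
      qed
      with True show ?thesis by (simp add: window_Suc)
    qed
  next
    case False
    with nz have inv: "X s = Inv \<alpha>" and "co (fold (rep_map M) r x) (s + 1) \<noteq> 0"
      by (auto simp: co_map split: if_splits)
    then consider "window X (s + 1 - int ?n) ?n = map Dir r" | "window X (s + 1) ?n = rev (map Inv r)"
      using snoc.IH by blast
    then show ?thesis
    proof cases
      case 2
      then show ?thesis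
        using inv by (simp add: window_Suc_left)
    next
      case 1
      have "r = []"
      proof (rule ccontr)
        assume "r \<noteq> []"
        then have "last (window X (s + 1 - int ?n) ?n) = X s"
          by (cases ?n) (simp_all add: window_Suc)
        with 1 inv \<open>r \<noteq> []\<close> show False
          by (simp add: last_map)
      qed
      with inv show ?thesis by (simp add: window_Suc)
    qed
  qed
qed simp

text \<open>A relation that acts nontrivially would occur in the word or in its inverse, and strings
  contain no relation.\<close>

lemma is_rep: "is_rep Q \<rho> M"
  unfolding is_rep_def
proof (intro conjI ballI)
  show vs: "vector_space (rep_scale M)"
    by unfold_locales (auto simp: M_def band_module_def fun_eq_iff algebra_simps)
  interpret vector_space "rep_scale M" by (fact vs)
  show "subspace (rep_space M v)" if "v \<in> verts Q" for v
  proof (rule subspaceI)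
    fix x y assume x: "x \<in> rep_space M v" and y: "y \<in> rep_space M v"
    show "x + y \<in> rep_space M v"
      unfolding space_iff co_add
    proof (intro conjI allI impI)
      fix t assume "co x t + co y t \<noteq> 0"
      then have "co x t \<noteq> 0 \<or> co y t \<noteq> 0" by auto
      then show "vx t = v" using spaceD(2)[OF x] spaceD(2)[OF y] by blast
    qed (intro supported_add spaceD(1)[OF x] spaceD(1)[OF y])
  next
    fix c x assume x: "x \<in> rep_space M v"
    show "rep_scale M c x \<in> rep_space M v"
      unfolding space_iff co_scale using spaceD[OF x] by (auto simp: supported_scale)
  qed (simp add: space_iff)
  show "linear_between (rep_scale M) (rep_space M (tail Q \<alpha>)) (rep_space M (head Q \<alpha>)) (rep_map M \<alpha>)" for \<alpha>
    by (auto simp: linear_between_def map_add map_scale map_space)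
  fix r x assume r: "r \<in> \<rho>"
  then have "length r \<ge> 2"
    using string_algebra by (auto simp: string_algebra_def)
  then obtain r' \<alpha> where r': "r = r' @ [\<alpha>]"
    by (cases r rule: rev_cases) auto
  show "fold (rep_map M) r x = 0"
  proof (rule co_eqI)
    show "supported (fold (rep_map M) r x)"
      by (simp add: r' supported_map)
    show "co (fold (rep_map M) r x) t = co 0 t" for t
    proof (rule ccontr)
      assume "co (fold (rep_map M) r x) t \<noteq> co 0 t"
      then have "window X (t - int (length r)) (length r) = map Dir r \<or> window X t (length r) = rev (map Inv r)"
        by (intro fold_map_nonzero) simp
      moreover have "window X s (length r) \<notin> map Dir ` \<rho>" "word_inv (window X s (length r)) \<notin> map Dir ` \<rho>" for s
      proof -
        have "is_string Q \<rho> (window X s (length r))"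
          using X \<open>length r \<ge> 2\<close> unfolding bistring_def by (metis not_numeral_le_zero not_gr_zero)
        then show "window X s (length r) \<notin> map Dir ` \<rho>" "word_inv (window X s (length r)) \<notin> map Dir ` \<rho>"
          unfolding is_string_def by blast+
      qed
      moreover have "word_inv (rev (map Inv r)) = map Dir r"
        by (simp add: word_inv_def rev_map comp_def)
      ultimately show False
        using r by (metis imageI)
    qed
  qed simp
qed

subsection \<open>Orientations\<close>

text \<open>
  A graph map may match a substring of the band with a substring read in the opposite direction.
  Here \<open>Y\<close> is the band or its inverse, and \<open>\<pi> y\<close> is the copy of the ground field at position \<open>y\<close> of \<open>Y\<close>.
\<close>

definition oriented :: "(int \<Rightarrow> 'a syllable) \<Rightarrow> (int \<Rightarrow> int) \<Rightarrow> (int \<Rightarrow> 'k) \<Rightarrow> bool" where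
  "oriented Y \<pi> w \<longleftrightarrow> bistring Y \<and> (\<forall>y z. y mod k = z mod k \<longrightarrow> Y y = Y z) \<and>
     (\<forall>y. w y \<noteq> 0 \<and> \<pi> (\<pi> y) = y \<and> vx (\<pi> y) = syl_src Q (Y y)) \<and>
     (\<forall>y z. y mod k = z mod k \<longrightarrow> \<pi> y mod k = \<pi> z mod k) \<and>
     (\<forall>\<alpha> x y. co (rep_map M \<alpha> x) (\<pi> y) = (if Y (y - 1) = Dir \<alpha> then w (y - 1) * co x (\<pi> (y - 1))
        else if Y y = Inv \<alpha> then w y * co x (\<pi> (y + 1)) else 0))"

lemma orientedD:
  assumes "oriented Y \<pi> w"
  shows "bistring Y" "y mod k = z mod k \<Longrightarrow> Y y = Y z" "w y \<noteq> 0" "\<pi> (\<pi> y) = y" "vx (\<pi> y) = syl_src Q (Y y)"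
    "y mod k = z mod k \<Longrightarrow> \<pi> y mod k = \<pi> z mod k"
    "co (rep_map M \<alpha> x) (\<pi> y) = (if Y (y - 1) = Dir \<alpha> then w (y - 1) * co x (\<pi> (y - 1))
        else if Y y = Inv \<alpha> then w y * co x (\<pi> (y + 1)) else 0)"
  using assms unfolding oriented_def by blast+

lemma oriented_same: "oriented X (\<lambda>y. y) weight"
  unfolding oriented_def using X by (auto simp: vx_def co_map intro: cong_X)

text \<open>Position y of the inverse is position -y of the band, and syllable y of the inverse is
  syllable -1 - y of the band, inverted; hence the weight.\<close>

lemma oriented_inverse: "oriented (per (word_inv b)) uminus (\<lambda>y. weight (- 1 - y))"
proof -
  have b: "b \<noteq> []"
    using p by auto
  have Y: "per (word_inv b) y = syl_inv (X (- 1 - y))" for y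
    by (rule per_word_inv[OF b])
  show ?thesis
    unfolding oriented_def
  proof (intro conjI allI impI)
    show "bistring (per (word_inv b))"
      using band by (intro band_bistring is_band_word_inv)
    show "per (word_inv b) y = per (word_inv b) z" if "y mod k = z mod k" for y z
      using that by (intro per_mod_eq) simp
    show "vx (- y) = syl_src Q (per (word_inv b) y)" for y
      using vx_Suc[of "- 1 - y"] by (simp add: Y)
    show "- y mod k = - z mod k" if "y mod k = z mod k" for y z
      using that by (metis mod_minus_eq)
    fix \<alpha> x and y :: int
    have e: "- y - 1 = - 1 - y" "- 1 - (y - 1) = - y" "- (y - 1) = - y + 1" "- (y + 1) = - 1 - y"
      by simp_all
    have "per (word_inv b) y = Inv \<alpha> \<longleftrightarrow> X (- 1 - y) = Dir \<alpha>"
      unfolding Y by (cases "X (- 1 - y)") simp_all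
    moreover have "per (word_inv b) (y - 1) = Dir \<alpha> \<longleftrightarrow> X (- y) = Inv \<alpha>"
      unfolding Y e by (cases "X (- y)") simp_all
    \<comment> \<open>Reversal swaps the two branches of \<open>co_map\<close>. They exclude each
      other, so the order of the tests is immaterial.\<close>
    moreover have "\<not> (X (- 1 - y) = Dir \<alpha> \<and> X (- y) = Inv \<alpha>)"
      using bistring_neq[OF X, of "- 1 - y"] by auto
    ultimately show "co (rep_map M \<alpha> x) (- y) = (if per (word_inv b) (y - 1) = Dir \<alpha> then weight (- 1 - (y - 1)) * co x (- (y - 1))
        else if per (word_inv b) y = Inv \<alpha> then weight (- 1 - y) * co x (- (y + 1)) else 0)"
      unfolding co_map e by auto
  qed auto
qed

end

context rank_one_band
begin

subsection \<open>A crossing yields a graph map\<close>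

lemma pred_mod: "(t - 1) mod k = (t + int (length b - 1)) mod k"
proof -
  have "1 \<le> length b"
    using p by linarith
  then have "t + int (length b - 1) = t - 1 + k"
    by linarith
  then show ?thesis
    by (metis mod_add_self2)
qed

text \<open>The endomorphism projects onto the factor spanned by the match in \<open>X\<close> and
  embeds it as the submodule spanned by the match in \<open>Y\<close>.\<close>

lemma crossing_nonscalar_endo:
  assumes Y: "oriented Y \<pi> w" and cross: "crossing X Y"
  obtains \<phi> where "\<phi> \<in> endos Q M" "\<And>c. \<phi> \<noteq> scalar_endo Q M c"
proof -
  obtain i j m where start: "src (X i) = src (Y j)"
    and agree: "\<And>\<tau>. \<tau> < m \<Longrightarrow> X (i + int \<tau>) = Y (j + int \<tau>)"
    and ends: "\<not> direct (X (i - 1))" "direct (X (i + int m))" "direct (Y (j - 1))" "\<not> direct (Y (j + int m))"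
    using cross unfolding crossing_def by blast
  note perY = orientedD(2)[OF Y]
  note bsY = orientedD(1)[OF Y]
  have wrap: "X (i - 1) = X (i + int (length b - 1))" "Y (j - 1) = Y (j + int (length b - 1))"
    by (rule cong_X[OF pred_mod], rule perY[OF pred_mod])
  \<comment> \<open>If m were k - 1, then \<open>X (i - 1)\<close>, which is inverse, would equal
    the direct \<open>X (i + int m)\<close>. If m were at least k, the match would identify the
    inverse \<open>X (i - 1)\<close> with the direct \<open>Y (j - 1)\<close>.\<close>
  have "length b - 1 \<noteq> m"
    using wrap ends by auto
  moreover have "\<not> length b - 1 < m"
    using agree[of "length b - 1"] wrap ends by auto
  ultimately have m: "int m + 1 < k"
    using k_pos by linarith
  \<comment> \<open>The weights absorb the parameter \<open>\<mu>\<close>, which the two substrings may meet at different places.\<close>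
  define \<kappa> :: "nat \<Rightarrow> 'k" where "\<kappa> = rec_nat 1 (\<lambda>\<tau> c.
    if direct (X (i + int \<tau>)) then c * w (j + int \<tau>) / weight (i + int \<tau>)
    else c * weight (i + int \<tau>) / w (j + int \<tau>))"
  have \<kappa>0: "\<kappa> 0 = 1"
    by (simp add: \<kappa>_def)
  have \<kappa>_Suc: "\<kappa> (Suc \<tau>) = (if direct (X (i + int \<tau>)) then \<kappa> \<tau> * w (j + int \<tau>) / weight (i + int \<tau>)
    else \<kappa> \<tau> * weight (i + int \<tau>) / w (j + int \<tau>))" for \<tau>
    by (simp add: \<kappa>_def)
  \<comment> \<open>Here \<open>\<tau>\<close> is the offset of copy s from the start of the match
    in \<open>Y\<close>, modulo the period; the offsets up to m form the match.\<close>
  define \<Phi> where "\<Phi> x = of_co (\<lambda>s. let \<tau> = nat ((\<pi> s - j) mod k) in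
    if \<tau> \<le> m then \<kappa> \<tau> * co x (i + int \<tau>) else 0)" for x
  have co\<Phi>: "co (\<Phi> x) (\<pi> (j + int \<tau>)) = (if \<tau> \<le> m then \<kappa> \<tau> * co x (i + int \<tau>) else 0)" if "\<tau> < length b" for x \<tau>
  proof -
    have "\<pi> (\<pi> (j + int \<tau>) mod k) mod k = \<pi> (\<pi> (j + int \<tau>)) mod k"
      by (rule orientedD(6)[OF Y]) simp
    then have "\<pi> (\<pi> (j + int \<tau>) mod k) mod k = (j + int \<tau>) mod k"
      by (simp add: orientedD(4)[OF Y])
    then have "(\<pi> (\<pi> (j + int \<tau>) mod k) - j) mod k = (j + int \<tau> - j) mod k"
      by (rule mod_diff_cong) simp
    then have "nat ((\<pi> (\<pi> (j + int \<tau>) mod k) - j) mod k) = \<tau>"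
      using that by simp
    then show ?thesis
      by (simp add: \<Phi>_def Let_def)
  qed
  have cong: "co x (\<pi> y) = co x (\<pi> z)" if "y mod k = z mod k" for x y z
    by (intro cong_co orientedD(6)[OF Y] that)
  have co_pred: "co (\<Phi> x) (\<pi> (j - 1)) = 0" for x
  proof -
    have "co (\<Phi> x) (\<pi> (j - 1)) = co (\<Phi> x) (\<pi> (j + int (length b - 1)))"
      by (rule cong[OF pred_mod])
    then show ?thesis
      using co\<Phi>[of "length b - 1" x] m by simp
  qed
  have position: "\<exists>\<tau><length b. \<pi> s mod k = (j + int \<tau>) mod k" for s
  proof (intro exI conjI)
    show "nat ((\<pi> s - j) mod k) < length b"
      by (rule nat_mod_less)
    show "\<pi> s mod k = (j + int (nat ((\<pi> s - j) mod k))) mod k"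
      by (simp add: mod_add_right_eq)
  qed
  have letters: "src (X (i + int \<tau>)) = src (Y (j + int \<tau>))" if "\<tau> \<le> m" for \<tau>
  proof (cases \<tau>)
    case (Suc \<tau>')
    with agree[of \<tau>'] that bistring_tgt[OF X, of "i + int \<tau>'"] bistring_tgt[OF bsY, of "j + int \<tau>'"]
    show ?thesis by (simp add: algebra_simps)
  qed (use start in simp)
  \<comment> \<open>Inside the match the recursion for \<open>\<kappa>\<close> balances the weights.
    At its ends the arrows of \<open>X\<close> lead out, so they contribute nothing to the match in
    \<open>R\<close>, and the arrows of \<open>Y\<close> lead in, so they carry nothing out of it in
    \<open>L\<close>.\<close>
  have commute: "\<Phi> (rep_map M \<alpha> x) = rep_map M \<alpha> (\<Phi> x)" for \<alpha> x
  proof (rule co_eqI)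
    fix s
    obtain \<tau> where \<tau>: "\<tau> < length b" "\<pi> s mod k = (j + int \<tau>) mod k"
      using position by blast
    have s: "co z s = co z (\<pi> (j + int \<tau>))" for z
      using cong[OF \<tau>(2), of z] orientedD(4)[OF Y] by simp
    have L: "co (rep_map M \<alpha> (\<Phi> x)) s =
      (if Y (j + int \<tau> - 1) = Dir \<alpha> then w (j + int \<tau> - 1) * co (\<Phi> x) (\<pi> (j + int \<tau> - 1))
       else if Y (j + int \<tau>) = Inv \<alpha> then w (j + int \<tau>) * co (\<Phi> x) (\<pi> (j + int \<tau> + 1)) else 0)"
      unfolding s orientedD(7)[OF Y] ..
    have R: "co (\<Phi> (rep_map M \<alpha> x)) s = (if \<tau> \<le> m then \<kappa> \<tau> *
      (if X (i + int \<tau> - 1) = Dir \<alpha> then weight (i + int \<tau> - 1) * co x (i + int \<tau> - 1)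
       else if X (i + int \<tau>) = Inv \<alpha> then weight (i + int \<tau>) * co x (i + int \<tau> + 1) else 0) else 0)"
      unfolding s co\<Phi>[OF \<tau>(1)] co_map ..
    have prev: "co (\<Phi> x) (\<pi> (j + int \<tau> - 1)) = (if \<tau> = 0 then 0 else if \<tau> - 1 \<le> m then \<kappa> (\<tau> - 1) * co x (i + int \<tau> - 1) else 0)"
      using co_pred co\<Phi>[of "\<tau> - 1" x] \<tau>(1) by (cases \<tau>) (simp_all add: algebra_simps)
    have succ: "co (\<Phi> x) (\<pi> (j + int \<tau> + 1)) = (if \<tau> + 1 \<le> m then \<kappa> (\<tau> + 1) * co x (i + int \<tau> + 1) else 0)"
      if "\<tau> + 1 < length b"
      using co\<Phi>[OF that, of x] by (simp add: algebra_simps)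
    have neqX: "\<not> (X (i + int \<tau> - 1) = Dir \<alpha> \<and> X (i + int \<tau>) = Inv \<alpha>)"
      using bistring_neq[OF X, of "i + int \<tau> - 1"] by auto
    have neqY: "\<not> (Y (j + int \<tau> - 1) = Dir \<alpha> \<and> Y (j + int \<tau>) = Inv \<alpha>)"
      using bistring_neq[OF bsY, of "j + int \<tau> - 1"] by auto
    have prev_eq: "X (i + int \<tau> - 1) = Y (j + int \<tau> - 1)" if "0 < \<tau>" "\<tau> \<le> m"
    proof -
      have e: "i + int (\<tau> - 1) = i + int \<tau> - 1" "j + int (\<tau> - 1) = j + int \<tau> - 1" and "\<tau> - 1 < m"
        using that by auto
      from agree[OF \<open>\<tau> - 1 < m\<close>] show ?thesis
        unfolding e .
    qed
    show "co (\<Phi> (rep_map M \<alpha> x)) s = co (rep_map M \<alpha> (\<Phi> x)) s"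
    proof (cases "\<tau> \<le> m")
      case le: True
      then have lt: "\<tau> + 1 < length b"
        using m by linarith
      consider (dir) "Y (j + int \<tau> - 1) = Dir \<alpha>" | (inv) "Y (j + int \<tau>) = Inv \<alpha>" "Y (j + int \<tau> - 1) \<noteq> Dir \<alpha>"
        | (none) "Y (j + int \<tau> - 1) \<noteq> Dir \<alpha>" "Y (j + int \<tau>) \<noteq> Inv \<alpha>"
        by blast
      then show ?thesis
      proof cases
        case dir
        show ?thesis
        proof (cases "\<tau> = 0")
          case True
          have "X i \<noteq> Inv \<alpha>"
          proof (cases "m = 0")
            case False
            then show ?thesis
              using agree[of 0] neqY dir True by auto
          qed (use ends in auto)
          with True dir ends(1) show ?thesis
            unfolding L R prev by auto
        next
          case False
          then have XD: "X (i + int \<tau> - 1) = Dir \<alpha>"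
            using prev_eq le dir by simp
          have e: "Suc (\<tau> - 1) = \<tau>" "i + int (\<tau> - 1) = i + int \<tau> - 1" "j + int (\<tau> - 1) = j + int \<tau> - 1"
            using False by auto
          have "\<kappa> \<tau> = \<kappa> (\<tau> - 1) * w (j + int \<tau> - 1) / weight (i + int \<tau> - 1)"
            using \<kappa>_Suc[of "\<tau> - 1", unfolded e] XD by simp
          then have "\<kappa> \<tau> * weight (i + int \<tau> - 1) = w (j + int \<tau> - 1) * \<kappa> (\<tau> - 1)"
            by simp
          then show ?thesis
            unfolding L R prev using False le dir XD by (simp add: mult.assoc[symmetric])
        qed
      next
        case inv
        show ?thesis
        proof (cases "\<tau> = m")
          case True
          have "X (i + int \<tau> - 1) \<noteq> Dir \<alpha>"
          proof (cases "\<tau> = 0")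
            case False
            then show ?thesis
              using prev_eq le inv by simp
          qed (use ends in auto)
          with True inv ends(2) show ?thesis
            unfolding L R succ[OF lt] by auto
        next
          case False
          with le have XI: "X (i + int \<tau>) = Inv \<alpha>"
            using agree[of \<tau>] inv by simp
          then have "\<kappa> (Suc \<tau>) * w (j + int \<tau>) = \<kappa> \<tau> * weight (i + int \<tau>)"
            using \<kappa>_Suc[of \<tau>] orientedD(3)[OF Y, of "j + int \<tau>"] by simp
          then show ?thesis
            unfolding L R succ[OF lt] using False le inv XI neqX
            by (simp add: mult.assoc[symmetric] mult.commute[of "w _"])
        qed
      next
        case none
        have "X (i + int \<tau> - 1) \<noteq> Dir \<alpha>"
          using prev_eq le none ends(1) by (cases "\<tau> = 0") auto
        moreover have "X (i + int \<tau>) \<noteq> Inv \<alpha>"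
          using agree[of \<tau>] le none ends(2) by (cases "\<tau> = m") auto
        ultimately show ?thesis
          unfolding L R using none by simp
      qed
    next
      case gt: False
      have "co (\<Phi> x) (\<pi> (j + int \<tau> - 1)) = 0" if "Y (j + int \<tau> - 1) = Dir \<alpha>"
      proof -
        have "\<tau> \<noteq> Suc m"
          using that ends(4) by auto
        with gt show ?thesis unfolding prev by auto
      qed
      moreover have "co (\<Phi> x) (\<pi> (j + int \<tau> + 1)) = 0" if "Y (j + int \<tau>) = Inv \<alpha>"
      proof -
        have "\<tau> \<noteq> length b - 1"
          using that ends(3) wrap(2) by auto
        then show ?thesis
          using succ gt \<tau>(1) by auto
      qed
      ultimately show ?thesis
        unfolding L R using gt by simp
    qed
  qed (simp_all add: \<Phi>_def supported_map)
  have \<Phi>_space: "\<Phi> x \<in> rep_space M v" if x: "x \<in> rep_space M v" for x v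
    unfolding space_iff
  proof (intro conjI allI impI)
    fix s assume nz: "co (\<Phi> x) s \<noteq> 0"
    obtain \<tau> where \<tau>: "\<tau> < length b" "\<pi> s mod k = (j + int \<tau>) mod k"
      using position by blast
    have s: "co z s = co z (\<pi> (j + int \<tau>))" for z
      using cong[OF \<tau>(2), of z] orientedD(4)[OF Y] by simp
    have "\<tau> \<le> m" "co x (i + int \<tau>) \<noteq> 0"
      using nz unfolding s co\<Phi>[OF \<tau>(1)] by (auto split: if_splits)
    then have "vx (i + int \<tau>) = v" "vx (i + int \<tau>) = syl_src Q (Y (j + int \<tau>))"
      using letters[of \<tau>] spaceD(2)[OF x] by (auto simp: src_letter_def vx_def)
    moreover have "vx s = vx (\<pi> (j + int \<tau>))"
      using orientedD(6)[OF Y \<tau>(2)] orientedD(4)[OF Y, of s] by (intro cong_vx) simp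
    ultimately show "vx s = v"
      using orientedD(5)[OF Y] by simp
  qed (simp add: \<Phi>_def)
  have \<Phi>_add: "\<Phi> (x + y) = \<Phi> x + \<Phi> y" for x y
    by (rule co_eqI) (simp_all add: \<Phi>_def supported_add co_add Let_def distrib_left)
  have \<Phi>_scale: "\<Phi> (rep_scale M c x) = rep_scale M c (\<Phi> x)" for c x
    by (rule co_eqI) (simp_all add: \<Phi>_def supported_scale co_scale Let_def mult.left_commute)
  define \<phi> where "\<phi> = (\<lambda>v\<in>verts Q. \<lambda>x\<in>rep_space M v. \<Phi> x)"
  have space_add: "x + y \<in> rep_space M v" "rep_scale M c x \<in> rep_space M v"
    if "v \<in> verts Q" "x \<in> rep_space M v" "y \<in> rep_space M v" for v x y c
  proof -
    interpret vector_space "rep_scale M"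
      using is_rep by (simp add: is_rep_def)
    have "subspace (rep_space M v)"
      using is_rep that(1) unfolding is_rep_def by blast
    with that show "x + y \<in> rep_space M v" "rep_scale M c x \<in> rep_space M v"
      using subspace_add subspace_scale by blast+
  qed
  have \<phi>: "\<phi> \<in> endos Q M"
    unfolding endos_def
  proof (intro CollectI conjI ballI)
    show "\<phi> \<in> (\<Pi>\<^sub>E v\<in>verts Q. rep_space M v \<rightarrow>\<^sub>E rep_space M v)"
      by (auto simp: \<phi>_def PiE_iff \<Phi>_space)
    show "linear_between (rep_scale M) (rep_space M v) (rep_space M v) (\<phi> v)" if "v \<in> verts Q" for v
      using that space_add[OF that] by (auto simp: linear_between_def \<phi>_def \<Phi>_space \<Phi>_add \<Phi>_scale)
    show "\<phi> (head Q \<alpha>) (rep_map M \<alpha> x) = rep_map M \<alpha> (\<phi> (tail Q \<alpha>) x)"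
      if "\<alpha> \<in> arcs Q" "x \<in> rep_space M (tail Q \<alpha>)" for \<alpha> x
      using that by (simp add: \<phi>_def commute map_space)
  qed
  \<comment> \<open>Copy i - 1 lies outside the match because m + 1 < k, so its basis vector is
    killed and c would be 0; but the basis vector of copy i is not killed.\<close>
  have "\<phi> \<noteq> scalar_endo Q M c" for c
  proof
    assume c: "\<phi> = scalar_endo Q M c"
    have scalar: "\<Phi> (basis_vec t) = rep_scale M c (basis_vec t)" for t
      using fun_cong[OF fun_cong[OF c, of "vx t"], of "basis_vec t"] basis_vec_space[of t] vx_in_verts[of t]
      by (simp add: \<phi>_def scalar_endo_def)
    have distinct: "(i + int \<tau>) mod k \<noteq> (i - 1) mod k" if "\<tau> \<le> m" for \<tau>
    proof
      assume "(i + int \<tau>) mod k = (i - 1) mod k"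
      then have "k dvd (i + int \<tau>) - (i - 1)"
        by (simp only: mod_eq_dvd_iff)
      then have "k dvd int \<tau> + 1"
        by simp
      then have "k \<le> int \<tau> + 1"
        by (rule zdvd_imp_le) simp
      with m that show False by simp
    qed
    obtain \<tau> where \<tau>: "\<tau> < length b" "\<pi> (i - 1) mod k = (j + int \<tau>) mod k"
      using position by blast
    have "co (\<Phi> (basis_vec (i - 1))) (i - 1) = co (\<Phi> (basis_vec (i - 1))) (\<pi> (j + int \<tau>))"
      using cong[OF \<tau>(2)] orientedD(4)[OF Y] by simp
    also have "\<dots> = 0"
      using distinct[of \<tau>] unfolding co\<Phi>[OF \<tau>(1)] by (simp add: co_basis_vec)
    finally have "c = 0"
      unfolding scalar co_scale by (simp add: co_basis_vec)
    moreover have "co (\<Phi> (basis_vec i)) (\<pi> (j + int 0)) = 1"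
      using k_pos p by (subst co\<Phi>) (auto simp: \<kappa>0 co_basis_vec)
    ultimately show False
      unfolding scalar co_scale by simp
  qed
  with \<phi> that show thesis by blast
qed

subsection \<open>Without crossings every endomorphism is scalar\<close>

text \<open>Orders the two ends of a syllable by the direction of its arrow, which merges the direct
  and the inverse case in the transport of entries.\<close>

definition edge :: "(int \<Rightarrow> 'a syllable) \<Rightarrow> 'a \<Rightarrow> int \<Rightarrow> int \<Rightarrow> int \<Rightarrow> bool" where
  "edge Z \<alpha> q t t' \<longleftrightarrow> Z q = Dir \<alpha> \<and> t = q \<and> t' = q + 1 \<or> Z q = Inv \<alpha> \<and> t = q + 1 \<and> t' = q"

lemma co_map_edge:
  assumes "oriented Y \<pi> w" "edge Y \<alpha> q y y'"
  shows "co (rep_map M \<alpha> x) (\<pi> y') = w q * co x (\<pi> y)"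
  using assms(2) bistring_neq[OF orientedD(1)[OF assms(1)], of "y' - 1"]
  unfolding edge_def orientedD(7)[OF assms(1)] by auto

text \<open>Two different edges of \<open>\<alpha>\<close> out of one copy would put the inverse of
  \<open>\<alpha>\<close> directly before \<open>\<alpha>\<close> in the word.\<close>

lemma edge_unique:
  assumes "edge X \<alpha> q t t'" "edge X \<alpha> r s s'" "t mod k = s mod k"
  shows "q mod k = r mod k" "t' mod k = s' mod k"
proof -
  have st: "X s = X t" "X (s - 1) = X (t - 1)"
    using assms(3) by (auto intro!: cong_X mod_diff_cong)
  have "X t = Dir \<alpha> \<and> q - t = 0 \<and> t' - t = 1 \<or> X (t - 1) = Inv \<alpha> \<and> q - t = - 1 \<and> t' - t = - 1"
    using assms(1) unfolding edge_def by auto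
  moreover have "X t = Dir \<alpha> \<and> r - s = 0 \<and> s' - s = 1 \<or> X (t - 1) = Inv \<alpha> \<and> r - s = - 1 \<and> s' - s = - 1"
    using assms(2) unfolding edge_def st[symmetric] by auto
  moreover have "\<not> (X t = Dir \<alpha> \<and> X (t - 1) = Inv \<alpha>)"
    using bistring_neq[OF X, of "t - 1"] by auto
  ultimately have "q - t = r - s" "t' - t = s' - s"
    by auto
  then have "q = t + (r - s)" "r = s + (r - s)" "t' = t + (s' - s)" "s' = s + (s' - s)"
    by auto
  then show "q mod k = r mod k" "t' mod k = s' mod k"
    using assms(3) mod_add_cong[of t k s "r - s" "r - s"] mod_add_cong[of t k s "s' - s" "s' - s"] by metis+
qed

lemma no_edge_map:
  assumes "\<And>q t'. \<not> edge X \<alpha> q t t'"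
  shows "rep_map M \<alpha> (basis_vec t) = 0"
proof (rule co_eqI)
  fix s
  have "(s - 1) mod k \<noteq> t mod k" if "X (s - 1) = Dir \<alpha>"
  proof
    assume "(s - 1) mod k = t mod k"
    then have "X t = Dir \<alpha>" using that cong_X by metis
    with assms show False unfolding edge_def by blast
  qed
  moreover have "(s + 1) mod k \<noteq> t mod k" if "X s = Inv \<alpha>"
  proof
    assume "(s + 1) mod k = t mod k"
    then have "(s + 1 - 1) mod k = (t - 1) mod k" by (rule mod_diff_cong) simp
    then have "X (t - 1) = Inv \<alpha>" using that cong_X[of "t - 1" s] by simp
    with assms[of "t - 1" "t - 1"] show False unfolding edge_def by simp
  qed
  ultimately show "co (rep_map M \<alpha> (basis_vec t)) s = co 0 s"
    by (auto simp: co_map co_basis_vec)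
qed (simp_all add: supported_map)

lemma edge_map:
  assumes e: "edge X \<alpha> q t t'"
  shows "rep_map M \<alpha> (basis_vec t) = rep_scale M (weight q) (basis_vec t')"
proof (rule co_eqI)
  fix s
  have weight: "weight r = weight q" if "r mod k = q mod k" for r
    using that by (simp add: weight_def)
  show "co (rep_map M \<alpha> (basis_vec t)) s = co (rep_scale M (weight q) (basis_vec t')) s"
  proof (cases "\<exists>r u. edge X \<alpha> r u s")
    case True
    then obtain r u where r: "edge X \<alpha> r u s" by blast
    have "co (rep_map M \<alpha> (basis_vec t)) s = weight r * co (basis_vec t) u"
      by (rule co_map_edge[OF oriented_same r])
    moreover have "u mod k = t mod k \<longleftrightarrow> s mod k = t' mod k"
    proof
      assume "u mod k = t mod k"
      then show "s mod k = t' mod k"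
        using edge_unique[OF e r] by simp
    next
      assume eq: "s mod k = t' mod k"
      have st: "X t' = X s" "X (t' - 1) = X (s - 1)"
        using eq by (auto intro!: cong_X mod_diff_cong)
      have "X (s - 1) = Dir \<alpha> \<and> t - t' = - 1 \<or> X s = Inv \<alpha> \<and> t - t' = 1"
        using e unfolding edge_def st[symmetric] by auto
      moreover have "X (s - 1) = Dir \<alpha> \<and> u - s = - 1 \<or> X s = Inv \<alpha> \<and> u - s = 1"
        using r unfolding edge_def by auto
      moreover have "\<not> (X (s - 1) = Dir \<alpha> \<and> X s = Inv \<alpha>)"
        using bistring_neq[OF X, of "s - 1"] by auto
      ultimately have "u - s = t - t'"
        by auto
      then have "u = s + (t - t')" "t = t' + (t - t')"
        by auto
      then show "u mod k = t mod k"
        using eq mod_add_cong[of s k t' "t - t'" "t - t'"] by metis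
    qed
    moreover have "weight r = weight q" if "u mod k = t mod k"
      using edge_unique(1)[OF r e that] by (rule weight)
    ultimately show ?thesis
      by (simp add: co_scale co_basis_vec)
  next
    case False
    have "s mod k \<noteq> t' mod k"
    proof
      assume eq: "s mod k = t' mod k"
      then have "X s = X t'" "X (s - 1) = X (t' - 1)"
        by (auto intro!: cong_X mod_diff_cong)
      then have "edge X \<alpha> s (s + 1) s \<or> edge X \<alpha> (s - 1) (s - 1) s"
        using e unfolding edge_def by auto
      with False show False by blast
    qed
    moreover have "X (s - 1) \<noteq> Dir \<alpha>" "X s \<noteq> Inv \<alpha>"
      using False unfolding edge_def by force+
    ultimately show ?thesis
      by (simp add: co_map co_scale co_basis_vec)
  qed
qed (simp_all add: supported_map supported_scale basis_vec_def)

lemma edge_vertices: "edge X \<alpha> q t t' \<Longrightarrow> \<alpha> \<in> arcs Q \<and> vx t = tail Q \<alpha> \<and> vx t' = head Q \<alpha>"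
  using bistring_arrow[OF X, of q] vx_Suc[of q] by (auto simp: edge_def vx_def)

lemma scale_0: "rep_scale M 0 x = 0"
  by (simp add: M_def band_module_def fun_eq_iff)

lemma zero_space: "0 \<in> rep_space M v"
  by (simp add: space_iff)

lemma src_neq_flip: "src x \<noteq> flip (src x)" if "arrow x \<in> arcs Q"
  using sign_cases[OF that] by (cases x) (auto simp: src_letter_def flip_def)

section \<open>Matrix entries of an endomorphism\<close>

context
  fixes \<phi>
  assumes \<phi>: "\<phi> \<in> endos Q M"
begin

definition entry :: "int \<Rightarrow> int \<Rightarrow> 'k" where
  "entry t s = co (\<phi> (vx t) (basis_vec t)) s"

lemma endo_space: "v \<in> verts Q \<Longrightarrow> x \<in> rep_space M v \<Longrightarrow> \<phi> v x \<in> rep_space M v"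
  using \<phi> by (auto simp: endos_def PiE_iff)

lemma endo_scale: "v \<in> verts Q \<Longrightarrow> x \<in> rep_space M v \<Longrightarrow> \<phi> v (rep_scale M c x) = rep_scale M c (\<phi> v x)"
  using \<phi> by (auto simp: endos_def linear_between_def)

lemma endo_add: "v \<in> verts Q \<Longrightarrow> x \<in> rep_space M v \<Longrightarrow> y \<in> rep_space M v \<Longrightarrow> \<phi> v (x + y) = \<phi> v x + \<phi> v y"
  using \<phi> by (auto simp: endos_def linear_between_def)

lemma endo_map: "\<alpha> \<in> arcs Q \<Longrightarrow> x \<in> rep_space M (tail Q \<alpha>) \<Longrightarrow>
    \<phi> (head Q \<alpha>) (rep_map M \<alpha> x) = rep_map M \<alpha> (\<phi> (tail Q \<alpha>) x)"
  using \<phi> by (auto simp: endos_def)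

lemma endo_0: "v \<in> verts Q \<Longrightarrow> \<phi> v 0 = 0"
  using endo_scale[OF _ zero_space, of v 0] by (simp add: scale_0)

lemma entry_cong: "s mod k = s' mod k \<Longrightarrow> entry t s = entry t s'"
  unfolding entry_def by (rule cong_co)

text \<open>This is coordinate \<open>\<pi> y'\<close> of the commutation of \<open>\<phi>\<close>
  with \<open>\<alpha>\<close>, applied to \<open>basis_vec t\<close>.\<close>

lemma entry_transport:
  assumes Y: "oriented Y \<pi> w" and e: "edge X \<alpha> q t t'" and e': "edge Y \<alpha> r y y'"
  shows "weight q * entry t' (\<pi> y') = w r * entry t (\<pi> y)"
proof -
  note v = edge_vertices[OF e]
  have "basis_vec t \<in> rep_space M (tail Q \<alpha>)" "basis_vec t' \<in> rep_space M (head Q \<alpha>)"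
    using basis_vec_space[of t] basis_vec_space[of t'] v by simp_all
  then have "rep_scale M (weight q) (\<phi> (vx t') (basis_vec t')) = rep_map M \<alpha> (\<phi> (vx t) (basis_vec t))"
    using endo_map[of \<alpha> "basis_vec t"] endo_scale[of "head Q \<alpha>" "basis_vec t'" "weight q"] v
    by (simp add: edge_map[OF e])
  then have "co (rep_scale M (weight q) (\<phi> (vx t') (basis_vec t'))) (\<pi> y') = co (rep_map M \<alpha> (\<phi> (vx t) (basis_vec t))) (\<pi> y')"
    by (rule arg_cong)
  then show ?thesis
    by (simp add: co_scale co_map_edge[OF Y e'] entry_def)
qed

text \<open>The arrow kills \<open>basis_vec t\<close>, hence also its image under
  \<open>\<phi>\<close>; but it carries the coordinate \<open>\<pi> y\<close> on with a nonzero
  weight.\<close>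

lemma entry_no_edge:
  assumes Y: "oriented Y \<pi> w" and e: "edge Y \<alpha> r y y'" and ne: "\<And>q t'. \<not> edge X \<alpha> q t t'"
    and v: "\<alpha> \<in> arcs Q" "vx t = tail Q \<alpha>"
  shows "entry t (\<pi> y) = 0"
proof -
  have "rep_map M \<alpha> (\<phi> (vx t) (basis_vec t)) = 0"
    using endo_map[of \<alpha> "basis_vec t"] basis_vec_space[of t] v endo_0[of "head Q \<alpha>"]
    by (simp add: no_edge_map[OF ne])
  then have "co (rep_map M \<alpha> (\<phi> (vx t) (basis_vec t))) (\<pi> y') = 0"
    by simp
  then show ?thesis
    using orientedD(3)[OF Y, of r] by (simp add: co_map_edge[OF Y e] entry_def)
qed

lemma entry_step:
  assumes Y: "oriented Y \<pi> w" and eq: "X t = Y y"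
  shows "entry t (\<pi> y) = 0 \<longleftrightarrow> entry (t + 1) (\<pi> (y + 1)) = 0"
proof (cases "X t")
  case (Dir \<alpha>)
  then have "edge X \<alpha> t t (t + 1)" "edge Y \<alpha> y y (y + 1)"
    using eq by (auto simp: edge_def)
  then have "weight t * entry (t + 1) (\<pi> (y + 1)) = w y * entry t (\<pi> y)"
    by (rule entry_transport[OF Y])
  then show ?thesis
    using orientedD(3)[OF Y, of y] by (metis mult_eq_0_iff weight_nonzero)
next
  case (Inv \<alpha>)
  then have "edge X \<alpha> t (t + 1) t" "edge Y \<alpha> y (y + 1) y"
    using eq by (auto simp: edge_def)
  then have "weight t * entry t (\<pi> y) = w y * entry (t + 1) (\<pi> (y + 1))"
    by (rule entry_transport[OF Y])
  then show ?thesis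
    using orientedD(3)[OF Y, of y] by (metis mult_eq_0_iff weight_nonzero)
qed

text \<open>At the ends of the maximal match the letters agree but the syllables do not, so their
  directions differ. If an arrow of \<open>Y\<close> leads out of the match at one end, the entry
  there vanishes by \<open>entry_no_edge\<close>, and \<open>entry_step\<close> carries the zero
  back to t. Otherwise both ends are those of a crossing.\<close>

lemma entry_zero:
  assumes Y: "oriented Y \<pi> w" and nc: "\<not> crossing X Y" and start: "src (X t) = src (Y y)"
    and right: "\<exists>n. X (t + int n) \<noteq> Y (y + int n)"
    and left: "\<exists>n. X (t - 1 - int n) \<noteq> Y (y - 1 - int n)"
  shows "entry t (\<pi> y) = 0"
proof -
  note bsY = orientedD(1)[OF Y]
  define n where "n = (LEAST n. X (t + int n) \<noteq> Y (y + int n))"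
  have n: "X (t + int n) \<noteq> Y (y + int n)"
    unfolding n_def using right by (rule LeastI_ex)
  have n_less: "X (t + int \<tau>) = Y (y + int \<tau>)" if "\<tau> < n" for \<tau>
    using that unfolding n_def by (blast dest: not_less_Least)
  define m where "m = (LEAST n. X (t - 1 - int n) \<noteq> Y (y - 1 - int n))"
  have m: "X (t - 1 - int m) \<noteq> Y (y - 1 - int m)"
    unfolding m_def using left by (rule LeastI_ex)
  have m_less: "X (t - 1 - int \<tau>) = Y (y - 1 - int \<tau>)" if "\<tau> < m" for \<tau>
    using that unfolding m_def by (blast dest: not_less_Least)
  have src_right: "src (X (t + int \<tau>)) = src (Y (y + int \<tau>))" if "\<tau> \<le> n" for \<tau>
  proof (cases \<tau>)
    case (Suc \<tau>')
    with n_less[of \<tau>'] that bistring_tgt[OF X, of "t + int \<tau>'"] bistring_tgt[OF bsY, of "y + int \<tau>'"]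
    show ?thesis by (simp add: algebra_simps)
  qed (use start in simp)
  have src_left: "src (X (t - int \<tau>)) = src (Y (y - int \<tau>))" if "\<tau> \<le> m" for \<tau>
  proof (cases \<tau>)
    case (Suc \<tau>')
    with m_less[of \<tau>'] that show ?thesis by (simp add: algebra_simps)
  qed (use start in simp)
  have right_iff: "entry t (\<pi> y) = 0 \<longleftrightarrow> entry (t + int \<tau>) (\<pi> (y + int \<tau>)) = 0" if "\<tau> \<le> n" for \<tau>
    using that
  proof (induction \<tau>)
    case (Suc \<tau>)
    then show ?case
      using entry_step[OF Y n_less[of \<tau>]] by (simp add: algebra_simps)
  qed simp
  have left_iff: "entry t (\<pi> y) = 0 \<longleftrightarrow> entry (t - int \<tau>) (\<pi> (y - int \<tau>)) = 0" if "\<tau> \<le> m" for \<tau>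
    using that
  proof (induction \<tau>)
    case (Suc \<tau>)
    then show ?case
      using entry_step[OF Y m_less[of \<tau>]] by (simp add: algebra_simps)
  qed simp
  have no_turn: "tgt (X (u - 1)) \<noteq> flip (src (X u))" for u
    using src_neq_flip[OF bistring_arrow[OF X]] bistring_tgt[OF X, of "u - 1"] by simp
  have dir_right: "direct (X (t + int n)) \<noteq> direct (Y (y + int n))"
    using n forward_det(1)[OF X bsY src_right[of n]] by blast
  have dir_left: "direct (X (t - 1 - int m)) \<noteq> direct (Y (y - 1 - int m))"
    using m backward_det[OF X bsY, of "t - int m" "y - int m"] src_left[of m] by (auto simp: algebra_simps)
  show ?thesis
  proof (cases "direct (X (t + int n))")
    case False
    then obtain \<alpha> where \<alpha>: "Y (y + int n) = Dir \<alpha>"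
      using dir_right by (auto simp: direct_def)
    have src: "src (X (t + int n)) = src (Dir \<alpha>)"
      using src_right[of n] \<alpha> by simp
    have "entry (t + int n) (\<pi> (y + int n)) = 0"
    proof (rule entry_no_edge[OF Y])
      show "edge Y \<alpha> (y + int n) (y + int n) (y + int n + 1)"
        using \<alpha> by (simp add: edge_def)
      show "\<alpha> \<in> arcs Q"
        using bistring_arrow[OF bsY, of "y + int n"] \<alpha> by simp
      show "vx (t + int n) = tail Q \<alpha>"
        using src by (simp add: vx_def src_letter_def)
      \<comment> \<open>Such an edge would run back along the previous syllable of \<open>X\<close>,
        which would then end in the flipped letter; \<open>no_turn\<close> excludes this.\<close>
      fix q t' show "\<not> edge X \<alpha> q (t + int n) t'"
      proof
        assume "edge X \<alpha> q (t + int n) t'"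
        then have "X (t + int n - 1) = Inv \<alpha>"
          using False unfolding edge_def by auto
        then have "tgt (X (t + int n - 1)) = flip (src (X (t + int n)))"
          using src tgt_syl_inv[of "Dir \<alpha>"] by simp
        with no_turn show False by blast
      qed
    qed
    with right_iff[of n] show ?thesis by simp
  next
    case right_dir: True
    show ?thesis
    proof (cases "direct (X (t - 1 - int m))")
      case True
      then obtain \<alpha> where \<alpha>: "Y (y - 1 - int m) = Inv \<alpha>"
        using dir_left by (cases "Y (y - 1 - int m)") auto
      have e: "y - int m - 1 = y - 1 - int m" "t - int m - 1 = t - 1 - int m"
        by simp_all
      have src: "src (X (t - int m)) = tgt (Inv \<alpha>)"
        using src_left[of m] bistring_tgt[OF bsY, of "y - 1 - int m"] \<alpha> by (simp add: algebra_simps)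
      have "entry (t - int m) (\<pi> (y - int m)) = 0"
      proof (rule entry_no_edge[OF Y])
        show "edge Y \<alpha> (y - 1 - int m) (y - int m) (y - 1 - int m)"
          using \<alpha> by (simp add: edge_def)
        show "\<alpha> \<in> arcs Q"
          using bistring_arrow[OF bsY, of "y - 1 - int m"] \<alpha> by simp
        show "vx (t - int m) = tail Q \<alpha>"
          using src by (simp add: vx_def src_letter_def tgt_letter_def)
        fix q t' show "\<not> edge X \<alpha> q (t - int m) t'"
        proof
          assume "edge X \<alpha> q (t - int m) t'"
          then have "X (t - int m) = Dir \<alpha> \<or> X (t - int m - 1) = Inv \<alpha>"
            unfolding edge_def by auto
          then have "X (t - int m) = Dir \<alpha>"
            using True e by auto
          then have "src (X (t - int m)) = flip (src (X (t - int m)))"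
            using src tgt_syl_inv[of "Dir \<alpha>"] by simp
          with src_neq_flip[OF bistring_arrow[OF X]] show False by blast
        qed
      qed
      with left_iff[of m] show ?thesis by simp
    next
      case False
      have "left_cross X Y t y"
        unfolding left_cross_def using m_less False dir_left by blast
      moreover have "right_cross X Y t y"
        unfolding right_cross_def using n_less right_dir dir_right by blast
      ultimately have "crossing X Y"
        using start by (intro crossingI)
      with nc show ?thesis ..
    qed
  qed
qed

end

text \<open>Both words have period k, and |u| + 1 periods move u onto either ray.\<close>

lemma rays_agree:
  assumes Y: "oriented Y \<pi> w"
    and ray: "(\<forall>n. X (t + int n) = Y (y + int n)) \<or> (\<forall>n. X (t - 1 - int n) = Y (y - 1 - int n))"
  shows "X (t + u) = Y (y + u)"
proof -
  have shift: "X (t + u) = X (t + u + c * k)" "Y (y + u) = Y (y + u + c * k)" for c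
    by (intro cong_X orientedD(2)[OF Y]; simp)+
  have "(\<bar>u\<bar> + 1) * 1 \<le> (\<bar>u\<bar> + 1) * k"
    using k_pos by (intro mult_left_mono) linarith+
  then have pos: "0 \<le> u + (\<bar>u\<bar> + 1) * k" "u + (- (\<bar>u\<bar> + 1)) * k < 0"
    by (auto simp: algebra_simps)
  from ray show ?thesis
  proof
    assume "\<forall>n. X (t + int n) = Y (y + int n)"
    then have "X (t + int (nat (u + (\<bar>u\<bar> + 1) * k))) = Y (y + int (nat (u + (\<bar>u\<bar> + 1) * k)))"
      by blast
    then show ?thesis
      using shift[of "\<bar>u\<bar> + 1"] pos(1) by (simp add: add.assoc)
  next
    assume left: "\<forall>n. X (t - 1 - int n) = Y (y - 1 - int n)"
    define n where "n = nat (- 1 - (u + (- (\<bar>u\<bar> + 1)) * k))"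
    have "t - 1 - int n = t + u + (- (\<bar>u\<bar> + 1)) * k" "y - 1 - int n = y + u + (- (\<bar>u\<bar> + 1)) * k"
      using pos(2) by (simp_all add: n_def)
    with left[rule_format, of n] show ?thesis
      using shift[of "- (\<bar>u\<bar> + 1)"] by simp
  qed
qed

lemma no_period:
  assumes "\<And>u. X (t + u) = X (s + u)"
  shows "t mod k = s mod k"
proof -
  have "X (u + (s - t)) = X u" for u
    using assms[of "u - t"] by (simp add: algebra_simps)
  then have "k dvd s - t"
    using band p by (intro per_period_dvd) (auto simp: is_band_def)
  then show ?thesis
    by (metis mod_eq_dvd_iff)
qed

text \<open>The agreement would be a reflection of the word. Its centre is a syllable, which would
  be its own inverse, or lies between two neighbours, which would be inverse to each other.\<close>

lemma not_own_inverse: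
  assumes "\<And>u. X (t + u) = per (word_inv b) (y + u)"
  shows False
proof -
  have b: "b \<noteq> []"
    using p by auto
  define c where "c = - 1 - y - t"
  have inv: "X (t + u) = syl_inv (X (t + (c - u)))" for u
    using assms[of u] unfolding per_word_inv[OF b] c_def by (simp add: algebra_simps)
  have "c - (c div 2 + c mod 2) = c div 2"
    by presburger
  then have "X (t + c div 2 + c mod 2) = syl_inv (X (t + c div 2))"
    using inv[of "c div 2 + c mod 2"] by (simp only: add.assoc)
  moreover have "c mod 2 = 0 \<or> c mod 2 = 1"
    by presburger
  moreover have "X v \<noteq> syl_inv (X v)" for v
    by (cases "X v") auto
  moreover have "X (v + 1) \<noteq> syl_inv (X v)" for v
    using bistring_neq[OF X, of v] by (metis syl_inv_syl_inv)
  ultimately show False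
    by (metis add.right_neutral)
qed

text \<open>Entries between different vertices vanish because \<open>\<phi>\<close> preserves the
  vertex spaces. Two copies at one vertex have equal letters, and \<open>entry_zero\<close> is used
  for the band with itself, or flipped letters, and it is used for the inverse, where copy s is
  position -s.\<close>

lemma endo_scalar:
  assumes nc: "\<not> crossing X X" "\<not> crossing X (per (word_inv b))" and \<phi>: "\<phi> \<in> endos Q M"
  shows "\<exists>c. \<phi> = scalar_endo Q M c"
proof -
  let ?c = "entry \<phi>"
  have off: "?c t s = 0" if ne: "t mod k \<noteq> s mod k" for t s
  proof (cases "vx t = vx s")
    case False
    then show ?thesis
      using spaceD(2)[OF endo_space[OF \<phi> vx_in_verts basis_vec_space], of t s] unfolding entry_def[OF \<phi>] by auto
  next
    case True
    show ?thesis
    proof (cases "src (X t) = src (X s)")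
      case eq: True
      have "\<not> (\<forall>u. X (t + u) = X (s + u))"
        using no_period ne by blast
      then show ?thesis
        using rays_agree[OF oriented_same, of t s]
        by (intro entry_zero[OF \<phi> oriented_same nc(1) eq]) blast+
    next
      case False
      let ?Y = "per (word_inv b)"
      have b: "b \<noteq> []"
        using p by auto
      have "src (?Y (- s)) = flip (src (X s))"
        using bistring_tgt[OF X, of "s - 1"] by (simp add: per_word_inv[OF b] src_syl_inv)
      moreover have "src (X t) = flip (src (X s))"
      proof -
        have "snd (src (X u)) = 1 \<or> snd (src (X u)) = - 1" for u
          using sign_cases[OF bistring_arrow[OF X, of u]] by (cases "X u") (auto simp: src_letter_def)
        from this[of t] this[of s] show ?thesis
          using False True by (auto simp: src_letter_def flip_def vx_def)
      qed
      ultimately have eq: "src (X t) = src (?Y (- s))" by simp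
      have "\<not> (\<forall>u. X (t + u) = ?Y (- s + u))"
        using not_own_inverse by blast
      then have "?c t (- (- s)) = 0"
        using rays_agree[OF oriented_inverse, of t "- s"]
        by (intro entry_zero[OF \<phi> oriented_inverse nc(2) eq]) blast+
      then show ?thesis by simp
    qed
  qed
  \<comment> \<open>Transport along the same syllable on both sides has the same weight on both
    sides, which cancels.\<close>
  have step: "?c (t + 1) (t + 1) = ?c t t" for t
  proof -
    obtain \<alpha> where "X t = Dir \<alpha> \<or> X t = Inv \<alpha>"
      by (cases "X t") auto
    then have "edge X \<alpha> t t (t + 1) \<or> edge X \<alpha> t (t + 1) t"
      by (auto simp: edge_def)
    then show ?thesis
      using entry_transport[OF \<phi> oriented_same] weight_nonzero[of t] by (metis mult_cancel_left)
  qed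
  have diag: "?c (int n) (int n) = ?c 0 0" for n
  proof (induction n)
    case (Suc n)
    then show ?case
      using step[of "int n"] by (simp add: add.commute)
  qed simp
  define c where "c = ?c 0 0"
  have basis: "\<phi> (vx (int n)) (basis_vec (int n)) = rep_scale M c (basis_vec (int n))" for n
  proof (rule co_eqI)
    show "supported (\<phi> (vx (int n)) (basis_vec (int n)))"
      by (rule spaceD(1)[OF endo_space[OF \<phi> vx_in_verts basis_vec_space]])
    show "supported (rep_scale M c (basis_vec (int n)))"
      by (intro supported_scale) (simp add: basis_vec_def)
    fix s
    have "co (\<phi> (vx (int n)) (basis_vec (int n))) s = ?c (int n) s"
      by (simp add: entry_def[OF \<phi>])
    also have "\<dots> = c * (if s mod k = int n mod k then 1 else 0)"
      using off[of "int n" s] entry_cong[OF \<phi>, of s "int n" "int n"] diag[of n] by (auto simp: c_def)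
    finally show "co (\<phi> (vx (int n)) (basis_vec (int n))) s = co (rep_scale M c (basis_vec (int n))) s"
      by (simp add: co_scale co_basis_vec)
  qed
  interpret vector_space "rep_scale M"
    using is_rep by (simp add: is_rep_def)
  have sub: "subspace (rep_space M v)" if "v \<in> verts Q" for v
    using is_rep that unfolding is_rep_def by blast
  have scalar: "\<phi> v x = rep_scale M c x" if v: "v \<in> verts Q" and x: "x \<in> rep_space M v" for v x
  proof -
    \<comment> \<open>The copies at the vertex v; their basis vectors span its space, so
      \<open>\<phi> v\<close> is determined by \<open>basis\<close> and additivity.\<close>
    define F where "F = {j. j < length b \<and> vx (int j) = v}"
    define part where "part j = rep_scale M (co x (int j)) (basis_vec (int j))" for j
    have part: "part j \<in> rep_space M v" "\<phi> v (part j) = rep_scale M c (part j)" if "j \<in> F" for j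
    proof -
      have u: "basis_vec (int j) \<in> rep_space M v" "vx (int j) = v"
        using that basis_vec_space[of "int j"] by (auto simp: F_def)
      then show "part j \<in> rep_space M v"
        unfolding part_def by (intro subspace_scale[OF sub[OF v]])
      show "\<phi> v (part j) = rep_scale M c (part j)"
        using endo_scale[OF \<phi> v u(1)] basis[of j] u(2) by (simp add: part_def mult.commute)
    qed
    have sum: "sum part G \<in> rep_space M v \<and> \<phi> v (sum part G) = rep_scale M c (sum part G)" if "finite G" "G \<subseteq> F" for G
      using that
    proof (induction G)
      case empty
      then show ?case
        unfolding sum.empty scale_zero_right using zero_space endo_0[OF \<phi> v] by blast
    next
      case (insert j G)
      then have IH: "sum part G \<in> rep_space M v" "\<phi> v (sum part G) = rep_scale M c (sum part G)" and j: "j \<in> F"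
        by auto
      show ?case
        unfolding sum.insert[OF insert.hyps] scale_right_distrib
        using subspace_add[OF sub[OF v] part(1)[OF j] IH(1)]
          endo_add[OF \<phi> v part(1)[OF j] IH(1)] part(2)[OF j] IH(2)
        by metis
    qed
    have "x = sum part F"
    proof (rule co_eqI)
      have co_sum: "co (sum part G) t = (\<Sum>j\<in>G. co (part j) t)" for G t
      proof (induction G rule: infinite_finite_induct)
        case (insert j G)
        then show ?case
          unfolding sum.insert[OF insert.hyps] co_add by metis
      qed (simp_all only: sum.infinite sum.empty co_0 not_False_eq_True)
      show "supported x" "supported (sum part F)"
        using spaceD(1)[OF x] sum[of F] spaceD(1) by (auto simp: F_def)
      fix t
      let ?j = "nat (t mod k)"
      have "co (sum part F) t = (\<Sum>j\<in>F. if j = ?j then co x t else 0)"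
        unfolding co_sum
      proof (rule sum.cong)
        fix j assume "j \<in> F"
        then have "t mod k = int j mod k \<longleftrightarrow> j = ?j"
          by (auto simp: F_def)
        then show "co (part j) t = (if j = ?j then co x t else 0)"
          using cong_co[of t "int j" x] by (auto simp: part_def co_scale co_basis_vec)
      qed simp
      also have "\<dots> = (if ?j \<in> F then co x t else 0)"
        by (simp add: F_def)
      also have "\<dots> = co x t"
        using spaceD(2)[OF x, of t] nat_mod_less[of t] cong_vx[of "int ?j" t] by (auto simp: F_def)
      finally show "co x t = co (sum part F) t" ..
    qed
    then show ?thesis
      using sum[of F] by (simp add: F_def)
  qed
  have "\<phi> = scalar_endo Q M c"
  proof (rule ext, rule ext)
    fix v x
    \<comment> \<open>Elements of \<open>endos\<close> are extensional, so both sides are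
      \<open>undefined\<close> outside the vertices and the vertex spaces.\<close>
    have "\<phi> v = undefined" if "v \<notin> verts Q"
      using \<phi> that by (auto simp: endos_def intro: PiE_arb)
    moreover have "\<phi> v x = undefined" if "v \<in> verts Q" "x \<notin> rep_space M v"
      using \<phi> that by (auto simp: endos_def PiE_iff extensional_def)
    ultimately show "\<phi> v x = scalar_endo Q M c v x"
      using scalar by (auto simp: scalar_endo_def restrict_def)
  qed
  then show ?thesis ..
qed

theorem is_brick_iff: "is_brick Q \<rho> M \<longleftrightarrow> \<not> crossing X X \<and> \<not> crossing X (per (word_inv b))"
proof
  assume brick: "is_brick Q \<rho> M"
  have "\<not> crossing X Y" if Y: "oriented Y \<pi> w" for Y \<pi> w
  proof
    assume "crossing X Y"
    then obtain \<phi> where "\<phi> \<in> endos Q M" "\<And>c. \<phi> \<noteq> scalar_endo Q M c"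
      using crossing_nonscalar_endo[OF Y] by blast
    then show False
      using brick_endo_scalar[OF wf_digraph_axioms brick] by blast
  qed
  from this[OF oriented_same] this[OF oriented_inverse]
  show "\<not> crossing X X \<and> \<not> crossing X (per (word_inv b))" ..
next
  assume nc: "\<not> crossing X X \<and> \<not> crossing X (per (word_inv b))"
  have "co (basis_vec 0) 0 \<noteq> 0"
    by (simp add: co_basis_vec)
  then have "basis_vec 0 \<noteq> 0"
    by auto
  with nc show "is_brick Q \<rho> M"
    using brickI_scalar[OF wf_digraph_axioms is_rep vx_in_verts basis_vec_space _ endo_scalar] by blast
qed

end

theorem theoremC:
  fixes Q :: "('v, 'a) pre_digraph"
    and \<rho> :: "'a list set"
    and \<sigma> \<epsilon> :: "'a \<Rightarrow> int"
    and b :: "'a syllable list"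
    and l p :: nat
    and \<mu> :: "'k::alg_closed_field"
  assumes "string_algebra Q \<rho>"
    and "acyclic_quiver Q"
    and "sign_maps Q \<rho> \<sigma> \<epsilon>"
    and "is_band Q \<rho> b"
    and "l > 0"
    and "\<mu> \<noteq> 0"
    and "p < length b"
  shows "is_brick Q \<rho> (band_module Q b l \<mu> p) \<longleftrightarrow>
    l = 1 \<and>
    weakly_perfectly_clustering Q \<rho> \<sigma> \<epsilon> (band_word Q \<sigma> \<epsilon> b) (band_word Q \<sigma> \<epsilon> b) \<and>
    weakly_perfectly_clustering Q \<rho> \<sigma> \<epsilon> (band_word Q \<sigma> \<epsilon> b) (band_word Q \<sigma> \<epsilon> (word_inv b))"
proof -
  interpret rank_one_band Q \<rho> \<sigma> \<epsilon> b \<mu> p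
    by unfold_locales fact+
  show ?thesis
  proof (cases "l = 1")
    case True
    then show ?thesis
      using is_brick_iff weakly_perfectly_clustering_iff_not_crossing[OF band band]
        weakly_perfectly_clustering_iff_not_crossing[OF band is_band_word_inv[OF band]]
      unfolding M_def by simp
  next
    case False
    have "vx 0 = syl_src Q (b ! 0)"
      by (simp add: vx_def per_def)
    moreover have "b \<noteq> []"
      using p by auto
    ultimately have "\<not> is_brick Q \<rho> (band_module Q b l \<mu> p)"
      using False assms(5) vx_in_verts[of 0] by (intro band_module_not_brick[OF wf_digraph_axioms]) simp_all
    with False show ?thesis by blast
  qed
qed

end
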